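(* Let $P(z)=a_nz^n+\cdots+a_0$ be a polynomial with $a_n\neq 0$, and let $A(z)$ be a non-trivial solution of the differential equation $w''+P(z)w=0$. Let $B(z)$ be a transcendental entire function satisfying $T(r,B)\sim\log M(r,B)$ in a set $E$ of positive upper logarithmic density. Then every non-trivial solution $f$ of $$f''+A(z)f'+B(z)f=0$$ is of infinite order.
   Context: Since $P$ is a polynomial, every solution of $w''+P(z)w=0$ is entire, so $A$ is entire; likewise all solutions of $f''+A(z)f'+B(z)f=0$ with $A,B$ entire are entire functions. "Non-trivial" means not identically zero. For an entire function $f$, $M(r,f)=\max\{|f(z)|:|z|=r\}$, $T(r,f)$ is the Nevanlinna characteristic, and the order is $\rho(f)=\limsup_{r\to\infty}\frac{\log^+ \log^+ M(r,f)}{\log r}\in[0,\infty]$; $f$ is of infinite order if $\rho(f)=\infty$. The upper logarithmic density of a measurable set $E\subset[1,\infty)$ is $\limsup_{r\to\infty}\frac{1}{\log r}\int_{E\cap[1,r]}\frac{dt}{t}$. The notation $T(r,B)\sim\log M(r,B)$ in a set $E$ means $\lim_{r\to\infty,\ r\in E}\frac{T(r,B)}{\log M(r,B)}=1$. *)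

theory Defs
  imports "HOL-Complex_Analysis.Complex_Analysis"
begin

text \<open>Since \<^term>\<open>ln (0::real) = 0\<close> in the library, this gives the usual value 0 at 0.\<close>

definition log_plus :: "real \<Rightarrow> real" where
  "log_plus x = max 0 (ln x)"

text \<open>For continuous \<open>f\<close> and \<open>r \<ge> 0\<close> the circle is compact and nonempty, so the supremum
  is an attained maximum.\<close>

definition max_modulus :: "real \<Rightarrow> (complex \<Rightarrow> complex) \<Rightarrow> real" where
  "max_modulus r f = (SUP z\<in>sphere 0 r. norm (f z))"

definition proximity :: "real \<Rightarrow> (complex \<Rightarrow> complex) \<Rightarrow> real" where
  "proximity r f =
     (LINT \<theta>:{0..2*pi}|lborel. log_plus (norm (f (complex_of_real r * cis \<theta>)))) / (2 * pi)"

text \<open>Poles in the closed disc, counted with multiplicity; at a pole \<^const>\<open>zorder\<close> is minus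
  the multiplicity.\<close>

definition pole_count :: "real \<Rightarrow> (complex \<Rightarrow> complex) \<Rightarrow> nat" where
  "pole_count r f = (\<Sum>z | is_pole f z \<and> norm z \<le> r. nat (- zorder f z))"

definition integrated_pole_count :: "real \<Rightarrow> (complex \<Rightarrow> complex) \<Rightarrow> real" where
  "integrated_pole_count r f =
     (LINT t:{0..r}|lborel. (real (pole_count t f) - real (pole_count 0 f)) / t)
       + real (pole_count 0 f) * ln r"

text \<open>The characteristic of a meromorphic function on the plane. For entire functions there are
  no poles and only the proximity term remains.\<close>

definition nevanlinna_char :: "real \<Rightarrow> (complex \<Rightarrow> complex) \<Rightarrow> real" where
  "nevanlinna_char r f = proximity r f + integrated_pole_count r f"

definition growth_order :: "(complex \<Rightarrow> complex) \<Rightarrow> ereal" where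
  "growth_order f =
     Limsup at_top (\<lambda>r::real. ereal (log_plus (log_plus (max_modulus r f)) / ln r))"

definition upper_log_density :: "real set \<Rightarrow> ereal" where
  "upper_log_density E =
     Limsup at_top (\<lambda>r::real. ereal ((1 / ln r) * (LINT t:E \<inter> {1..r}|lebesgue. 1 / t)))"

text \<open>An entire function is transcendental iff it is not a polynomial.\<close>

definition transcendental_entire :: "(complex \<Rightarrow> complex) \<Rightarrow> bool" where
  "transcendental_entire f \<longleftrightarrow> f holomorphic_on UNIV \<and> \<not> (\<exists>p. \<forall>z. f z = poly p z)"

text \<open>Requiring \<open>f\<close> to be holomorphic makes \<^const>\<open>deriv\<close> the genuine derivative. For entire
  coefficients nothing is lost: every solution is entire.\<close>

definition solves_ode2 ::
    "(complex \<Rightarrow> complex) \<Rightarrow> (complex \<Rightarrow> complex) \<Rightarrow> (complex \<Rightarrow> complex) \<Rightarrow> bool" where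
  "solves_ode2 a b f \<longleftrightarrow>
     f holomorphic_on UNIV \<and> (\<forall>z. deriv (deriv f) z + a z * deriv f z + b z * f z = 0)"

end

theory Submission
  imports Defs "HOL-Real_Asymp.Real_Asymp"
begin

text \<open>
  Suppose that \<open>f\<close> has finite order and put \<open>\<beta> = deg P / 2 + 1\<close>. Dividing out zeros and applying
  Borel--Caratheodory shows that \<open>f'/f\<close> and \<open>f''/f'\<close> are polynomially bounded in \<open>r\<close> off few
  angles, so \<open>\<bar>B\<bar> \<le> r\<^sup>K (r\<^sup>K + \<bar>A\<bar>)\<close> there. Since \<open>T(r,B) \<sim> log M(r,B)\<close> on \<open>E\<close>, every sector contains
  points of the circle \<open>\<bar>z\<bar> = r\<close>, \<open>r \<in> E\<close>, with \<open>log M(r,B) < 2 log\<^sup>+ \<bar>B\<bar>\<close>. This has two consequences.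
  First, \<open>A\<close> is unbounded in every sector, because \<open>B\<close> is transcendental; an elementary cone
  argument for \<open>w'' + P w = 0\<close> on rays then gives \<open>\<bar>A\<bar> \<ge> exp (c r\<^sup>\<beta>)\<close> on a subsector. Second,
  \<open>A\<close> is at most \<open>exp (\<epsilon> r\<^sup>\<beta>)\<close> near a critical ray, so \<open>log M(r,B) = o(r\<^sup>\<beta>)\<close> for \<open>r \<in> E\<close>.

  Hence, for \<open>r \<in> E\<close>, there are arbitrarily dense rays along which \<open>f'/f\<close> is tiny on
  \<open>e\<^sup>-\<^sup>2 r \<le> \<bar>z\<bar> \<le> r\<close>. The maximum principle in the thin sectors between them shows that the increment
  of the convex function \<open>t \<mapsto> log M(e\<^sup>t,f)\<close> over a unit interval ending at \<open>log r\<close> exceeds the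
  previous one by an arbitrarily large prescribed factor. By the positive upper logarithmic
  density of \<open>E\<close> this happens in a positive proportion of all unit intervals, which contradicts
  finite order.
\<close>

subsection \<open>Maximum modulus\<close>

text \<open>The gain per hit must be arbitrarily large because the density d of \<open>E\<close> and
  the growth exponent p of \<open>f\<close> are arbitrary: roughly d N gains by exp q among N unit
  intervals have to beat the square of an increment of size exp ((p + 1) N), so q d must exceed 2 p
  + 2. Dense rays supply such a gain: in a sector of opening 2 pi / (3 k), damping by a function of
  the form exp (- D z^k) reduces the influence of the outer arc by e^-k per unit of log |z|. The
  obstacle is that the exceptional angles change with r, so no ray need be good for all r, and no
  theorem of Phragmen--Lindelof type for a fixed sector applies. Everything therefore happens in one
  window of moduli. It ends at r because M(r,B) is controlled only for r in \<open>E\<close>; the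
  maximum principle carries this bound inwards, and the loss of a constant factor in the exponent is
  covered by o(r^\<beta>). A critical ray here is one where the leading term of z^2 P(z) is
  positive. There w'' + P w = 0 is oscillatory, which is why \<open>A\<close> cannot reach full
  exponential growth near it.\<close>

lemma norm_le_max_modulus:
  assumes "f holomorphic_on UNIV" "norm z = r"
  shows "norm (f z) \<le> max_modulus r f"
proof -
  have "compact ((\<lambda>z. norm (f z)) ` sphere 0 r)"
    by (intro compact_continuous_image continuous_intros
        holomorphic_on_imp_continuous_on[OF holomorphic_on_subset[OF assms(1)]]) auto
  then have "bdd_above ((\<lambda>z. norm (f z)) ` sphere 0 r)"
    by (simp add: bounded_imp_bdd_above compact_imp_bounded)
  then show ?thesis
    unfolding max_modulus_def using assms(2) by (intro cSUP_upper) auto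
qed

lemma max_modulus_le:
  assumes "r \<ge> 0" "\<And>z. norm z = r \<Longrightarrow> norm (f z) \<le> b"
  shows "max_modulus r f \<le> b"
  unfolding max_modulus_def using assms by (intro cSUP_least) auto

lemma norm_le_max_modulus_cball:
  assumes "f holomorphic_on UNIV" "norm z \<le> r"
  shows "norm (f z) \<le> max_modulus r f"
proof (cases "r = 0")
  case True
  then show ?thesis using assms norm_le_max_modulus by auto
next
  case False
  with assms(2) have r: "r > 0" using norm_ge_zero[of z] by linarith
  show ?thesis
  proof (rule maximum_modulus_frontier[where S = "cball 0 r" and f = f])
    show "f holomorphic_on interior (cball 0 r)"
      using assms(1) holomorphic_on_subset by blast
    show "continuous_on (closure (cball 0 r)) f"
      using assms(1) holomorphic_on_imp_continuous_on holomorphic_on_subset by blast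
    show "norm (f w) \<le> max_modulus r f" if "w \<in> frontier (cball 0 r)" for w
      using that r assms(1) by (intro norm_le_max_modulus) auto
  qed (use assms in auto)
qed

lemma max_modulus_mono:
  assumes "f holomorphic_on UNIV" "0 \<le> r" "r \<le> s"
  shows "max_modulus r f \<le> max_modulus s f"
  using assms by (intro max_modulus_le norm_le_max_modulus_cball) auto

lemma max_modulus_pos:
  assumes "f holomorphic_on UNIV" "\<exists>z. f z \<noteq> 0" "r > 0"
  shows "max_modulus r f > 0"
proof (rule ccontr)
  assume "\<not> max_modulus r f > 0"
  then have "norm (f z) \<le> 0" if "norm z \<le> r" for z
    using norm_le_max_modulus_cball[OF assms(1) that] by linarith
  then have "f w = 0" for w
    using analytic_continuation_open[of "ball 0 r" UNIV f "\<lambda>_. 0" w] assms by auto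
  with assms(2) show False by blast
qed

section \<open>Convexity of log M(r) as a function of log r\<close>

lemma strip_point_shift:
  obtains k :: int where "0 \<le> Im s - 2 * pi * k" "Im s - 2 * pi * k \<le> 2 * pi"
proof
  define k where "k = \<lfloor>Im s / (2 * pi)\<rfloor>"
  have "k \<le> Im s / (2 * pi)" "Im s / (2 * pi) \<le> k + 1" unfolding k_def by linarith+
  then show "0 \<le> Im s - 2 * pi * k" "Im s - 2 * pi * k \<le> 2 * pi"
    by (simp_all add: field_simps)
qed

text \<open>Hadamard's theorem for comparison with C r^a. The exponent a is an arbitrary real
  number, so the quotient f(z) / z^a is formed in the coordinate s = log z, where it is
  entire.\<close>

lemma three_circles:
  assumes f: "f holomorphic_on UNIV" and x: "x1 < x" "x < x2"
    and b1: "max_modulus (exp x1) f \<le> C * exp (a * x1)"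
    and b2: "max_modulus (exp x2) f \<le> C * exp (a * x2)"
  shows "max_modulus (exp x) f \<le> C * exp (a * x)"
proof -
  define g where "g s = f (exp s) * exp (- of_real a * s)" for s
  have "(f \<circ> exp) holomorphic_on UNIV"
    by (rule holomorphic_on_compose_gen[OF holomorphic_on_exp f]) auto
  then have g: "g holomorphic_on UNIV"
    unfolding g_def by (intro holomorphic_intros) (simp_all add: o_def)
  have ng: "norm (g s) = norm (f (exp s)) / exp (a * Re s)" for s
    by (simp add: g_def norm_mult exp_minus divide_inverse norm_inverse)
  \<comment> \<open>One period of the strip suffices: \<open>norm (g s)\<close> depends only on
    \<open>exp s\<close> and \<open>Re s\<close>, so it has period 2 pi i even if \<open>g\<close>
    does not, and its supremum over the strip is attained.\<close>
  define K where "K = cbox (Complex x1 0) (Complex x2 (2 * pi))"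
  have "\<exists>s0\<in>K. \<forall>s\<in>K. norm (g s) \<le> norm (g s0)"
    unfolding K_def
  proof (rule continuous_attains_sup)
    show "cbox (Complex x1 0) (Complex x2 (2 * pi)) \<noteq> {}"
      using x by (auto simp: in_cbox_complex_iff intro!: exI[of _ "Complex x1 0"] simp flip: ex_in_conv)
  qed (auto intro!: continuous_on_norm holomorphic_on_imp_continuous_on holomorphic_on_subset[OF g])
  then obtain s0 where s0: "s0 \<in> K" and mx: "\<And>s. s \<in> K \<Longrightarrow> norm (g s) \<le> norm (g s0)" by blast
  have per: "norm (g s) \<le> norm (g s0)" if s: "x1 \<le> Re s" "Re s \<le> x2" for s
  proof -
    obtain k :: int where k: "0 \<le> Im s - 2 * pi * k" "Im s - 2 * pi * k \<le> 2 * pi"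
      by (rule strip_point_shift)
    define s' where "s' = Complex (Re s) (Im s - 2 * pi * k)"
    have e: "exp s' = exp s"
      unfolding exp_eq by (rule exI[of _ "-k"]) (simp add: s'_def complex_eq_iff algebra_simps)
    have "s' \<in> K" using s k by (simp add: K_def in_cbox_complex_iff s'_def)
    from mx[OF this] show ?thesis by (simp add: ng e) (simp add: s'_def)
  qed
  have bd: "norm (g s) \<le> C" if "Re s = x1 \<or> Re s = x2" for s
    using that
  proof
    assume "Re s = x1"
    then show ?thesis using order_trans[OF norm_le_max_modulus[OF f, of "exp s"] b1]
      by (simp add: ng field_simps)
  next
    assume "Re s = x2"
    then show ?thesis using order_trans[OF norm_le_max_modulus[OF f, of "exp s"] b2]
      by (simp add: ng field_simps)
  qed
  have le: "norm (g s0) \<le> C"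
  proof (rule ccontr)
    assume c: "\<not> norm (g s0) \<le> C"
    define S where "S = {s. Re s > x1} \<inter> {s. Re s < x2}"
    have s0S: "s0 \<in> S"
      using s0 bd[of s0] c by (auto simp: S_def K_def in_cbox_complex_iff order_le_less)
    have S: "open S" "connected S"
      unfolding S_def by (auto intro!: open_halfspace_Re_gt open_halfspace_Re_lt convex_connected
          convex_Int convex_halfspace_Re_gt convex_halfspace_Re_lt)
    have "g constant_on S"
      by (rule maximum_modulus_principle[of g S S s0])
        (use S s0S per in \<open>auto simp: S_def intro: holomorphic_on_subset[OF g]\<close>)
    then have const: "g s = g s0" if "s \<in> S" for s
      using that s0S by (auto simp: constant_on_def)
    \<comment> \<open>An interior maximum makes \<open>g\<close> constant, and continuity transports
      its value to a boundary point, where the bound \<open>C\<close> holds.\<close>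
    have cl: "complex_of_real x1 \<in> closure S"
    proof (subst closure_approachable, intro allI impI)
      fix e :: real assume "e > 0"
      define y where "y = x1 + min (e/2) ((x2 - x1)/2)"
      have "complex_of_real y \<in> S" "dist (complex_of_real y) (of_real x1) < e"
        using \<open>e > 0\<close> x by (auto simp: y_def S_def dist_norm min_def field_simps simp flip: of_real_diff)
      then show "\<exists>y\<in>S. dist y (of_real x1) < e" by blast
    qed
    have "g (of_real x1) = g s0"
      by (rule continuous_constant_on_closure[OF _ _ cl])
        (auto intro: const holomorphic_on_imp_continuous_on holomorphic_on_subset[OF g])
    then show False using c bd[of "of_real x1"] by simp
  qed
  show ?thesis
  proof (rule max_modulus_le)
    fix z :: complex assume z: "norm z = exp x"
    then have "z \<noteq> 0" by (metis exp_not_eq_zero norm_zero)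
    then have "exp (Ln z) = z" "Re (Ln z) = x" using z by (simp_all add: Re_Ln)
    with per[of "Ln z"] le ng[of "Ln z"] x have "norm (f z) / exp (a * x) \<le> C" by simp
    then show "norm (f z) \<le> C * exp (a * x)" by (simp add: field_simps)
  qed simp
qed

lemma convex_ln_max_modulus:
  assumes f: "f holomorphic_on UNIV" "\<exists>z. f z \<noteq> 0"
  shows "convex_on UNIV (\<lambda>t. ln (max_modulus (exp t) f))"
proof (rule convex_on_linorderI)
  fix t x y :: real
  assume t: "t > 0" "t < 1" and xy: "x < y"
  define m where "m t = ln (max_modulus (exp t) f)" for t
  have em: "exp (m t) = max_modulus (exp t) f" for t
    unfolding m_def using max_modulus_pos[OF f, of "exp t"] by (intro exp_ln) simp
  \<comment> \<open>The slope of the chord serves as the exponent in \<open>three_circles\<close>,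
    so that equality holds at both end points.\<close>
  define a where "a = (m y - m x) / (y - x)"
  define z where "z = (1 - t) * x + t * y"
  have z': "z = x + t * (y - x)" by (simp add: z_def algebra_simps)
  have z: "x < z" "z < y"
    using mult_pos_pos[of t "y - x"] mult_strict_right_mono[of t 1 "y - x", unfolded mult_1] t xy
    unfolding z' by linarith+
  have my: "m y = m x + a * (y - x)" using xy by (simp add: a_def)
  have "max_modulus (exp z) f \<le> exp (m x - a * x) * exp (a * z)"
    by (rule three_circles[OF f(1) z]) (simp_all add: em[symmetric] my exp_add[symmetric] algebra_simps)
  then have "exp (m z) \<le> exp (m x - a * x + a * z)" by (simp add: em exp_add)
  then have "m z \<le> m x + a * (z - x)" by (simp add: algebra_simps)
  also have "\<dots> = (1 - t) * m x + t * m y" by (simp add: my z' algebra_simps)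
  finally show "ln (max_modulus (exp ((1 - t) *\<^sub>R x + t *\<^sub>R y)) f)
      \<le> (1 - t) * ln (max_modulus (exp x) f) + t * ln (max_modulus (exp y) f)"
    by (simp add: m_def z_def)
qed simp

lemma convex_on_increment_mono:
  fixes \<phi> :: "real \<Rightarrow> real"
  assumes c: "convex_on UNIV \<phi>" and "s \<le> t" "h > 0"
  shows "\<phi> s - \<phi> (s - h) \<le> \<phi> t - \<phi> (t - h)"
proof -
  \<comment> \<open>Both \<open>s\<close> and \<open>t - h\<close> lie between \<open>s - h\<close>
    and \<open>t\<close>, with complementary weights; adding the two convexity inequalities gives
    the claim.\<close>
  define l where "l = h / (t - s + h)"
  have l: "0 \<le> l" "l \<le> 1" and lh: "l * (t - s + h) = h" using assms by (auto simp: l_def)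
  have 1: "\<phi> ((1 - l) *\<^sub>R (s - h) + l *\<^sub>R t) \<le> (1 - l) * \<phi> (s - h) + l * \<phi> t"
    by (rule convex_onD[OF c]) (use l in auto)
  have 2: "\<phi> ((1 - (1 - l)) *\<^sub>R (s - h) + (1 - l) *\<^sub>R t) \<le> (1 - (1 - l)) * \<phi> (s - h) + (1 - l) * \<phi> t"
    by (rule convex_onD[OF c]) (use l in auto)
  have e1: "(1 - l) *\<^sub>R (s - h) + l *\<^sub>R t = s" and e2: "(1 - (1 - l)) *\<^sub>R (s - h) + (1 - l) *\<^sub>R t = t - h"
    using lh by (simp_all add: algebra_simps)
  show ?thesis using 1 2 unfolding e1 e2 by (simp add: algebra_simps)
qed

section \<open>Polynomial growth on a sequence of radii\<close>

lemma frequently_growth_imp_higher_deriv_0: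
  assumes f: "f holomorphic_on UNIV" and n: "real n > \<kappa>"
    and fr: "\<exists>\<^sub>F r in at_top. max_modulus r f \<le> C * r powr \<kappa>"
  shows "(deriv ^^ n) f 0 = 0"
proof (rule ccontr)
  assume nz: "(deriv ^^ n) f 0 \<noteq> 0"
  define c where "c = norm ((deriv ^^ n) f 0) / fact n"
  have c: "c > 0" using nz by (simp add: c_def)
  have lim: "((\<lambda>r. C * r powr (\<kappa> - n)) \<longlongrightarrow> C * 0) at_top"
    using n by (intro tendsto_mult tendsto_const tendsto_neg_powr filterlim_ident) auto
  have "\<forall>\<^sub>F r in at_top. C * r powr (\<kappa> - n) < c" using order_tendstoD(2)[OF lim, of c] c by simp
  with fr have "\<exists>\<^sub>F r in at_top. max_modulus r f \<le> C * r powr \<kappa> \<and> C * r powr (\<kappa> - n) < c \<and> r > 0"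
    by (intro frequently_eventually_frequently eventually_conj eventually_gt_at_top) 
  then obtain r where r: "max_modulus r f \<le> C * r powr \<kappa>" "C * r powr (\<kappa> - n) < c" "r > 0"
    by (blast dest: frequently_ex)
  have "norm ((deriv ^^ n) f 0) \<le> fact n * (C * r powr \<kappa>) / r ^ n"
  proof (rule Cauchy_inequality)
    show "f holomorphic_on ball 0 r" "continuous_on (cball 0 r) f"
      using f holomorphic_on_imp_continuous_on holomorphic_on_subset by blast+
    show "norm (f x) \<le> C * r powr \<kappa>" if "norm (0 - x) = r" for x
      using norm_le_max_modulus[OF f, of x r] r that by auto
  qed (use r in auto)
  then have "c \<le> C * r powr \<kappa> / r ^ n" by (simp add: c_def field_simps)
  also have "\<dots> = C * r powr (\<kappa> - n)" using r by (simp add: powr_diff powr_realpow)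
  finally show False using r by simp
qed

lemma entire_taylor:
  assumes "f holomorphic_on UNIV" and "\<And>n. n > N \<Longrightarrow> (deriv ^^ n) f 0 = 0"
  shows "f z = (\<Sum>n\<le>N. (deriv ^^ n) f 0 / fact n * z ^ n)"
proof -
  have "(\<lambda>n. (deriv ^^ n) f 0 / fact n * (z - 0) ^ n) sums f z"
    by (rule holomorphic_power_series[where r = "norm z + 1"])
      (use assms(1) holomorphic_on_subset in auto)
  moreover have "(\<lambda>n. (deriv ^^ n) f 0 / fact n * (z - 0) ^ n) sums
      (\<Sum>n\<le>N. (deriv ^^ n) f 0 / fact n * (z - 0) ^ n)"
    by (rule sums_finite) (use assms(2) in auto)
  ultimately show ?thesis using sums_unique2 by force
qed

text \<open>Cauchy's estimates need the upper bound only for arbitrarily large radii. Hence the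
  lower bound holds for every large r, in particular for those in any unbounded set.\<close>

lemma transcendental_growth:
  assumes "transcendental_entire f"
  shows "\<forall>\<^sub>F r in at_top. max_modulus r f > C * r powr \<kappa>"
proof (rule ccontr)
  assume "\<not> ?thesis"
  then have fr: "\<exists>\<^sub>F r in at_top. max_modulus r f \<le> C * r powr \<kappa>"
    by (simp add: frequently_def not_le)
  have f: "f holomorphic_on UNIV" using assms by (simp add: transcendental_entire_def)
  define N where "N = nat \<lceil>\<kappa>\<rceil>"
  have "(deriv ^^ n) f 0 = 0" if "n > N" for n
    by (rule frequently_growth_imp_higher_deriv_0[OF f _ fr]) (use that in \<open>unfold N_def; linarith\<close>)
  from entire_taylor[OF f this] have
    "f z = poly (\<Sum>n\<le>N. monom ((deriv ^^ n) f 0 / fact n) n) z" for z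
    by (simp add: poly_sum poly_monom)
  with assms show False unfolding transcendental_entire_def by blast
qed

lemma nonconstant_growth:
  assumes f: "f holomorphic_on UNIV" and nc: "\<not> f constant_on UNIV" and "\<kappa> < 1"
  shows "\<forall>\<^sub>F r in at_top. max_modulus r f > C * r powr \<kappa>"
proof (rule ccontr)
  assume "\<not> ?thesis"
  then have fr: "\<exists>\<^sub>F r in at_top. max_modulus r f \<le> C * r powr \<kappa>"
    by (simp add: frequently_def not_le)
  have "(deriv ^^ n) f 0 = 0" if "n > 0" for n
    by (rule frequently_growth_imp_higher_deriv_0[OF f _ fr]) (use that \<open>\<kappa> < 1\<close> in linarith)
  then have "f z = f 0" for z using entire_taylor[OF f, of 0 z] by simp
  with nc show False unfolding constant_on_def by blast
qed

subsection \<open>Logarithmic derivatives\<close>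

lemma entire_divide_zero:
  assumes "h holomorphic_on UNIV" "h a = 0"
  obtains k where "k holomorphic_on UNIV" "\<And>z::complex. h z = (z - a) * k z"
proof
  show "(\<lambda>z. if z = a then deriv h a else (h z - h a) / (z - a)) holomorphic_on UNIV"
    by (rule pole_lemma_open) (use assms in auto)
qed (use assms in auto)

lemma has_field_derivative_root_product:
  fixes z :: complex
  assumes "z \<notin> set L"
  shows "((\<lambda>z. \<Prod>a\<leftarrow>L. z - a) has_field_derivative (\<Sum>a\<leftarrow>L. 1 / (z - a)) * (\<Prod>a\<leftarrow>L. z - a)) (at z)"
  using assms
proof (induction L)
  case (Cons b L)
  then have "((\<lambda>z. (z - b) * (\<Prod>a\<leftarrow>L. z - a)) has_field_derivative
      1 * (\<Prod>a\<leftarrow>L. z - a) + (\<Sum>a\<leftarrow>L. 1 / (z - a)) * (\<Prod>a\<leftarrow>L. z - a) * (z - b)) (at z)"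
    by (intro DERIV_mult) (auto intro!: derivative_eq_intros)
  moreover have "z - b \<noteq> 0" using Cons.prems by auto
  then have "1 * (\<Prod>a\<leftarrow>L. z - a) + (\<Sum>a\<leftarrow>L. 1 / (z - a)) * (\<Prod>a\<leftarrow>L. z - a) * (z - b)
      = (1 / (z - b) + (\<Sum>a\<leftarrow>L. 1 / (z - a))) * ((z - b) * (\<Prod>a\<leftarrow>L. z - a))"
    by (simp add: distrib_right)
  ultimately show ?case by (simp only: list.map sum_list.Cons prod_list.Cons)
qed simp

lemma norm_root_product_ge:
  fixes z :: complex
  assumes "set L \<subseteq> cball 0 R" "norm z = 8 * R" "R > 0"
  shows "(7 * R) ^ length L \<le> norm (\<Prod>a\<leftarrow>L. z - a)"
  using assms(1)
proof (induction L)
  case (Cons a L)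
  have "norm z - norm a \<le> norm (z - a)" by (rule norm_triangle_ineq2)
  then have "7 * R \<le> norm (z - a)" using Cons.prems assms(2) by auto
  then show ?case using Cons assms(3) by (auto simp: norm_mult intro!: mult_mono)
qed simp

lemma norm_root_product_0_le:
  assumes "set L \<subseteq> cball 0 R" "R > 0"
  shows "norm (\<Prod>a\<leftarrow>L. 0 - a :: complex) \<le> R ^ length L"
  using assms(1)
proof (induction L)
  case (Cons a L)
  then show ?case using assms(2) by (auto simp: norm_mult intro!: mult_mono)
qed simp

text \<open>Each root contributes at least 7 R on the circle of radius 8 R but at most R at the
  origin, which yields a factor 7 per root. Taking z = 0 bounds the number of roots; other z bound
  the cofactor relative to \<open>h 0\<close>.\<close>

lemma zero_free_part_bound:
  assumes h: "h holomorphic_on UNIV" and F: "\<And>z. F z = (\<Prod>a\<leftarrow>L. z - a) * h z"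
    and L: "set L \<subseteq> cball 0 R" and R: "R > 0"
    and M: "\<And>z. norm z = 8 * R \<Longrightarrow> norm (F z) \<le> M" and z: "norm z \<le> 8 * R"
  shows "7 ^ length L * norm (F 0) * norm (h z) \<le> M * norm (h 0)"
proof -
  have "norm (h z) \<le> M / (7 * R) ^ length L"
  proof (rule order_trans[OF norm_le_max_modulus_cball[OF h z]], rule max_modulus_le)
    fix w :: complex assume w: "norm w = 8 * R"
    have "(7 * R) ^ length L * norm (h w) \<le> norm (\<Prod>a\<leftarrow>L. w - a) * norm (h w)"
      by (intro mult_right_mono norm_root_product_ge[OF L w R]) auto
    also have "\<dots> = norm (F w)" by (simp add: F norm_mult)
    also have "\<dots> \<le> M" by (rule M[OF w])
    finally show "norm (h w) \<le> M / (7 * R) ^ length L"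
      using R by (simp add: field_simps)
  qed (use R in simp)
  then have 1: "norm (h z) * (7 * R) ^ length L \<le> M" using R by (simp add: field_simps)
  have "norm (F 0) \<le> R ^ length L * norm (h 0)"
    using norm_root_product_0_le[OF L R] unfolding F norm_mult
    by (rule mult_right_mono) (rule norm_ge_zero)
  then have "norm (F 0) * (norm (h z) * (7 * R) ^ length L) \<le> (R ^ length L * norm (h 0)) * M"
    by (rule mult_mono) (use 1 R in auto)
  then have "R ^ length L * (7 ^ length L * norm (F 0) * norm (h z)) \<le> R ^ length L * (M * norm (h 0))"
    by (simp add: power_mult_distrib mult_ac)
  then show ?thesis using R by (simp only: mult_le_cancel_left_pos zero_less_power)
qed

text \<open>By the case z = 0 of \<open>zero_free_part_bound\<close>, the number of linear factors
  that can be split off is bounded. A factorisation with the most factors leaves a cofactor without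
  zeros in the disc. The list records multiplicities.\<close>

lemma factor_zeros_disc:
  assumes F: "F holomorphic_on UNIV" and F0: "F 0 \<noteq> 0" and R: "R > 0"
  obtains L h where "h holomorphic_on UNIV" "\<And>z. F z = (\<Prod>a\<leftarrow>L. z - a) * h z"
    "set L \<subseteq> cball 0 R" "\<And>z. norm z \<le> R \<Longrightarrow> h z \<noteq> 0"
proof -
  define Q where "Q N \<longleftrightarrow> (\<exists>L h. length L = N \<and> h holomorphic_on UNIV \<and>
      (\<forall>z. F z = (\<Prod>a\<leftarrow>L. z - a) * h z) \<and> set L \<subseteq> cball 0 R)" for N
  have Q0: "Q 0" unfolding Q_def using F by (intro exI[of _ "[]"] exI[of _ F]) auto
  define M where "M = max_modulus (8 * R) F"
  obtain b :: nat where b: "M / norm (F 0) < real b" using reals_Archimedean2 by blast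
  have bound: "N \<le> b" if "Q N" for N
  proof -
    from that obtain L h where L: "length L = N" "h holomorphic_on UNIV"
      "\<And>z. F z = (\<Prod>a\<leftarrow>L. z - a) * h z" "set L \<subseteq> cball 0 R" unfolding Q_def by auto
    have "7 ^ length L * norm (F 0) * norm (h 0) \<le> M * norm (h 0)"
      unfolding M_def
      by (rule zero_free_part_bound[OF L(2,3,4) R norm_le_max_modulus[OF F]]) (use R in auto)
    moreover have "h 0 \<noteq> 0" using F0 L(3)[of 0] by auto
    ultimately have "7 ^ N * norm (F 0) \<le> M" using L(1) by simp
    then have "7 ^ N \<le> M / norm (F 0)" using F0 by (simp add: field_simps)
    moreover have "real N < 7 ^ N"
      using of_nat_less_two_power[of N, where 'a = real] power_mono[of 2 "7::real" N] by linarith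
    ultimately show ?thesis using b by linarith
  qed
  obtain N where N: "Q N" "\<And>N'. Q N' \<Longrightarrow> N' \<le> N"
    using Nat.ex_has_greatest_nat[of Q 0 b] Q0 bound by blast
  from N(1) obtain L h where L: "length L = N" "h holomorphic_on UNIV"
      "\<And>z. F z = (\<Prod>a\<leftarrow>L. z - a) * h z" "set L \<subseteq> cball 0 R" unfolding Q_def by auto
  have "h a \<noteq> 0" if a: "norm a \<le> R" for a
  proof
    assume "h a = 0"
    then obtain k where k: "k holomorphic_on UNIV" "\<And>z. h z = (z - a) * k z"
      using entire_divide_zero[OF L(2)] by metis
    have "Q (Suc N)" unfolding Q_def
      by (rule exI[of _ "a # L"], rule exI[of _ k]) (use L k a in auto)
    with N(2) show False by fastforce
  qed
  with L show ?thesis using that by blast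
qed

text \<open>The map u -> u / (2 \<Lambda> - u) sends the half plane Re u < \<Lambda> into the unit
  disc and fixes 0, so Schwarz's lemma applies after rescaling.\<close>

lemma Borel_Caratheodory_ball:
  assumes l: "l holomorphic_on ball 0 R" and l0: "l 0 = 0" and R: "R > 0"
    and Re: "\<And>z. norm z < R \<Longrightarrow> Re (l z) < \<Lambda>" and z: "norm z < R"
  shows "norm (l z) * (R - norm z) \<le> 2 * \<Lambda> * norm z"
proof -
  have \<Lambda>: "\<Lambda> > 0" using Re[of 0] R l0 by simp
  have nz: "2 * of_real \<Lambda> - l z \<noteq> 0" if "norm z < R" for z
    using Re[OF that] \<Lambda> by (auto simp: complex_eq_iff)
  define \<phi> where "\<phi> w = l (of_real R * w) / (2 * of_real \<Lambda> - l (of_real R * w))" for w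
  have dom: "norm (of_real R * w) < R" if "norm w < 1" for w :: complex
    using that R by (simp add: norm_mult)
  have hol: "(l \<circ> (\<lambda>w. of_real R * w)) holomorphic_on ball 0 1"
    by (rule holomorphic_on_compose_gen[OF _ l]) (use dom in \<open>auto intro!: holomorphic_intros\<close>)
  have "\<phi> holomorphic_on ball 0 1"
    unfolding \<phi>_def using hol nz dom by (intro holomorphic_intros) (auto simp: o_def)
  moreover have "norm (\<phi> w) < 1" if w: "norm w < 1" for w
  proof -
    define u where "u = l (of_real R * w)"
    have "(norm u)\<^sup>2 < (norm (2 * of_real \<Lambda> - u))\<^sup>2"
      using mult_strict_left_mono[OF Re[OF dom[OF w]] \<Lambda>] unfolding u_def[symmetric] cmod_power2
      by (simp add: power2_eq_square algebra_simps)
    then have "norm u < norm (2 * of_real \<Lambda> - u)" by (rule power_less_imp_less_base) simp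
    then show ?thesis unfolding \<phi>_def u_def[symmetric] by (simp add: norm_divide divide_less_eq_1) 
  qed
  moreover have "\<phi> 0 = 0" by (simp add: \<phi>_def l0)
  ultimately have "norm (\<phi> (z / of_real R)) \<le> norm (z / of_real R)"
    using z R by (intro Schwarz_Lemma(1)) (auto simp: norm_divide)
  then have "norm (l z) * R \<le> norm z * norm (2 * of_real \<Lambda> - l z)"
    using nz[OF z] R by (simp add: \<phi>_def norm_divide field_simps)
  also have "\<dots> \<le> norm z * (2 * \<Lambda> + norm (l z))"
    using norm_triangle_ineq4[of "2 * of_real \<Lambda>" "l z"] \<Lambda> by (intro mult_left_mono) auto
  finally show ?thesis by (simp add: algebra_simps)
qed

text \<open>With F = p h, p the product over the zeros, F'/F splits into a sum of at most \<Lambda>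
  terms 1 / (z - a) and the term h'/h. The latter is handled through a holomorphic logarithm of the
  zero-free \<open>h\<close>. A single number \<Lambda> controls both the number of zeros and the
  growth of \<open>h\<close>.\<close>

lemma log_deriv_disc:
  assumes F: "F holomorphic_on UNIV" and F0: "F 0 \<noteq> 0" and R: "R > 0"
    and M: "max_modulus (8 * R) F < exp \<Lambda> * norm (F 0)"
  obtains Z where "finite Z" "real (card Z) \<le> \<Lambda>"
    "\<And>d z. d > 0 \<Longrightarrow> norm z \<le> R / 2 \<Longrightarrow> (\<And>a. a \<in> Z \<Longrightarrow> d \<le> norm (z - a)) \<Longrightarrow>
       F z \<noteq> 0 \<and> norm (deriv F z) \<le> (24 * \<Lambda> / R + \<Lambda> / d) * norm (F z)"
proof -
  obtain L h where h: "h holomorphic_on UNIV" and Fh: "\<And>z. F z = (\<Prod>a\<leftarrow>L. z - a) * h z"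
    and L: "set L \<subseteq> cball 0 R" and hnz: "\<And>z. norm z \<le> R \<Longrightarrow> h z \<noteq> 0"
    using factor_zeros_disc[OF F F0 R] by metis
  have hb: "7 ^ length L * norm (h z) < exp \<Lambda> * norm (h 0)" if "norm z \<le> 8 * R" for z
  proof -
    have "7 ^ length L * norm (F 0) * norm (h z) \<le> max_modulus (8 * R) F * norm (h 0)"
      by (rule zero_free_part_bound[OF h Fh L R _ that]) (rule norm_le_max_modulus[OF F])
    also have "\<dots> < exp \<Lambda> * norm (F 0) * norm (h 0)"
      using hnz[of 0] R by (intro mult_strict_right_mono M) auto
    finally show ?thesis using F0 by (simp add: mult_ac)
  qed
  \<comment> \<open>Follows from e < 7.\<close>
  have N: "real (length L) \<le> \<Lambda>"
  proof -
    have "7 ^ length L < exp \<Lambda>" using hb[of 0] hnz[of 0] R by simp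
    moreover have "exp (real (length L)) \<le> 7 ^ length L"
      using exp_le by (simp add: exp_of_nat_mult[of "length L" "1::real", simplified] power_mono)
    ultimately have "exp (real (length L)) < exp \<Lambda>" by linarith
    then show ?thesis by simp
  qed
  then have \<Lambda>0: "\<Lambda> \<ge> 0" by linarith
  have hb': "norm (h z) < exp \<Lambda> * norm (h 0)" if "norm z \<le> 8 * R" for z
  proof -
    have "1 * norm (h z) \<le> 7 ^ length L * norm (h z)" by (intro mult_right_mono) auto
    with hb[OF that] show ?thesis by linarith
  qed
  have hd: "norm (deriv h z) \<le> 24 * \<Lambda> / R * norm (h z)" if z: "norm z \<le> R / 2" for z
  proof -
    have "contractible (ball (0::complex) R)" by (simp add: convex_imp_contractible)
    then obtain g where g: "g holomorphic_on ball 0 R" and gh: "\<And>w. w \<in> ball 0 R \<Longrightarrow> h w = exp (g w)"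
      using contractible_imp_holomorphic_log[of h "ball 0 R"] holomorphic_on_subset[OF h] hnz by auto
    define l where "l w = g w - g 0" for w
    have l: "l holomorphic_on ball 0 R" unfolding l_def using g by (intro holomorphic_intros)
    have el: "exp (l w) = h w / h 0" if "norm w < R" for w
      using gh[of w] gh[of 0] that R by (simp add: l_def exp_diff)
    have lRe: "Re (l w) < \<Lambda>" if w: "norm w < R" for w
    proof -
      have "exp (Re (l w)) = norm (h w) / norm (h 0)"
        using el[OF w] by (metis norm_divide norm_exp_eq_Re)
      also have "\<dots> < exp \<Lambda>" using hb'[of w] w hnz[of 0] R by (simp add: divide_less_eq)
      finally show ?thesis by simp
    qed
    \<comment> \<open>The distance R / 4 to the boundary turns 2 \<Lambda> * 3 R / 4 into 6
      \<Lambda>; Cauchy's estimate on a disc of radius R / 4 then gives the constant 24.\<close>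
    have lb: "norm (l w) \<le> 6 * \<Lambda>" if w: "norm w \<le> 3 * R / 4" for w
    proof -
      have "norm (l w) * (R / 4) \<le> norm (l w) * (R - norm w)"
        using w by (intro mult_left_mono) auto
      also have "\<dots> \<le> 2 * \<Lambda> * norm w"
        by (rule Borel_Caratheodory_ball[OF l _ R lRe]) (use w R in \<open>auto simp: l_def\<close>)
      also have "\<dots> \<le> 2 * \<Lambda> * (3 * R / 4)" using w \<Lambda>0 by (intro mult_left_mono) auto
      finally show ?thesis using R by simp
    qed
    have in34: "norm w \<le> 3 * R / 4" if "norm (z - w) \<le> R / 4" for w
      using z that norm_triangle_ineq4[of z "z - w"] by simp
    have "norm ((deriv ^^ 1) l z) \<le> fact 1 * (6 * \<Lambda>) / (R / 4) ^ 1"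
    proof (rule Cauchy_inequality)
      have sub: "cball z (R / 4) \<subseteq> ball 0 R" using in34 R by (force simp: dist_norm)
      show "l holomorphic_on ball z (R / 4)"
        using l sub by (meson ball_subset_cball holomorphic_on_subset subset_trans)
      show "continuous_on (cball z (R / 4)) l"
        using l sub holomorphic_on_imp_continuous_on holomorphic_on_subset by blast
    qed (use R lb in34 in auto)
    then have "norm (deriv l z) \<le> 24 * \<Lambda> / R" by simp
    moreover have "deriv h z = deriv l z * h z"
    proof (rule DERIV_imp_deriv)
      have zR: "z \<in> ball 0 R" using z R by simp
      have "(l has_field_derivative deriv l z) (at z)"
        using l zR by (intro holomorphic_derivI) auto
      then have "((\<lambda>w. h 0 * exp (l w)) has_field_derivative h 0 * (exp (l z) * deriv l z)) (at z)"
        by (auto intro!: derivative_eq_intros)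
      then have "(h has_field_derivative h 0 * (exp (l z) * deriv l z)) (at z)"
        by (rule has_field_derivative_transform_within_open[OF _ open_ball zR])
          (use el hnz[of 0] R in auto)
      then show "(h has_field_derivative deriv l z * h z) (at z)"
        using el[of z] zR hnz[of 0] R by (simp add: mult_ac)
    qed
    ultimately show ?thesis using mult_right_mono[of _ "24 * \<Lambda> / R" "norm (h z)"]
      by (simp only: norm_mult norm_ge_zero)
  qed
  show ?thesis
  proof
    show "finite (set L)" "real (card (set L)) \<le> \<Lambda>"
      using N card_length[of L] by auto
    fix d z assume d: "d > 0" and z: "norm z \<le> R / 2" and far: "\<And>a. a \<in> set L \<Longrightarrow> d \<le> norm (z - a)"
    have zL: "z \<notin> set L" using far[of z] d by auto
    define S where "S = (\<Sum>a\<leftarrow>L. 1 / (z - a))"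
    define p where "p w = (\<Prod>a\<leftarrow>L. w - a)" for w
    have "p z \<noteq> 0" using zL by (auto simp: p_def prod_list_zero_iff)
    then have "F z \<noteq> 0" using hnz[of z] z R by (simp add: Fh p_def)
    moreover have "norm (deriv F z) \<le> (24 * \<Lambda> / R + \<Lambda> / d) * norm (F z)"
    proof -
      have "(h has_field_derivative deriv h z) (at z)"
        using h by (intro holomorphic_derivI[of _ UNIV]) auto
      then have "((\<lambda>z. p z * h z) has_field_derivative S * p z * h z + deriv h z * p z) (at z)"
        using has_field_derivative_root_product[OF zL] unfolding p_def[symmetric] S_def[symmetric]
        by (intro DERIV_mult)
      moreover have "F = (\<lambda>z. p z * h z)" using Fh by (simp add: fun_eq_iff p_def)
      ultimately have "deriv F z = S * F z + deriv h z * p z"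
        by (intro DERIV_imp_deriv) (simp add: mult_ac)
      then have "norm (deriv F z) \<le> norm S * norm (F z) + norm (deriv h z) * norm (p z)"
        by (metis norm_mult norm_triangle_ineq)
      also have "norm S \<le> \<Lambda> / d"
      proof -
        have "norm S \<le> (\<Sum>a\<leftarrow>L. norm (1 / (z - a)))"
          unfolding S_def by (induction L) (auto intro: order_trans[OF norm_triangle_ineq])
        also have "\<dots> \<le> (\<Sum>a\<leftarrow>L. 1 / d)"
          using far d zL by (intro sum_list_mono) (auto simp: norm_divide intro!: divide_left_mono mult_pos_pos)
        also have "\<dots> \<le> \<Lambda> / d" using N d by (simp add: sum_list_triv divide_right_mono)
        finally show ?thesis .
      qed
      also have "norm (deriv h z) * norm (p z) \<le> 24 * \<Lambda> / R * norm (h z) * norm (p z)"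
        by (intro mult_right_mono hd z) auto
      also have "\<dots> = 24 * \<Lambda> / R * norm (F z)" by (simp add: Fh p_def norm_mult)
      finally show ?thesis by (simp add: algebra_simps mult_right_mono)
    qed
    ultimately show "F z \<noteq> 0 \<and> norm (deriv F z) \<le> (24 * \<Lambda> / R + \<Lambda> / d) * norm (F z)" by blast
  qed
qed

section \<open>Logarithmic derivatives of functions of finite order\<close>

definition finite_growth :: "(complex \<Rightarrow> complex) \<Rightarrow> bool" where
  "finite_growth F \<longleftrightarrow> (\<exists>k. \<forall>\<^sub>F r in at_top. max_modulus r F \<le> exp (r ^ k))"

lemma growth_order_finite_growth:
  assumes F: "F holomorphic_on UNIV" "\<exists>z. F z \<noteq> 0" and ord: "growth_order F \<noteq> \<infinity>"
  shows "finite_growth F"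
proof -
  have "growth_order F < \<infinity>" using ord by (cases "growth_order F") auto
  then obtain \<rho> where \<rho>: "growth_order F < ereal \<rho>"
    using less_PInf_Ex_of_nat[of "growth_order F"] by (metis PInfty_neq_ereal(1) ereal_infinity_cases ord less_PInf_Ex_of_nat)
  define k where "k = nat \<lceil>\<rho>\<rceil>"
  have ev: "\<forall>\<^sub>F r in at_top. ereal (log_plus (log_plus (max_modulus r F)) / ln r) < ereal \<rho>"
    using \<rho> unfolding growth_order_def by (rule Limsup_lessD)
  have "\<forall>\<^sub>F r in at_top. max_modulus r F \<le> exp (r ^ k)"
    using ev eventually_gt_at_top[of 1]
  proof eventually_elim
    case (elim r)
    then have lr: "ln r > 0" by simp
    have pos: "max_modulus r F > 0" using elim by (intro max_modulus_pos F) auto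
    have "log_plus (log_plus (max_modulus r F)) < \<rho> * ln r" using elim lr by (simp add: field_simps)
    then have l: "ln (log_plus (max_modulus r F)) < \<rho> * ln r" by (simp add: log_plus_def)
    have "log_plus (max_modulus r F) \<le> r ^ k"
    \<comment> \<open>If \<open>log_plus\<close> vanishes, the bound on its \<open>ln\<close>
      carries no information, because \<open>ln 0 = 0\<close>.\<close>
    proof (cases "log_plus (max_modulus r F) > 0")
      case True
      then have "log_plus (max_modulus r F) = exp (ln (log_plus (max_modulus r F)))" by simp
      also have "\<dots> \<le> exp (real k * ln r)"
      proof -
        have "\<rho> \<le> k" unfolding k_def by linarith
        then have "\<rho> * ln r \<le> k * ln r" using lr by (intro mult_right_mono) auto
        with l show ?thesis by simp
      qed
      also have "\<dots> = r ^ k" using elim by (simp add: exp_of_nat_mult)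
      finally show ?thesis .
    next
      case False
      moreover have "0 \<le> r ^ k" using elim by simp
      ultimately show ?thesis by linarith
    qed
    then have "ln (max_modulus r F) \<le> r ^ k" by (simp add: log_plus_def)
    then show ?case using pos by (metis exp_le_cancel_iff exp_ln)
  qed
  then show ?thesis unfolding finite_growth_def by blast
qed

lemma max_modulus_deriv_le:
  assumes F: "F holomorphic_on UNIV" and "r \<ge> 0"
  shows "max_modulus r (deriv F) \<le> max_modulus (r + 1) F"
proof (rule max_modulus_le)
  fix z :: complex assume z: "norm z = r"
  have "norm ((deriv ^^ 1) F z) \<le> fact 1 * max_modulus (r + 1) F / 1 ^ 1"
  proof (rule Cauchy_inequality)
    show "F holomorphic_on ball z 1" "continuous_on (cball z 1) F"
      using F holomorphic_on_imp_continuous_on holomorphic_on_subset by blast+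
    show "norm (F x) \<le> max_modulus (r + 1) F" if "norm (z - x) = 1" for x
      using z that norm_triangle_ineq4[of z "z - x"] by (intro norm_le_max_modulus_cball F) simp
  qed simp
  then show "norm (deriv F z) \<le> max_modulus (r + 1) F" by simp
qed (use assms in simp)

lemma finite_growth_deriv:
  assumes F: "F holomorphic_on UNIV" and "finite_growth F"
  shows "finite_growth (deriv F)"
proof -
  obtain k where k: "\<forall>\<^sub>F r in at_top. max_modulus r F \<le> exp (r ^ k)"
    using assms(2) unfolding finite_growth_def by blast
  have "\<forall>\<^sub>F r :: real in at_top. max_modulus (r + 1) F \<le> exp ((r + 1) ^ k)"
    by (rule eventually_compose_filterlim[OF k]) real_asymp
  then have "\<forall>\<^sub>F r in at_top. max_modulus r (deriv F) \<le> exp (r ^ (2 * k))"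
    using eventually_ge_at_top[of 2]
  proof eventually_elim
    case (elim r)
    have "2 * r \<le> r * r" using elim by (intro mult_right_mono) auto
    then have "r + 1 \<le> r\<^sup>2" unfolding power2_eq_square using elim by linarith
    then have "(r + 1) ^ k \<le> r ^ (2 * k)" unfolding power_mult using elim by (intro power_mono) auto
    then have "exp ((r + 1) ^ k) \<le> exp (r ^ (2 * k))" by simp
    moreover have "max_modulus r (deriv F) \<le> max_modulus (r + 1) F"
      using elim by (intro max_modulus_deriv_le F) simp
    ultimately show ?case using elim(1) by linarith
  qed
  then show ?thesis unfolding finite_growth_def by blast
qed

text \<open>\<open>log_deriv_disc\<close> normalises at the origin, where \<open>F\<close> may
  vanish. It is applied to a translate centred at a point of the unit circle where \<open>F\<close>
  does not vanish; this changes all radii by at most 1.\<close>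

lemma log_deriv_far_from_zeros:
  assumes F: "F holomorphic_on UNIV" "\<exists>z. F z \<noteq> 0" and fg: "finite_growth F"
  shows "\<exists>K::nat. \<forall>\<^sub>F R in at_top. \<exists>Z. finite Z \<and> real (card Z) \<le> R ^ K \<and>
    (\<forall>d z. 0 < d \<longrightarrow> d \<le> 1 \<longrightarrow> norm z \<le> R \<longrightarrow> (\<forall>a\<in>Z. d \<le> norm (z - a)) \<longrightarrow>
       F z \<noteq> 0 \<and> norm (deriv F z) \<le> R ^ K / d * norm (F z))"
proof -
  obtain k where k: "\<forall>\<^sub>F r in at_top. max_modulus r F \<le> exp (r ^ k)"
    using fg unfolding finite_growth_def by blast
  obtain c where c: "norm c = 1" "F c \<noteq> 0"
    using max_modulus_pos[OF F, of 1] max_modulus_le[of 1 F 0] by force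
  define G where "G z = F (z + c)" for z
  have "(F \<circ> (\<lambda>z. z + c)) holomorphic_on UNIV"
    by (rule holomorphic_on_compose_gen[OF _ F(1)]) (auto intro!: holomorphic_intros)
  then have G: "G holomorphic_on UNIV" unfolding G_def by (simp add: o_def)
  have dG: "deriv G z = deriv F (z + c)" for z
  proof (rule DERIV_imp_deriv)
    have "(F has_field_derivative deriv F (z + c)) (at (z + c))"
      using F(1) by (intro holomorphic_derivI[of _ UNIV]) auto
    then show "(G has_field_derivative deriv F (z + c)) (at z)"
      unfolding G_def by (simp add: DERIV_shift)
  qed
  have MG: "max_modulus s G \<le> max_modulus (s + 1) F" if "s \<ge> 0" for s
  proof (rule max_modulus_le[OF that])
    fix z :: complex assume "norm z = s"
    then show "norm (G z) \<le> max_modulus (s + 1) F"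
      unfolding G_def using norm_triangle_ineq[of z c] c by (intro norm_le_max_modulus_cball F) simp
  qed
  have ev: "\<forall>\<^sub>F R :: real in at_top. max_modulus (16 * R + 17) F \<le> exp ((16 * R + 17) ^ k)"
    by (rule eventually_compose_filterlim[OF k]) real_asymp
  have "\<forall>\<^sub>F R in at_top. \<exists>Z. finite Z \<and> real (card Z) \<le> R ^ (k + 2) \<and>
    (\<forall>d z. 0 < d \<longrightarrow> d \<le> 1 \<longrightarrow> norm z \<le> R \<longrightarrow> (\<forall>a\<in>Z. d \<le> norm (z - a)) \<longrightarrow>
       F z \<noteq> 0 \<and> norm (deriv F z) \<le> R ^ (k + 2) / d * norm (F z))"
    using ev eventually_ge_at_top[of 25] eventually_ge_at_top[of "33 ^ k + 1 - ln (norm (F c))"]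
      eventually_ge_at_top[of "33 ^ k"]
  proof eventually_elim
    case (elim R)
    \<comment> \<open>Then |z - c| is at most R + 1 = R' / 2, and the circle of radius 8 R' about c
      lies in the disc of radius 16 R + 17.\<close>
    define R' where "R' = 2 * R + 2"
    have R: "R \<ge> 25" "R' > 0" using elim by (auto simp: R'_def)
    \<comment> \<open>One power of R beyond the growth exponent absorbs the factor 33^k and the
      constant \<open>ln (norm (F c))\<close>; a further power, with R at least 25 = 24 + 1, absorbs
      the constants of \<open>log_deriv_disc\<close>.\<close>
    define \<Lambda> where "\<Lambda> = R ^ (k + 1)"
    have "max_modulus (8 * R') G \<le> max_modulus (16 * R + 17) F"
      using MG[of "8 * R'"] R by (simp add: R'_def algebra_simps)
    also have "\<dots> \<le> exp ((33 * R) ^ k)"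
      using R by (intro order_trans[OF elim(1)] iffD2[OF exp_le_cancel_iff] power_mono) auto
    also have "\<dots> < exp (\<Lambda> + ln (norm (F c)))"
    proof -
      have "1 * (R - 33 ^ k) \<le> R ^ k * (R - 33 ^ k)"
        using R elim by (intro mult_right_mono one_le_power) auto
      then have "R - 33 ^ k \<le> \<Lambda> - (33 * R) ^ k"
        by (simp add: \<Lambda>_def power_mult_distrib algebra_simps)
      then show ?thesis using elim by simp
    qed
    also have "\<dots> = exp \<Lambda> * norm (G 0)" using c by (simp add: exp_add G_def)
    finally have M: "max_modulus (8 * R') G < exp \<Lambda> * norm (G 0)" .
    obtain Z where Z: "finite Z" "real (card Z) \<le> \<Lambda>"
      "\<And>d z. d > 0 \<Longrightarrow> norm z \<le> R' / 2 \<Longrightarrow> (\<And>a. a \<in> Z \<Longrightarrow> d \<le> norm (z - a)) \<Longrightarrow>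
         G z \<noteq> 0 \<and> norm (deriv G z) \<le> (24 * \<Lambda> / R' + \<Lambda> / d) * norm (G z)"
      by (rule log_deriv_disc[OF G _ R(2) M]) (use c in \<open>auto simp: G_def\<close>)
    have \<Lambda>0: "\<Lambda> > 0" using R by (simp add: \<Lambda>_def)
    have R\<Lambda>: "R ^ (k + 2) = R * \<Lambda>" by (simp add: \<Lambda>_def)
    show ?case
    proof (rule exI[of _ "(\<lambda>a. a + c) ` Z"], intro conjI allI impI)
      have "1 * \<Lambda> \<le> R * \<Lambda>" using R \<Lambda>0 by (intro mult_right_mono) auto
      then show "real (card ((\<lambda>a. a + c) ` Z)) \<le> R ^ (k + 2)"
        unfolding R\<Lambda> using Z(2) by (simp add: card_image)
      fix d z
      assume d: "0 < d" "d \<le> 1" and z: "norm z \<le> R"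
        and far: "\<forall>a\<in>(\<lambda>a. a + c) ` Z. d \<le> norm (z - a)"
      have *: "G (z - c) \<noteq> 0 \<and> norm (deriv G (z - c)) \<le> (24 * \<Lambda> / R' + \<Lambda> / d) * norm (G (z - c))"
      proof (rule Z(3)[OF d(1)])
        show "norm (z - c) \<le> R' / 2" using norm_triangle_ineq4[of z c] z c by (simp add: R'_def)
        show "d \<le> norm (z - c - a)" if "a \<in> Z" for a
          using far that by (auto simp: algebra_simps)
      qed
      then show "F z \<noteq> 0" by (simp add: G_def)
      have "24 * \<Lambda> / R' \<le> 24 * \<Lambda> / d"
        using R d \<Lambda>0 by (intro divide_left_mono) (auto simp: R'_def)
      moreover have "24 * \<Lambda> / d + \<Lambda> / d = 25 * \<Lambda> / d" by (simp add: field_simps)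
      ultimately have "24 * \<Lambda> / R' + \<Lambda> / d \<le> 25 * \<Lambda> / d" by linarith
      also have "\<dots> \<le> R ^ (k + 2) / d"
        unfolding R\<Lambda> using R \<Lambda>0 d by (intro divide_right_mono mult_right_mono) auto
      finally have "(24 * \<Lambda> / R' + \<Lambda> / d) * norm (F z) \<le> R ^ (k + 2) / d * norm (F z)"
        by (rule mult_right_mono) simp
      then show "norm (deriv F z) \<le> R ^ (k + 2) / d * norm (F z)"
        using * by (simp add: G_def dG)
    qed (use Z in auto)
  qed
  then show ?thesis by blast
qed

section \<open>Exceptional angles\<close>

lemma abs_sin_ge_half:
  assumes "\<bar>x::real\<bar> \<le> 1"
  shows "\<bar>x\<bar> / 2 \<le> \<bar>sin x\<bar>"
proof -
  have *: "y / 2 \<le> sin y" if "0 \<le> y" "y \<le> 1" for y :: real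
  proof -
    have "sin 0 - 0 / 2 \<le> sin y - y / 2"
    proof (rule DERIV_nonneg_imp_nondecreasing[OF that(1)])
      fix x assume x: "0 \<le> x" "x \<le> y"
      \<comment> \<open>On [0,1] the cosine is at least 1/2, because 1 < pi / 3.\<close>
      have "cos (pi / 3) \<le> cos x" using x that pi_gt3 by (intro cos_monotone_0_pi_le) auto
      then show "\<exists>d. ((\<lambda>x. sin x - x / 2) has_real_derivative d) (at x) \<and> 0 \<le> d"
        by (intro exI[of _ "cos x - 1 / 2"]) (auto intro!: derivative_eq_intros simp: cos_60)
    qed
    then show ?thesis by simp
  qed
  show ?thesis using *[of x] *[of "-x"] assms by (cases "x \<ge> 0") auto
qed

text \<open>After rotation by -\<phi> the second point is real, so the imaginary part of the
  difference sees only the angle. The radius \<open>s\<close> is therefore unrestricted, and the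
  angular width of a disc of radius d met outside the unit disc is O(d) wherever its centre
  lies.\<close>

lemma angle_le_of_close:
  assumes t: "t \<ge> 1" and le1: "\<bar>\<theta> - \<phi>\<bar> \<le> 1"
    and c: "norm (of_real t * cis \<theta> - a) < d" "norm (of_real s * cis \<phi> - a) < d"
  shows "\<bar>\<theta> - \<phi>\<bar> \<le> 4 * d"
proof -
  have "norm (of_real t * cis \<theta> - of_real s * cis \<phi>) < 2 * d"
    using norm_triangle_ineq4[of "of_real t * cis \<theta> - a" "of_real s * cis \<phi> - a"] c by simp
  also have "norm (of_real t * cis \<theta> - of_real s * cis \<phi>)
      = norm ((of_real t * cis \<theta> - of_real s * cis \<phi>) * cis (- \<phi>))"
    by (simp add: norm_mult)
  also have "(of_real t * cis \<theta> - of_real s * cis \<phi>) * cis (- \<phi>) = of_real t * cis (\<theta> - \<phi>) - of_real s"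
    by (simp add: left_diff_distrib mult.assoc cis_mult)
  finally have "norm (of_real t * cis (\<theta> - \<phi>) - of_real s) < 2 * d" .
  moreover have "\<bar>Im (of_real t * cis (\<theta> - \<phi>) - of_real s)\<bar> \<le> norm (of_real t * cis (\<theta> - \<phi>) - of_real s)"
    by (rule abs_Im_le_cmod)
  ultimately have "t * \<bar>sin (\<theta> - \<phi>)\<bar> < 2 * d" using t by (simp add: abs_mult)
  then have "\<bar>sin (\<theta> - \<phi>)\<bar> < 2 * d"
    using t mult_right_mono[of 1 t "\<bar>sin (\<theta> - \<phi>)\<bar>"] by simp
  then show ?thesis using abs_sin_ge_half[OF le1] by simp
qed

lemma bad_angles:
  fixes Z :: "complex set"
  assumes "finite Z" "u \<le> v" "v \<le> u + 1" "d > 0"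
  obtains Bad where "compact Bad" "measure lborel Bad \<le> 8 * d * real (card Z)"
    "\<And>\<theta> t a. \<theta> \<in> {u..v} - Bad \<Longrightarrow> t \<ge> 1 \<Longrightarrow> a \<in> Z \<Longrightarrow> d \<le> norm (of_real t * cis \<theta> - a)"
proof -
  define near where "near a \<theta> \<longleftrightarrow> \<theta> \<in> {u..v} \<and> (\<exists>t\<ge>1. norm (of_real t * cis \<theta> - a) < d)" for a \<theta>
  \<comment> \<open>Any single bad angle serves as the centre: by \<open>angle_le_of_close\<close>
    all other bad angles for \<open>a\<close> are within 4 d of it.\<close>
  define J where "J a = (if \<exists>\<theta>. near a \<theta> then cball (SOME \<theta>. near a \<theta>) (4 * d) else {})" for a
  have J: "\<theta> \<in> J a" if near: "near a \<theta>" for a \<theta>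
  proof -
    define \<phi> where "\<phi> = (SOME \<theta>. near a \<theta>)"
    have \<phi>: "near a \<phi>" unfolding \<phi>_def using near by (rule someI)
    have "\<bar>\<theta> - \<phi>\<bar> \<le> 4 * d"
      using near \<phi> assms unfolding near_def by (auto intro!: angle_le_of_close)
    then show ?thesis using near unfolding J_def \<phi>_def by (auto simp: dist_real_def abs_minus_commute)
  qed
  have mJ: "measure lborel (J a) \<le> 8 * d" and sJ: "J a \<in> sets lborel" and cJ: "compact (J a)" for a
    using assms(4) by (auto simp: J_def cball_eq_atLeastAtMost)
  show ?thesis
  proof
    show "compact (\<Union>a\<in>Z. J a)" using assms(1) cJ by (intro compact_UN) auto
    have "measure lborel (\<Union>a\<in>Z. J a) \<le> (\<Sum>a\<in>Z. measure lborel (J a))"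
      using assms(1) sJ by (intro measure_UNION_le) auto
    also have "\<dots> \<le> (\<Sum>a\<in>Z. 8 * d)" by (intro sum_mono mJ)
    finally show "measure lborel (\<Union>a\<in>Z. J a) \<le> 8 * d * real (card Z)" by (simp add: mult_ac)
    show "d \<le> norm (of_real t * cis \<theta> - a)"
      if "\<theta> \<in> {u..v} - (\<Union>a\<in>Z. J a)" "t \<ge> 1" "a \<in> Z" for \<theta> t a
      using that J[of a \<theta>] unfolding near_def by (metis DiffE UN_I not_less)
  qed
qed

text \<open>The radius d about the zeros is taken as small as a negative power of R. The excluded
  angles then have small total measure, while the bound on the logarithmic derivative loses only a
  further power of R.\<close>

lemma log_deriv_rays:
  assumes F: "F holomorphic_on UNIV" "\<exists>z. F z \<noteq> 0" "finite_growth F"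
    and uv: "u \<le> v" "v \<le> u + 1" and e: "e > 0"
  shows "\<exists>K::nat. \<forall>\<^sub>F R in at_top. \<exists>Bad. compact Bad \<and> measure lborel Bad \<le> e \<and>
    (\<forall>\<theta>\<in>{u..v} - Bad. \<forall>t\<in>{1..R}. F (of_real t * cis \<theta>) \<noteq> 0 \<and>
       norm (deriv F (of_real t * cis \<theta>)) \<le> R ^ K * norm (F (of_real t * cis \<theta>)))"
proof -
  obtain K :: nat where K: "\<forall>\<^sub>F R in at_top. \<exists>Z. finite Z \<and> real (card Z) \<le> R ^ K \<and>
    (\<forall>d z. 0 < d \<longrightarrow> d \<le> 1 \<longrightarrow> norm z \<le> R \<longrightarrow> (\<forall>a\<in>Z. d \<le> norm (z - a)) \<longrightarrow>
       F z \<noteq> 0 \<and> norm (deriv F z) \<le> R ^ K / d * norm (F z))"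
    using log_deriv_far_from_zeros[OF F] by blast
  have "\<forall>\<^sub>F R in at_top. \<exists>Bad. compact Bad \<and> measure lborel Bad \<le> e \<and>
    (\<forall>\<theta>\<in>{u..v} - Bad. \<forall>t\<in>{1..R}. F (of_real t * cis \<theta>) \<noteq> 0 \<and>
       norm (deriv F (of_real t * cis \<theta>)) \<le> R ^ (2 * K + 1) * norm (F (of_real t * cis \<theta>)))"
    using K eventually_ge_at_top[of 1] eventually_ge_at_top[of "8 / e"] eventually_ge_at_top[of e]
  proof eventually_elim
    case (elim R)
    then obtain Z where Z: "finite Z" "real (card Z) \<le> R ^ K"
      "\<And>d z. 0 < d \<Longrightarrow> d \<le> 1 \<Longrightarrow> norm z \<le> R \<Longrightarrow> (\<forall>a\<in>Z. d \<le> norm (z - a)) \<Longrightarrow>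
         F z \<noteq> 0 \<and> norm (deriv F z) \<le> R ^ K / d * norm (F z)" by blast
    \<comment> \<open>With at most R^K zeros the excluded measure is 8 d R^K = 8 / R.\<close>
    define d where "d = 1 / (R ^ K * R)"
    have RK: "R ^ K \<ge> 1" using elim by simp
    have RK1: "R ^ K * R \<ge> 1" using elim mult_mono[of 1 "R ^ K" 1 R] RK by simp
    have d: "d > 0" "d \<le> 1" using RK1 by (auto simp: d_def)
    obtain Bad where Bad: "compact Bad" "measure lborel Bad \<le> 8 * d * real (card Z)"
      "\<And>\<theta> t a. \<theta> \<in> {u..v} - Bad \<Longrightarrow> t \<ge> 1 \<Longrightarrow> a \<in> Z \<Longrightarrow> d \<le> norm (of_real t * cis \<theta> - a)"
      using bad_angles[OF Z(1) uv d(1)] by blast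
    show ?case
    proof (rule exI[of _ Bad], intro conjI ballI)
      have "8 * d * real (card Z) \<le> 8 * d * R ^ K" using Z d by (intro mult_left_mono) auto
      also have "\<dots> = 8 / R" using RK by (simp add: d_def)
      also have "\<dots> \<le> e" using elim e by (simp add: field_simps)
      finally show "measure lborel Bad \<le> e" using Bad by linarith
      fix \<theta> t assume \<theta>: "\<theta> \<in> {u..v} - Bad" and t: "t \<in> {1..R}"
      define z where "z = of_real t * cis \<theta>"
      have *: "F z \<noteq> 0 \<and> norm (deriv F z) \<le> R ^ K / d * norm (F z)"
        using Bad(3)[OF \<theta>] t by (intro Z(3) d) (auto simp: z_def norm_mult)
      then show "F (of_real t * cis \<theta>) \<noteq> 0" by (simp add: z_def)
      have "R ^ K / d = R ^ (2 * K + 1)" by (simp add: d_def mult_2 power_add)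
      with * show "norm (deriv F (of_real t * cis \<theta>)) \<le> R ^ (2 * K + 1) * norm (F (of_real t * cis \<theta>))"
        by (simp add: z_def)
    qed (rule Bad(1))
  qed
  then show ?thesis by blast
qed

subsection \<open>The equation for \<open>A\<close> along rays\<close>

lemma poly_lead_term_approx:
  fixes P :: "complex poly"
  assumes "\<epsilon> > 0"
  obtains r0 where "r0 \<ge> 1"
    "\<And>z. norm z \<ge> r0 \<Longrightarrow> norm (poly P z - lead_coeff P * z ^ degree P) \<le> \<epsilon> * norm z ^ degree P"
proof -
  define n S where "n = degree P" and "S = (\<Sum>i<n. norm (coeff P i))"
  have S0: "S \<ge> 0" unfolding S_def by (intro sum_nonneg) auto
  show ?thesis
  proof (rule that[of "max 1 (S / \<epsilon>)"])
    fix z :: complex assume z: "norm z \<ge> max 1 (S / \<epsilon>)"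
    have "poly P z - lead_coeff P * z ^ n = (\<Sum>i<n. coeff P i * z ^ i)"
      unfolding poly_altdef n_def by (simp add: lessThan_Suc_atMost[symmetric])
    also have "norm \<dots> \<le> (\<Sum>i<n. norm (coeff P i) * (norm z ^ n / norm z))"
    proof (rule sum_norm_le)
      fix i assume i: "i \<in> {..<n}"
      have "norm z ^ i \<le> norm z ^ (n - 1)" using z i by (intro power_increasing) auto
      also have "\<dots> = norm z ^ n / norm z" using z i by (cases n) auto
      finally show "norm (coeff P i * z ^ i) \<le> norm (coeff P i) * (norm z ^ n / norm z)"
        unfolding norm_mult norm_power by (rule mult_left_mono) simp
    qed
    also have "\<dots> = S / norm z * norm z ^ n" by (simp add: S_def sum_distrib_right sum_divide_distrib)
    also have "\<dots> \<le> \<epsilon> * norm z ^ n"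
    proof (rule mult_right_mono)
      have "S \<le> \<epsilon> * norm z" using z assms by (simp add: field_simps)
      moreover have "norm z > 0" using z by linarith
      ultimately show "S / norm z \<le> \<epsilon>" by (simp add: field_simps)
    qed simp
    finally show "norm (poly P z - lead_coeff P * z ^ degree P) \<le> \<epsilon> * norm z ^ degree P"
      by (simp add: n_def)
  qed simp
qed

lemma norm_square_has_derivative:
  fixes X :: "real \<Rightarrow> complex"
  assumes "(X has_vector_derivative X') (at t)"
  shows "((\<lambda>t. (norm (X t))\<^sup>2) has_real_derivative 2 * Re (cnj (X t) * X')) (at t)"
proof -
  have D: "((\<lambda>t. Re (X t)) has_real_derivative Re X') (at t)" "((\<lambda>t. Im (X t)) has_real_derivative Im X') (at t)"
    using bounded_linear.has_vector_derivative[OF bounded_linear_Re assms]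
      bounded_linear.has_vector_derivative[OF bounded_linear_Im assms]
    by (simp_all add: has_real_derivative_iff_has_vector_derivative)
  show ?thesis unfolding cmod_power2
    by (rule DERIV_cong[OF DERIV_add[OF DERIV_power[OF D(1), of 2] DERIV_power[OF D(2), of 2]]])
      (simp add: algebra_simps)
qed

text \<open>Gronwall's inequality through the integrating factor exp (- G). As \<open>K\<close> may
  have either sign, applying it to a negated function gives upper bounds.\<close>

lemma exp_comparison:
  fixes K G :: "real \<Rightarrow> real"
  assumes "s \<le> t" and K: "\<And>x. s \<le> x \<Longrightarrow> x \<le> t \<Longrightarrow> (K has_real_derivative K' x) (at x)"
    and G: "\<And>x. s \<le> x \<Longrightarrow> x \<le> t \<Longrightarrow> (G has_real_derivative g x) (at x)"
    and le: "\<And>x. s \<le> x \<Longrightarrow> x \<le> t \<Longrightarrow> g x * K x \<le> K' x"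
  shows "K s * exp (G t - G s) \<le> K t"
proof -
  have "K s * exp (- G s) \<le> K t * exp (- G t)"
  proof (rule DERIV_nonneg_imp_nondecreasing[OF assms(1)])
    fix x assume x: "s \<le> x" "x \<le> t"
    have "((\<lambda>x. K x * exp (- G x)) has_real_derivative (K' x - g x * K x) * exp (- G x)) (at x)"
      using K[OF x] G[OF x] by (auto intro!: derivative_eq_intros simp: algebra_simps)
    then show "\<exists>y. ((\<lambda>x. K x * exp (- G x)) has_real_derivative y) (at x) \<and> 0 \<le> y"
      using le[OF x] by fastforce
  qed
  then have "K s * exp (- G s) * exp (G t) \<le> K t * exp (- G t) * exp (G t)"
    by (rule mult_right_mono) simp
  then show ?thesis by (simp add: exp_diff exp_minus field_simps)
qed

text \<open>If the real part vanished on an interval, so would its derivative, which is a multiple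
  of the imaginary part, forcing l = 0.\<close>

lemma noncritical_direction:
  assumes "l \<noteq> 0" "\<beta> > 0" "u < v"
  obtains \<theta> where "u < \<theta>" "\<theta> < v" "Re (l * cis (\<beta> * \<theta>)) \<noteq> 0"
proof (rule ccontr)
  note direction = that
  assume neg: "\<not> thesis"
  have z: "Re (l * cis (\<beta> * \<theta>)) = 0" if "\<theta> \<in> {u<..<v}" for \<theta>
    using direction[of \<theta>] that neg by fastforce
  define m where "m = (u + v) / 2"
  have m: "m \<in> {u<..<v}" using assms(3) by (simp add: m_def)
  have re: "Re (l * cis (\<beta> * \<theta>)) = Re l * cos (\<beta> * \<theta>) - Im l * sin (\<beta> * \<theta>)" for \<theta> by simp
  have D: "((\<lambda>\<theta>. Re (l * cis (\<beta> * \<theta>))) has_real_derivative - \<beta> * Im (l * cis (\<beta> * m))) (at m)"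
    unfolding re by (auto intro!: derivative_eq_intros simp: algebra_simps)
  have "((\<lambda>\<theta>. 0) has_real_derivative - \<beta> * Im (l * cis (\<beta> * m))) (at m)"
    by (rule has_field_derivative_transform_within_open[OF D open_greaterThanLessThan m]) (rule z)
  then have "- \<beta> * Im (l * cis (\<beta> * m)) = 0" using DERIV_unique DERIV_const by blast
  then have "l * cis (\<beta> * m) = 0" using assms(2) z[OF m] by (simp add: complex_eq_iff)
  then show False using assms(1) by simp
qed

lemma entire_ray_derivative:
  assumes "f holomorphic_on UNIV"
  shows "((\<lambda>t. f (of_real t * cis \<theta>)) has_vector_derivative cis \<theta> * deriv f (of_real t * cis \<theta>)) (at t)"
proof -
  have dz: "((\<lambda>t. of_real t * cis \<theta>) has_vector_derivative cis \<theta>) (at t)"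
    by (rule has_vector_derivative_eq_rhs[OF has_vector_derivative_mult_left[OF has_vector_derivative_of_real[OF DERIV_ident]]])
      simp
  have "(f has_field_derivative deriv f (of_real t * cis \<theta>)) (at (of_real t * cis \<theta>))"
    using assms by (intro holomorphic_derivI[of _ UNIV]) auto
  from field_vector_diff_chain_at[OF dz this] show ?thesis by (simp add: o_def)
qed

text \<open>The factor \<open>cis \<theta>\<close> makes the second function the derivative along
  the ray, so the equation becomes W'' = - e^(2 i \<theta>) P W in the real variable t.\<close>

lemma ray_derivatives:
  assumes A: "A holomorphic_on UNIV" and ode: "\<And>z. deriv (deriv A) z = - poly P z * A z"
  shows "((\<lambda>t. A (of_real t * cis \<theta>)) has_vector_derivative cis \<theta> * deriv A (of_real t * cis \<theta>)) (at t)"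
    and "((\<lambda>t. cis \<theta> * deriv A (of_real t * cis \<theta>)) has_vector_derivative
           - cis (2 * \<theta>) * poly P (of_real t * cis \<theta>) * A (of_real t * cis \<theta>)) (at t)"
proof -
  show "((\<lambda>t. A (of_real t * cis \<theta>)) has_vector_derivative cis \<theta> * deriv A (of_real t * cis \<theta>)) (at t)"
    by (rule entire_ray_derivative[OF A])
  have "deriv A holomorphic_on UNIV" using A by (intro holomorphic_deriv) auto
  from entire_ray_derivative[OF this]
  have "((\<lambda>t. deriv A (of_real t * cis \<theta>)) has_vector_derivative
      cis \<theta> * (- poly P (of_real t * cis \<theta>) * A (of_real t * cis \<theta>))) (at t)"
    by (simp only: ode)
  from has_vector_derivative_mult_right[OF this, of "cis \<theta>"]
  show "((\<lambda>t. cis \<theta> * deriv A (of_real t * cis \<theta>)) has_vector_derivative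
           - cis (2 * \<theta>) * poly P (of_real t * cis \<theta>) * A (of_real t * cis \<theta>)) (at t)"
    by (simp add: mult.assoc[symmetric] cis_mult)
qed

text \<open>By \<open>crit\<close> the equation on the ray is close to W'' = - |a| t^n W. Its energy
  |W'|^2 + |a| t^n |W|^2 is nearly conserved: the main terms cancel in the derivative, leaving only
  the error of the approximation and the derivative of t^n. Both are small relative to t^(n/2) times
  the energy on a narrow sector.\<close>

lemma coefficient_small_near_critical_ray:
  assumes P0: "P \<noteq> 0" and A: "A holomorphic_on UNIV"
    and ode: "\<And>z. deriv (deriv A) z = - poly P z * A z"
    and crit: "lead_coeff P * cis (real (degree P + 2) * \<theta>0) = of_real (norm (lead_coeff P))" and e: "\<epsilon> > 0"
  shows "\<exists>u v. u < v \<and> v \<le> u + 1 \<and> (\<exists>t1. \<forall>\<theta>\<in>{u..v}. \<forall>t\<ge>t1.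
    norm (A (of_real t * cis \<theta>)) \<le> exp (\<epsilon> * t powr (real (degree P) / 2 + 1)))"
proof -
  define n a where "n = degree P" and "a = lead_coeff P"
  define \<beta> where "\<beta> = real n / 2 + 1"
  have a: "norm a > 0" using P0 by (simp add: a_def)
  \<comment> \<open>Chosen so that the cross term 4 e1 h^2 |V| |W| equals \<epsilon>/4 h times 2 |V|
    (sqrt |a| h |W|), which the arithmetic-geometric inequality bounds by the energy.\<close>
  define e1 where "e1 = sqrt (norm a) * \<epsilon> / 8"
  have e1: "e1 > 0" using a e by (simp add: e1_def)
  obtain r0 where r0: "r0 \<ge> 1" "\<And>z. norm z \<ge> r0 \<Longrightarrow> norm (poly P z - a * z ^ n) \<le> e1 * norm z ^ n"
    using poly_lead_term_approx[OF e1, of P] unfolding a_def n_def by blast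
  have "isCont (\<lambda>\<theta>. a * cis (real (n + 2) * \<theta>)) \<theta>0"
    unfolding cis_conv_exp by (intro continuous_intros)
  moreover have "a * cis (real (n + 2) * \<theta>0) = of_real (norm a)"
    using crit by (simp add: a_def n_def)
  ultimately obtain \<delta> where \<delta>: "\<delta> > 0" "\<And>\<theta>. \<bar>\<theta> - \<theta>0\<bar> < \<delta> \<Longrightarrow> norm (a * cis (real (n + 2) * \<theta>) - of_real (norm a)) < e1"
    using e1 unfolding continuous_at_eps_delta dist_norm real_norm_def by metis
  define u v where "u = \<theta>0 - min (\<delta> / 2) (1 / 2)" and "v = \<theta>0 + min (\<delta> / 2) (1 / 2)"
  \<comment> \<open>Beyond 4 n / \<epsilon> the relative derivative n / t of t^n is at most
    \<epsilon>/4.\<close>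
  define t0 where "t0 = max r0 (4 * n / \<epsilon>)"
  have t0: "t0 \<ge> 1" using r0 by (simp add: t0_def)
  define C where "C = (max_modulus t0 (deriv A))\<^sup>2 + norm a * t0 ^ n * (max_modulus t0 A)\<^sup>2"
  have main: "(norm (A (of_real t * cis \<theta>)))\<^sup>2 \<le> C / norm a * exp (\<epsilon> / 2 * t powr \<beta>)"
    if \<theta>: "\<theta> \<in> {u..v}" and t: "t \<ge> t0" for \<theta> t
  proof -
    define W where "W t = A (of_real t * cis \<theta>)" for t
    define V where "V t = cis \<theta> * deriv A (of_real t * cis \<theta>)" for t
    define Q where "Q t = - cis (2 * \<theta>) * poly P (of_real t * cis \<theta>)" for t
    have dW: "(W has_vector_derivative V t) (at t)" for t
      using ray_derivatives(1)[OF A ode, of \<theta> t] by (simp add: W_def[abs_def] V_def)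
    have dV: "(V has_vector_derivative Q t * W t) (at t)" for t
      using ray_derivatives(2)[OF A ode, of \<theta> t] by (simp add: W_def V_def[abs_def] Q_def)
    define G where "G t = (norm (V t))\<^sup>2 + norm a * t ^ n * (norm (W t))\<^sup>2" for t
    define G' where "G' t = 2 * Re (cnj (V t) * (Q t * W t)) + norm a * (real n * t ^ (n - 1) * (norm (W t))\<^sup>2
        + t ^ n * (2 * Re (cnj (W t) * V t)))" for t
    have dG: "(G has_real_derivative G' t) (at t)" for t
      unfolding G_def[abs_def] G'_def
      by (rule DERIV_cong[OF DERIV_add[OF norm_square_has_derivative[OF dV]
              DERIV_mult[OF DERIV_cmult[OF DERIV_pow] norm_square_has_derivative[OF dW]]]])
        (simp add: distrib_left mult_ac)
    have Gle: "G' x \<le> \<epsilon> / 2 * x powr (\<beta> - 1) * G x" if x: "x \<ge> t0" for x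
    proof -
      have x1: "x \<ge> 1" using x t0 by simp
      define h where "h = x powr (\<beta> - 1)"
      have h2: "h\<^sup>2 = x ^ n"
        using x1 by (simp add: h_def \<beta>_def powr_power powr_realpow)
      have h1: "h \<ge> 1" unfolding h_def \<beta>_def using x1 by (intro ge_one_powr_ge_zero) auto
      define \<eta> where "\<eta> = - Q x - norm a * h\<^sup>2"
      have z: "norm (of_real x * cis \<theta>) = x" using x1 by (simp add: norm_mult)
      have "\<eta> = cis (2 * \<theta>) * (poly P (of_real x * cis \<theta>) - a * (of_real x * cis \<theta>) ^ n)
          + x ^ n * (a * cis (real (n + 2) * \<theta>) - norm a)"
      proof -
        have "cis (real (n + 2) * \<theta>) = cis (2 * \<theta>) * cis \<theta> ^ n"
          unfolding Complex.DeMoivre cis_mult by (simp add: algebra_simps)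
        then show ?thesis unfolding \<eta>_def Q_def h2
          by (simp add: algebra_simps)
      qed
      also have "norm \<dots> \<le> norm (poly P (of_real x * cis \<theta>) - a * (of_real x * cis \<theta>) ^ n)
          + x ^ n * norm (a * cis (real (n + 2) * \<theta>) - norm a)"
        by (rule order_trans[OF norm_triangle_ineq]) (use x1 in \<open>simp add: norm_mult norm_power\<close>)
      also have "\<dots> \<le> e1 * x ^ n + x ^ n * e1"
      proof (intro add_mono mult_left_mono)
        show "norm (poly P (of_real x * cis \<theta>) - a * (of_real x * cis \<theta>) ^ n) \<le> e1 * x ^ n"
          using r0(2)[of "of_real x * cis \<theta>"] x z by (simp add: t0_def)
        have "\<bar>\<theta> - \<theta>0\<bar> < \<delta>" using \<theta> \<delta>(1) by (auto simp: u_def v_def min_def split: if_splits)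
        then show "norm (a * cis (real (n + 2) * \<theta>) - norm a) \<le> e1" using \<delta>(2) by force
      qed (use x1 in auto)
      finally have \<eta>: "norm \<eta> \<le> 2 * e1 * h\<^sup>2" by (simp add: h2)
      define w s where "w = norm (W x)" and "s = norm (V x)"
      have "Re (cnj (V x) * (Q x * W x)) = - norm a * h\<^sup>2 * Re (cnj (W x) * V x) - Re (cnj (V x) * (\<eta> * W x))"
      proof -
        have "Q x = - of_real (norm a * h\<^sup>2) - \<eta>" by (simp add: \<eta>_def)
        then have "cnj (V x) * (Q x * W x) = - (of_real (norm a * h\<^sup>2) * (cnj (V x) * W x)) - cnj (V x) * (\<eta> * W x)"
          by (simp only: left_diff_distrib right_diff_distrib mult_minus_left mult_minus_right mult_ac)
        moreover have "Re (cnj (V x) * W x) = Re (cnj (W x) * V x)" by simp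
        moreover have "Re (of_real r * u) = r * Re u" for r u by simp
        ultimately show ?thesis by (simp only: minus_complex.simps uminus_complex.simps mult_minus_left)
      qed
      then have "G' x = - 2 * Re (cnj (V x) * (\<eta> * W x)) + norm a * (n * x ^ (n - 1) * w\<^sup>2)"
        unfolding G'_def by (simp add: h2 w_def algebra_simps)
      also have "\<dots> \<le> 2 * (s * (2 * e1 * h\<^sup>2) * w) + norm a * (n * x ^ (n - 1) * w\<^sup>2)"
      proof -
        have "- Re (cnj (V x) * (\<eta> * W x)) \<le> norm (cnj (V x) * (\<eta> * W x))"
          using abs_Re_le_cmod[of "cnj (V x) * (\<eta> * W x)"] by linarith
        also have "\<dots> = s * norm \<eta> * w" by (simp add: norm_mult s_def w_def)
        also have "\<dots> \<le> s * (2 * e1 * h\<^sup>2) * w"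
          using \<eta> by (intro mult_right_mono mult_left_mono) (auto simp: s_def w_def)
        finally show ?thesis by simp
      qed
      also have "2 * (s * (2 * e1 * h\<^sup>2) * w) = \<epsilon> / 4 * h * (2 * s * (sqrt (norm a) * h * w))"
        by (simp add: e1_def power2_eq_square)
      also have "\<dots> \<le> \<epsilon> / 4 * h * G x"
      proof (rule mult_left_mono)
        have "(sqrt (norm a) * h * w)\<^sup>2 = norm a * x ^ n * w\<^sup>2" by (simp add: power_mult_distrib h2)
        then show "2 * s * (sqrt (norm a) * h * w) \<le> G x"
          using sum_squares_bound[of s "sqrt (norm a) * h * w"] by (simp add: G_def s_def w_def)
      qed (use e h1 in auto)
      also have "norm a * (n * x ^ (n - 1) * w\<^sup>2) \<le> \<epsilon> / 4 * h * G x"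
      proof -
        have "x ^ (n - 1) * real n = real n / x * x ^ n" using x1 by (cases n) auto
        then have "norm a * (n * x ^ (n - 1) * w\<^sup>2) = real n / x * (norm a * x ^ n * w\<^sup>2)"
          by (simp add: mult_ac)
        also have "\<dots> \<le> real n / x * G x"
          using x1 by (intro mult_left_mono) (auto simp: G_def w_def)
        also have "\<dots> \<le> \<epsilon> / 4 * h * G x"
        proof (rule mult_right_mono)
          have "real n / x \<le> \<epsilon> / 4 * 1" using x x1 e by (simp add: t0_def field_simps)
          also have "\<dots> \<le> \<epsilon> / 4 * h" using e h1 by (intro mult_left_mono) auto
          finally show "real n / x \<le> \<epsilon> / 4 * h" .
          show "0 \<le> G x" using x1 by (simp add: G_def)
        qed
        finally show ?thesis .
      qed
      finally show ?thesis by (simp add: h_def mult_ac)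
    qed
    have \<beta>1: "\<beta> \<ge> 1" by (simp add: \<beta>_def)
    \<comment> \<open>The comparison lemma bounds from below, so it is applied to the negated
      energy.\<close>
    have "- G t0 * exp (\<epsilon> / 2 * t powr \<beta> / \<beta> - \<epsilon> / 2 * t0 powr \<beta> / \<beta>) \<le> - G t"
    proof (rule exp_comparison[OF t, where K = "\<lambda>x. - G x" and K' = "\<lambda>x. - G' x" and g = "\<lambda>x. \<epsilon> / 2 * x powr (\<beta> - 1)"])
      fix x assume x: "t0 \<le> x" "x \<le> t"
      show "((\<lambda>x. - G x) has_real_derivative - G' x) (at x)" by (intro DERIV_minus dG)
      show "((\<lambda>x. \<epsilon> / 2 * x powr \<beta> / \<beta>) has_real_derivative \<epsilon> / 2 * x powr (\<beta> - 1)) (at x)"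
        using x t0 \<beta>1 by (auto intro!: derivative_eq_intros simp: field_simps)
      show "\<epsilon> / 2 * x powr (\<beta> - 1) * - G x \<le> - G' x" using Gle[OF x(1)] by (simp only: mult_minus_right neg_le_iff_le)
    qed
    then have "G t \<le> G t0 * exp (\<epsilon> / 2 * t powr \<beta> / \<beta> - \<epsilon> / 2 * t0 powr \<beta> / \<beta>)" by simp
    also have "\<dots> \<le> C * exp (\<epsilon> / 2 * t powr \<beta>)"
    proof (rule mult_mono)
      have z: "norm (of_real t0 * cis \<theta>) = t0" using t0 by (simp add: norm_mult)
      have "norm (V t0) \<le> max_modulus t0 (deriv A)"
        unfolding V_def norm_mult norm_cis mult_1
        using A z by (intro norm_le_max_modulus holomorphic_deriv) auto
      moreover have "norm (W t0) \<le> max_modulus t0 A"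
        unfolding W_def using A z by (intro norm_le_max_modulus) auto
      ultimately show "G t0 \<le> C" unfolding G_def C_def using t0
        by (intro add_mono mult_left_mono power_mono) auto
      have "\<epsilon> / 2 * t powr \<beta> / \<beta> \<le> \<epsilon> / 2 * t powr \<beta> / 1"
        using \<beta>1 e by (intro divide_left_mono) auto
      moreover have "\<epsilon> / 2 * t0 powr \<beta> / \<beta> \<ge> 0" using \<beta>1 e by simp
      ultimately show "exp (\<epsilon> / 2 * t powr \<beta> / \<beta> - \<epsilon> / 2 * t0 powr \<beta> / \<beta>) \<le> exp (\<epsilon> / 2 * t powr \<beta>)" by simp
      show "0 \<le> C" using t0 by (simp add: C_def)
    qed simp
    finally have Gt: "G t \<le> C * exp (\<epsilon> / 2 * t powr \<beta>)" .
    have "1 * (norm a * (norm (W t))\<^sup>2) \<le> t ^ n * (norm a * (norm (W t))\<^sup>2)"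
      using t t0 by (intro mult_right_mono one_le_power) auto
    also have "\<dots> \<le> G t" by (simp add: G_def mult_ac)
    also note Gt
    finally show ?thesis using a by (simp add: W_def field_simps)
  qed
  have "filterlim (\<lambda>t::real. t powr \<beta>) at_top at_top"
  proof -
    have "\<beta> > 0" by (simp add: \<beta>_def add_nonneg_pos)
    then show ?thesis by real_asymp
  qed
  \<comment> \<open>The exponent \<epsilon>/2 in \<open>main\<close> is below the 2 \<epsilon> of
    the squared target; the difference absorbs the constant.\<close>
  moreover have "\<forall>\<^sub>F y in at_top. C / norm a * exp (\<epsilon> / 2 * y) \<le> (exp (\<epsilon> * y))\<^sup>2"
    using e by real_asymp
  ultimately have "\<forall>\<^sub>F t in at_top. C / norm a * exp (\<epsilon> / 2 * t powr \<beta>) \<le> (exp (\<epsilon> * t powr \<beta>))\<^sup>2"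
    by (rule eventually_compose_filterlim[rotated])
  then obtain t1 where t1: "\<And>t. t \<ge> t1 \<Longrightarrow> C / norm a * exp (\<epsilon> / 2 * t powr \<beta>) \<le> (exp (\<epsilon> * t powr \<beta>))\<^sup>2"
    unfolding eventually_at_top_linorder by blast
  show ?thesis
  proof (rule exI[of _ u], rule exI[of _ v], intro conjI exI[of _ "max t0 t1"] ballI allI impI)
    show "u < v" "v \<le> u + 1" using \<delta>(1) by (auto simp: u_def v_def)
    fix \<theta> t assume \<theta>: "\<theta> \<in> {u..v}" and t: "t \<ge> max t0 t1"
    have "(norm (A (of_real t * cis \<theta>)))\<^sup>2 \<le> (exp (\<epsilon> * t powr \<beta>))\<^sup>2"
      by (rule order_trans[OF main[OF \<theta>] t1]) (use t in auto)
    then show "norm (A (of_real t * cis \<theta>)) \<le> exp (\<epsilon> * t powr (real (degree P) / 2 + 1))"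
      unfolding \<beta>_def[symmetric] n_def[symmetric] by (rule power2_le_imp_le) simp
  qed
qed

text \<open>
  \<open>X\<close> and \<open>Y\<close> are the components of \<open>(W, W')\<close> along the approximate growing and decaying solutions,
  which behave like \<open>exp (l t\<^sup>\<beta> / \<beta>)\<close> and \<open>exp (- l t\<^sup>\<beta> / \<beta>)\<close>; the cone \<open>K > 0\<close> is forward invariant.
\<close>

lemma ray_cone_estimates:
  fixes l :: complex
  assumes A: "A holomorphic_on UNIV" and ode: "\<And>z. deriv (deriv A) z = - poly P z * A z"
  defines "n \<equiv> degree P"
  defines "h \<equiv> (\<lambda>t. t powr (real n / 2))"
  assumes l2: "l\<^sup>2 = - (lead_coeff P * cis (real (n + 2) * \<theta>))"
    and c: "c > 0" "c \<le> Re l" and t0: "t0 \<ge> 1" "real n / t0 \<le> c / 10"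
    and small: "\<And>z. norm z \<ge> t0 \<Longrightarrow> norm (poly P z - lead_coeff P * z ^ n) \<le> c * norm l / 20 * norm z ^ n"
  defines "W \<equiv> (\<lambda>t. A (of_real t * cis \<theta>))" and "V \<equiv> (\<lambda>t. cis \<theta> * deriv A (of_real t * cis \<theta>))"
  defines "X \<equiv> (\<lambda>t. l * h t * W t + V t)" and "Y \<equiv> (\<lambda>t. l * h t * W t - V t)"
  defines "K \<equiv> (\<lambda>t. (norm (X t))\<^sup>2 - 4 * (norm (Y t))\<^sup>2)"
  shows "t0 \<le> s \<Longrightarrow> s \<le> t \<Longrightarrow>
      K s * exp (c / (real n / 2 + 1) * (t powr (real n / 2 + 1) - s powr (real n / 2 + 1))) \<le> K t"
    and "t0 \<le> t \<Longrightarrow> (\<And>x. t0 \<le> x \<Longrightarrow> x \<le> t \<Longrightarrow> K x \<le> 0) \<Longrightarrow> norm (Y t) \<le> norm (Y t0)"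
    and "t > 0 \<Longrightarrow> X t + Y t = 2 * l * h t * W t"
proof -
  define Q where "Q t = - cis (2 * \<theta>) * poly P (of_real t * cis \<theta>)" for t
  \<comment> \<open>\<open>E1\<close> and \<open>E2\<close> are the errors in X' = l h X + E1 and Y'
    = - l h Y + E2. They come from replacing the coefficient by its leading term l^2 h^2 and from
    the derivative of h.\<close>
  define E1 where "E1 t = (Q t - l\<^sup>2 * (h t)\<^sup>2) * W t + l * (real n / (2 * t)) * h t * W t" for t
  define E2 where "E2 t = - (Q t - l\<^sup>2 * (h t)\<^sup>2) * W t + l * (real n / (2 * t)) * h t * W t" for t
  have l0: "norm l > 0" using c complex_Re_le_cmod[of l] by linarith
  have sum: "X t + Y t = 2 * l * h t * W t" for t by (simp add: X_def Y_def)
  show "X t + Y t = 2 * l * h t * W t" by (rule sum)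
  have dW: "(W has_vector_derivative V t) (at t)" for t
    using ray_derivatives(1)[OF A ode, of \<theta> t] by (simp add: W_def V_def)
  have dV: "(V has_vector_derivative Q t * W t) (at t)" for t
    using ray_derivatives(2)[OF A ode, of \<theta> t] by (simp add: W_def V_def Q_def)
  have dh: "(h has_real_derivative real n / (2 * t) * h t) (at t)" if "t > 0" for t
    unfolding h_def
    by (rule DERIV_cong[OF has_real_derivative_powr[OF that]]) (use that in \<open>simp add: powr_diff\<close>)
  have dhW: "((\<lambda>t. l * h t * W t) has_vector_derivative l * (real n / (2 * t)) * h t * W t + l * h t * V t) (at t)"
    if "t > 0" for t
  proof -
    have "((\<lambda>t. complex_of_real (h t)) has_vector_derivative of_real (real n / (2 * t) * h t)) (at t)"
      by (rule has_vector_derivative_of_real[OF dh[OF that]])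
    from has_vector_derivative_mult[OF has_vector_derivative_mult_right[OF this, of l] dW]
    show ?thesis by (rule has_vector_derivative_eq_rhs) (simp add: algebra_simps)
  qed
  have dX: "(X has_vector_derivative l * h t * X t + E1 t) (at t)" if "t > 0" for t
    unfolding X_def
    by (rule has_vector_derivative_eq_rhs[OF has_vector_derivative_add[OF dhW[OF that] dV]])
      (simp add: E1_def algebra_simps power2_eq_square)
  have dY: "(Y has_vector_derivative - l * h t * Y t + E2 t) (at t)" if "t > 0" for t
    unfolding Y_def
    by (rule has_vector_derivative_eq_rhs[OF has_vector_derivative_diff[OF dhW[OF that] dV]])
      (simp add: E2_def algebra_simps power2_eq_square)
  have E: "norm (E1 t) \<le> c / 20 * h t * (norm (X t) + norm (Y t))"
    "norm (E2 t) \<le> c / 20 * h t * (norm (X t) + norm (Y t))"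
    "h t \<ge> 1" if t: "t \<ge> t0" for t
  proof -
    have t1: "t \<ge> 1" using t t0 by simp
    show h1: "h t \<ge> 1" unfolding h_def using t1 by (intro ge_one_powr_ge_zero) auto
    have h2: "(h t)\<^sup>2 = t ^ n"
      using t1 by (simp add: h_def powr_power powr_realpow)
    have z: "norm (of_real t * cis \<theta>) = t" using t1 by (simp add: norm_mult)
    have "cis (real (n + 2) * \<theta>) = cis (2 * \<theta>) * cis \<theta> ^ n"
      unfolding Complex.DeMoivre cis_mult by (simp add: algebra_simps)
    then have "Q t - l\<^sup>2 * (h t)\<^sup>2 = - cis (2 * \<theta>) * (poly P (of_real t * cis \<theta>) - lead_coeff P * (of_real t * cis \<theta>) ^ n)"
      unfolding Q_def l2 using h2 by (simp add: algebra_simps flip: of_real_power)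
    then have "norm (Q t - l\<^sup>2 * (h t)\<^sup>2) = norm (poly P (of_real t * cis \<theta>) - lead_coeff P * (of_real t * cis \<theta>) ^ n)"
      by (simp add: norm_mult)
    also have "\<dots> \<le> c * norm l / 20 * (h t)\<^sup>2"
      using small[of "of_real t * cis \<theta>"] t z h2 by simp
    finally have q: "norm (Q t - l\<^sup>2 * (h t)\<^sup>2) \<le> c * norm l / 20 * (h t)\<^sup>2" .
    have "real n / t \<le> real n / t0" using t t0 by (intro divide_left_mono) auto
    moreover have "real n / (2 * t) = real n / t / 2" by simp
    ultimately have "real n / (2 * t) \<le> c / 20 * 1" using t0(2) by linarith
    also have "\<dots> \<le> c / 20 * h t" using c h1 by (intro mult_left_mono) auto
    finally have nt: "norm l * (real n / (2 * t)) * h t \<le> norm l * (c / 20 * h t) * h t"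
      using h1 by (intro mult_right_mono mult_left_mono) auto
    have W: "2 * norm l * h t * norm (W t) \<le> norm (X t) + norm (Y t)"
      using norm_triangle_ineq[of "X t" "Y t"] h1 unfolding sum by (simp add: norm_mult)
    have b: "norm (Q t - l\<^sup>2 * (h t)\<^sup>2) * norm (W t) + norm l * (real n / (2 * t)) * h t * norm (W t)
        \<le> c / 20 * h t * (norm (X t) + norm (Y t))"
    proof -
      have "norm (Q t - l\<^sup>2 * (h t)\<^sup>2) * norm (W t) + norm l * (real n / (2 * t)) * h t * norm (W t)
        \<le> (c * norm l / 20 * (h t)\<^sup>2) * norm (W t) + norm l * (c / 20 * h t) * h t * norm (W t)"
        by (intro add_mono mult_right_mono q nt norm_ge_zero)
      also have "\<dots> = c / 20 * h t * (2 * norm l * h t * norm (W t))"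
        by (simp add: power2_eq_square algebra_simps)
      also have "\<dots> \<le> c / 20 * h t * (norm (X t) + norm (Y t))"
        using W c h1 by (intro mult_left_mono) auto
      finally show ?thesis .
    qed
    have "norm (l * (real n / (2 * t)) * h t * W t) = norm l * (real n / (2 * t)) * h t * norm (W t)"
      using t1 h1 by (simp add: norm_mult norm_divide)
    note lower = this
    show "norm (E1 t) \<le> c / 20 * h t * (norm (X t) + norm (Y t))"
      unfolding E1_def by (rule order_trans[OF norm_triangle_ineq]) (use b lower in \<open>simp only: norm_mult\<close>)
    show "norm (E2 t) \<le> c / 20 * h t * (norm (X t) + norm (Y t))"
      unfolding E2_def
      by (rule order_trans[OF norm_triangle_ineq]) (use b lower in \<open>simp only: norm_mult norm_minus_cancel\<close>)
  qed
  define X2 where "X2 t = 2 * Re (cnj (X t) * (l * h t * X t + E1 t))" for t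
  define Y2 where "Y2 t = 2 * Re (cnj (Y t) * (- l * h t * Y t + E2 t))" for t
  have re: "Re (cnj u * (\<mu> * of_real k * u + e)) = Re \<mu> * k * (norm u)\<^sup>2 + Re (cnj u * e)" for u \<mu> e :: complex and k
    unfolding cmod_power2 by (simp add: algebra_simps power2_eq_square)
  have reb: "\<bar>Re (cnj u * e)\<bar> \<le> norm u * norm e" for u e :: complex
    using abs_Re_le_cmod[of "cnj u * e"] by (simp add: norm_mult)
  \<comment> \<open>With \<epsilon> = c h / 20 the errors are at most \<epsilon> (p + q), while the
    main rates are at least 20 \<epsilon>. The difference of the two sides is then at least
    \<epsilon> (18 p^2 + 232 q^2 - 10 p q), which is nonnegative.\<close>
  have KG: "c * h x * K x \<le> X2 x - 4 * Y2 x" and Yd: "K x \<le> 0 \<Longrightarrow> Y2 x \<le> 0" if x: "x \<ge> t0" for x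
  proof -
    define p q \<epsilon> where "p = norm (X x)" and "q = norm (Y x)" and "\<epsilon> = c / 20 * h x"
    have pq: "p \<ge> 0" "q \<ge> 0" "\<epsilon> > 0" using E(3)[OF x] c by (auto simp: p_def q_def \<epsilon>_def)
    have l: "20 * \<epsilon> \<le> Re l * h x" using E(3)[OF x] c by (simp add: \<epsilon>_def mult_right_mono)
    have e1: "\<bar>Re (cnj (X x) * E1 x)\<bar> \<le> p * (\<epsilon> * (p + q))"
      using order_trans[OF reb mult_left_mono[OF E(1)[OF x]]] by (simp add: p_def q_def \<epsilon>_def)
    have e2: "\<bar>Re (cnj (Y x) * E2 x)\<bar> \<le> q * (\<epsilon> * (p + q))"
      using order_trans[OF reb mult_left_mono[OF E(2)[OF x]]] by (simp add: p_def q_def \<epsilon>_def)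
    have lp: "20 * \<epsilon> * p\<^sup>2 \<le> Re l * h x * p\<^sup>2" and lq: "20 * \<epsilon> * q\<^sup>2 \<le> Re l * h x * q\<^sup>2"
      using l by (intro mult_right_mono; simp)+
    have X2: "X2 x \<ge> 2 * (20 * \<epsilon> * p\<^sup>2) - 2 * (p * (\<epsilon> * (p + q)))"
      unfolding X2_def re p_def[symmetric] using lp e1 by (simp add: abs_le_iff)
    have Y2: "Y2 x \<le> - 2 * (20 * \<epsilon> * q\<^sup>2) + 2 * (q * (\<epsilon> * (p + q)))"
      unfolding Y2_def re q_def[symmetric] using lq e2 by (simp add: abs_le_iff)
    have Kx: "K x = p\<^sup>2 - 4 * q\<^sup>2" by (simp add: K_def p_def q_def)
    have ep: "0 \<le> \<epsilon> * (p - q)\<^sup>2" "0 \<le> \<epsilon> * p\<^sup>2" "0 \<le> \<epsilon> * q\<^sup>2" using pq by auto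
    have "c * h x * K x = 20 * \<epsilon> * (p\<^sup>2 - 4 * q\<^sup>2)" by (simp add: \<epsilon>_def Kx)
    also have "\<dots> \<le> (2 * (20 * \<epsilon> * p\<^sup>2) - 2 * (p * (\<epsilon> * (p + q)))) - 4 * (- 2 * (20 * \<epsilon> * q\<^sup>2) + 2 * (q * (\<epsilon> * (p + q))))"
      using ep by (simp add: algebra_simps power2_eq_square)
    also have "\<dots> \<le> X2 x - 4 * Y2 x" by (rule diff_mono[OF X2 mult_left_mono[OF Y2]]) simp
    finally show "c * h x * K x \<le> X2 x - 4 * Y2 x" .
    \<comment> \<open>Outside the cone p is at most 2 q, so the error is at most 3 \<epsilon> q^2,
      against a decay of 20 \<epsilon> q^2.\<close>
    assume "K x \<le> 0"
    then have "p\<^sup>2 \<le> (2 * q)\<^sup>2" by (simp add: Kx power_mult_distrib)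
    then have "p \<le> 2 * q" by (rule power2_le_imp_le) (use pq in simp)
    then have "q * (\<epsilon> * (p + q)) \<le> q * (\<epsilon> * (3 * q))" using pq by (intro mult_left_mono) auto
    also have "\<dots> = 3 * (\<epsilon> * q\<^sup>2)" by (simp add: power2_eq_square)
    finally show "Y2 x \<le> 0" using Y2 ep(3) by linarith
  qed
  have dY2: "((\<lambda>t. (norm (Y t))\<^sup>2) has_real_derivative Y2 x) (at x)" if "x \<ge> t0" for x
    unfolding Y2_def using that t0 by (intro norm_square_has_derivative dY) simp
  have dK: "(K has_real_derivative X2 x - 4 * Y2 x) (at x)" if "x \<ge> t0" for x
    unfolding K_def
  proof (rule DERIV_diff[OF _ DERIV_cmult[OF dY2[OF that]]])
    show "((\<lambda>t. (norm (X t))\<^sup>2) has_real_derivative X2 x) (at x)"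
      unfolding X2_def using that t0 by (intro norm_square_has_derivative dX) simp
  qed
  show "K s * exp (c / (real n / 2 + 1) * (t powr (real n / 2 + 1) - s powr (real n / 2 + 1))) \<le> K t"
    if "t0 \<le> s" "s \<le> t" for s t
  proof -
    define b where "b = real n / 2 + 1"
    have b: "b \<ge> 1" by (simp add: b_def)
    have "K s * exp (c / b * t powr b - c / b * s powr b) \<le> K t"
    proof (rule exp_comparison[OF that(2), where g = "\<lambda>x. c * h x"])
      fix x assume x: "s \<le> x" "x \<le> t"
      show "(K has_real_derivative X2 x - 4 * Y2 x) (at x)" using x that by (intro dK) simp
      show "((\<lambda>x. c / b * x powr b) has_real_derivative c * h x) (at x)"
        using x that t0 b unfolding h_def by (auto intro!: derivative_eq_intros simp: b_def)
      show "c * h x * K x \<le> X2 x - 4 * Y2 x" using x that by (intro KG) simp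
    qed
    then show ?thesis by (simp add: b_def right_diff_distrib)
  qed
  show "norm (Y t) \<le> norm (Y t0)" if "t0 \<le> t" "\<And>x. t0 \<le> x \<Longrightarrow> x \<le> t \<Longrightarrow> K x \<le> 0" for t
  proof (rule power2_le_imp_le)
    show "(norm (Y t))\<^sup>2 \<le> (norm (Y t0))\<^sup>2"
      by (rule DERIV_nonpos_imp_nonincreasing[OF that(1)]) (use dY2 Yd that in blast)
  qed simp
qed

text \<open>On a small subsector without critical rays the cone estimates hold uniformly. If no ray
  there ever enters the cone, X is dominated by the nonincreasing |Y| and \<open>A\<close> is
  bounded. If one ray is inside the cone at one radius, so are its neighbours by continuity, and
  invariance of the cone makes \<open>K\<close> grow exponentially on all of them.\<close>

lemma sector_dichotomy:
  fixes P :: "complex poly" and A :: "complex \<Rightarrow> complex"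
  assumes P0: "P \<noteq> 0" and A: "A holomorphic_on UNIV"
    and ode: "\<And>z. deriv (deriv A) z = - poly P z * A z" and uv: "u < v"
  defines "\<beta> \<equiv> real (degree P) / 2 + 1"
  obtains (bounded) u' v' C t1 where "u \<le> u'" "u' < v'" "v' \<le> v" "v' \<le> u' + 1"
      "\<And>\<theta> t. \<theta> \<in> {u'..v'} \<Longrightarrow> t \<ge> t1 \<Longrightarrow> norm (A (of_real t * cis \<theta>)) \<le> C"
  | (growth) u' v' c t1 where "u \<le> u'" "u' < v'" "v' \<le> v" "v' \<le> u' + 1" "c > 0"
      "\<And>\<theta> t. \<theta> \<in> {u'..v'} \<Longrightarrow> t \<ge> t1 \<Longrightarrow> exp (c * t powr \<beta>) \<le> norm (A (of_real t * cis \<theta>))"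
proof -
  define n where "n = degree P"
  define l0 where "l0 = csqrt (- lead_coeff P)"
  have l0: "l0\<^sup>2 = - lead_coeff P" "l0 \<noteq> 0" using P0 by (auto simp: l0_def)
  have \<beta>: "\<beta> \<ge> 1" by (simp add: \<beta>_def)
  have "u < min v (u + 1)" using uv by simp
  then obtain \<theta>0 where \<theta>0: "u < \<theta>0" "\<theta>0 < min v (u + 1)" "Re (l0 * cis (\<beta> * \<theta>0)) \<noteq> 0"
    using noncritical_direction[OF l0(2), of \<beta> u "min v (u + 1)"] \<beta> by auto
  \<comment> \<open>Both square roots satisfy the same quadratic relation; this one has positive
    real part in the chosen direction and so belongs to the growing solution.\<close>
  define l1 where "l1 = (if Re (l0 * cis (\<beta> * \<theta>0)) > 0 then l0 else - l0)"
  define l where "l \<theta> = l1 * cis (\<beta> * \<theta>)" for \<theta>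
  define c where "c = Re (l \<theta>0) / 2"
  have c: "c > 0" using \<theta>0(3) by (auto simp: c_def l_def l1_def)
  have l2: "(l \<theta>)\<^sup>2 = - (lead_coeff P * cis (real (degree P + 2) * \<theta>))" for \<theta>
  proof -
    have "(cis (\<beta> * \<theta>))\<^sup>2 = cis (real (degree P + 2) * \<theta>)"
      unfolding Complex.DeMoivre by (simp add: \<beta>_def algebra_simps)
    moreover have "l1\<^sup>2 = - lead_coeff P" using l0 by (simp add: l1_def)
    ultimately show ?thesis by (simp add: l_def power_mult_distrib)
  qed
  have nl: "norm (l \<theta>) = norm l1" for \<theta> by (simp add: l_def norm_mult)
  have l1: "norm l1 > 0" using l0(2) by (auto simp: l1_def)
  have "isCont (\<lambda>\<theta>. Re (l \<theta>)) \<theta>0" unfolding l_def by (auto intro!: continuous_intros)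
  then obtain \<delta> where \<delta>: "\<delta> > 0" "\<And>\<theta>. \<bar>\<theta> - \<theta>0\<bar> < \<delta> \<Longrightarrow> \<bar>Re (l \<theta>) - Re (l \<theta>0)\<bar> < c"
    using c unfolding continuous_at_eps_delta dist_real_def by blast
  define u1 v1 where "u1 = max u (\<theta>0 - \<delta> / 2)" and "v1 = min (min v (u + 1)) (\<theta>0 + \<delta> / 2)"
  have uv1: "u \<le> u1" "u1 < v1" "v1 \<le> v" "v1 \<le> u + 1" using \<theta>0 \<delta>(1) by (auto simp: u1_def v1_def)
  have lc: "c \<le> Re (l \<theta>)" if "\<theta> \<in> {u1..v1}" for \<theta>
  proof -
    have "\<bar>\<theta> - \<theta>0\<bar> < \<delta>" using that \<delta>(1) by (auto simp: u1_def v1_def abs_less_iff)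
    from \<delta>(2)[OF this] show ?thesis unfolding c_def by linarith
  qed
  have "c * norm l1 / 20 > 0" using c l1 by simp
  then obtain r0 where r0: "r0 \<ge> 1"
    "\<And>z. norm z \<ge> r0 \<Longrightarrow> norm (poly P z - lead_coeff P * z ^ degree P) \<le> c * norm l1 / 20 * norm z ^ degree P"
    using poly_lead_term_approx[of "c * norm l1 / 20" P] by blast
  define t0 where "t0 = max r0 (10 * n / c)"
  have t0: "t0 \<ge> 1" using r0 by (simp add: t0_def)
  have nt0: "real (degree P) / t0 \<le> c / 10"
  proof -
    have "10 * n / c \<le> t0" by (simp add: t0_def)
    then show ?thesis using c t0 by (simp add: field_simps n_def)
  qed
  define h where "h t = t powr (real (degree P) / 2)" for t
  define W where "W \<theta> t = A (of_real t * cis \<theta>)" for \<theta> t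
  define V where "V \<theta> t = cis \<theta> * deriv A (of_real t * cis \<theta>)" for \<theta> t
  define X where "X \<theta> t = l \<theta> * h t * W \<theta> t + V \<theta> t" for \<theta> t
  define Y where "Y \<theta> t = l \<theta> * h t * W \<theta> t - V \<theta> t" for \<theta> t
  define K where "K \<theta> t = (norm (X \<theta> t))\<^sup>2 - 4 * (norm (Y \<theta> t))\<^sup>2" for \<theta> t
  have small: "norm (poly P z - lead_coeff P * z ^ degree P) \<le> c * norm (l \<theta>) / 20 * norm z ^ degree P"
    if "norm z \<ge> t0" for z \<theta> using r0(2)[of z] that by (simp add: nl t0_def)
  note cone = ray_cone_estimates[OF A ode l2 c lc t0 nt0 small, folded h_def W_def V_def, folded X_def Y_def, folded K_def, folded \<beta>_def]
  have h1: "h t \<ge> 1" if "t \<ge> 1" for t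
    unfolding h_def using that by (intro ge_one_powr_ge_zero) auto
  have XY: "2 * norm l1 * h t * norm (W \<theta> t) = norm (X \<theta> t + Y \<theta> t)" if "t \<ge> 1" for \<theta> t
    using h1[OF that] by (simp add: X_def Y_def norm_mult nl)
  show ?thesis
  proof (cases "\<forall>\<theta>\<in>{u1..v1}. \<forall>t\<ge>t0. K \<theta> t \<le> 0")
    case True
    define Y0 where "Y0 = norm l1 * h t0 * max_modulus t0 A + max_modulus t0 (deriv A)"
    show ?thesis
    proof (rule bounded[OF uv1(1,2,3)])
      show "v1 \<le> u1 + 1" using uv1 by simp
      fix \<theta> t assume \<theta>: "\<theta> \<in> {u1..v1}" and t: "t \<ge> t0"
      have t1: "t \<ge> 1" using t t0 by simp
      have "norm (Y \<theta> t) \<le> norm (Y \<theta> t0)"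
        by (rule cone(2)[OF \<theta> _ t]) (use True \<theta> in auto)
      also have "\<dots> \<le> norm (l \<theta> * h t0 * W \<theta> t0) + norm (V \<theta> t0)"
        unfolding Y_def by (rule norm_triangle_ineq4)
      also have "\<dots> \<le> Y0"
      proof -
        have z: "norm (of_real t0 * cis \<theta>) = t0" using t0 by (simp add: norm_mult)
        have "norm (V \<theta> t0) \<le> max_modulus t0 (deriv A)"
          unfolding V_def norm_mult norm_cis mult_1
          using A z by (intro norm_le_max_modulus holomorphic_deriv) auto
        moreover have "norm (W \<theta> t0) \<le> max_modulus t0 A"
          unfolding W_def using A z by (intro norm_le_max_modulus) auto
        moreover have "norm (l \<theta> * h t0 * W \<theta> t0) = norm l1 * h t0 * norm (W \<theta> t0)"
          using h1[OF t0] by (simp add: norm_mult nl)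
        ultimately show ?thesis
          unfolding Y0_def using h1[OF t0] by (auto intro!: add_mono mult_left_mono)
      qed
      finally have Y0: "norm (Y \<theta> t) \<le> Y0" .
      have "K \<theta> t \<le> 0" using True \<theta> t by blast
      then have "(norm (X \<theta> t))\<^sup>2 \<le> (2 * norm (Y \<theta> t))\<^sup>2" by (simp add: K_def power_mult_distrib)
      then have "norm (X \<theta> t) \<le> 2 * norm (Y \<theta> t)" by (rule power2_le_imp_le) simp
      then have "norm (X \<theta> t + Y \<theta> t) \<le> 3 * Y0"
        using norm_triangle_ineq[of "X \<theta> t" "Y \<theta> t"] Y0 by linarith
      then have "2 * norm l1 * h t * norm (W \<theta> t) \<le> 3 * Y0" using XY[OF t1] by simp
      moreover have "2 * norm l1 * 1 * norm (W \<theta> t) \<le> 2 * norm l1 * h t * norm (W \<theta> t)"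
        using h1[OF t1] by (intro mult_right_mono mult_left_mono) auto
      ultimately have "2 * norm l1 * norm (W \<theta> t) \<le> 3 * Y0" by simp
      then show "norm (A (of_real t * cis \<theta>)) \<le> 3 * Y0 / (2 * norm l1)"
        using l1 by (simp add: W_def field_simps)
    qed
  next
    case False
    then obtain \<theta>1 s where \<theta>1: "\<theta>1 \<in> {u1..v1}" and s: "s \<ge> t0" and K1: "K \<theta>1 s > 0" by force
    define \<kappa> where "\<kappa> = K \<theta>1 s / 2"
    have \<kappa>: "\<kappa> > 0" using K1 by (simp add: \<kappa>_def)
    have comp: "continuous_on UNIV (\<lambda>\<theta>. g (of_real s * cis \<theta>))" if "g holomorphic_on UNIV" for g
      by (rule continuous_on_compose2[OF holomorphic_on_imp_continuous_on[OF that]])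
        (auto intro!: continuous_intros simp: cis_conv_exp)
    have "deriv A holomorphic_on UNIV" using A by (intro holomorphic_deriv) auto
    with A have "continuous_on UNIV (\<lambda>\<theta>. K \<theta> s)"
      unfolding K_def X_def Y_def W_def V_def l_def
      by (intro continuous_intros comp) (auto simp: cis_conv_exp intro!: continuous_intros)
    then have "isCont (\<lambda>\<theta>. K \<theta> s) \<theta>1" by (simp add: continuous_on_eq_continuous_at)
    then obtain d where d: "d > 0" "\<And>\<theta>. \<bar>\<theta> - \<theta>1\<bar> < d \<Longrightarrow> \<bar>K \<theta> s - K \<theta>1 s\<bar> < \<kappa>"
      using \<kappa> unfolding continuous_at_eps_delta dist_real_def by blast
    define u2 v2 where "u2 = max u1 (\<theta>1 - d / 2)" and "v2 = min v1 (\<theta>1 + d / 2)"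
    have uv2: "u1 \<le> u2" "u2 < v2" "v2 \<le> v1" using uv1 \<theta>1 d(1) by (auto simp: u2_def v2_def)
    have Ks: "K \<theta> s \<ge> \<kappa>" if "\<theta> \<in> {u2..v2}" for \<theta>
    proof -
      have "\<bar>\<theta> - \<theta>1\<bar> < d" using that d(1) by (auto simp: u2_def v2_def abs_less_iff)
      from d(2)[OF this] show ?thesis unfolding \<kappa>_def by linarith
    qed
    \<comment> \<open>\<open>K\<close> grows like exp (4 c' t^\<beta>), hence |X| like exp (2 c'
      t^\<beta>). Half of that rate pays for the constants and the factor h, which is estimated by
      t^\<beta> so that y = t^\<beta> is the only variable.\<close>
    define c' where "c' = c / (4 * \<beta>)"
    have c': "c' > 0" using c \<beta> by (simp add: c'_def)
    define y0 where "y0 = s powr \<beta>"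
    have "\<forall>\<^sub>F y in at_top. (4 * norm l1 * y * exp (c' * y))\<^sup>2 \<le> \<kappa> * exp (4 * c' * (y - y0))"
    proof -
      define M where "M = 16 * (norm l1)\<^sup>2 * exp (4 * c' * y0) / \<kappa>"
      have M: "M > 0" using l1 \<kappa> by (simp add: M_def)
      have "\<forall>\<^sub>F y in at_top. M * y\<^sup>2 \<le> exp (2 * c' * y)" using c' M by real_asymp
      then show ?thesis
      proof eventually_elim
        case (elim y)
        have "(4 * norm l1 * y * exp (c' * y))\<^sup>2 = M * y\<^sup>2 * (\<kappa> * exp (2 * c' * y - 4 * c' * y0))"
          using \<kappa> by (simp add: M_def power_mult_distrib exp_diff exp_double[symmetric] mult.assoc)
        also have "\<dots> \<le> exp (2 * c' * y) * (\<kappa> * exp (2 * c' * y - 4 * c' * y0))"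
          using elim \<kappa> by (intro mult_right_mono) auto
        also have "\<dots> = \<kappa> * exp (4 * c' * (y - y0))"
          by (simp add: exp_add[symmetric] algebra_simps)
        finally show ?case .
      qed
    qed
    moreover have "filterlim (\<lambda>t::real. t powr \<beta>) at_top at_top" using \<beta> by real_asymp
    ultimately have "\<forall>\<^sub>F t in at_top. (4 * norm l1 * t powr \<beta> * exp (c' * t powr \<beta>))\<^sup>2 \<le> \<kappa> * exp (4 * c' * (t powr \<beta> - y0))"
      by (rule eventually_compose_filterlim)
    then obtain t1 where t1: "\<And>t. t \<ge> t1 \<Longrightarrow>
        (4 * norm l1 * t powr \<beta> * exp (c' * t powr \<beta>))\<^sup>2 \<le> \<kappa> * exp (4 * c' * (t powr \<beta> - y0))"
      unfolding eventually_at_top_linorder by blast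
    show ?thesis
    proof (rule growth[OF _ uv2(2) _ _ c'])
      show "u \<le> u2" "v2 \<le> v" "v2 \<le> u2 + 1" using uv1 uv2 by simp_all
      fix \<theta> t assume \<theta>: "\<theta> \<in> {u2..v2}" and t: "t \<ge> max s t1"
      have t1': "t \<ge> 1" using t s t0 by simp
      have \<theta>': "\<theta> \<in> {u1..v1}" using \<theta> uv2 by simp
      have "\<kappa> * exp (4 * c' * (t powr \<beta> - y0)) \<le> K \<theta> s * exp (c / \<beta> * (t powr \<beta> - s powr \<beta>))"
        using Ks[OF \<theta>] \<beta> by (simp add: c'_def y0_def)
      also have "\<dots> \<le> K \<theta> t" by (rule cone(1)[OF \<theta>' _ s]) (use t in auto)
      finally have Kt: "\<kappa> * exp (4 * c' * (t powr \<beta> - y0)) \<le> K \<theta> t" .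
      have Kpos: "K \<theta> t > 0" by (rule less_le_trans[OF _ Kt]) (use \<kappa> in simp)
      then have "(2 * norm (Y \<theta> t))\<^sup>2 \<le> (norm (X \<theta> t))\<^sup>2" by (simp add: K_def power_mult_distrib)
      then have "2 * norm (Y \<theta> t) \<le> norm (X \<theta> t)" by (rule power2_le_imp_le) simp
      then have XW: "norm (X \<theta> t) \<le> 4 * norm l1 * h t * norm (W \<theta> t)"
        using XY[OF t1', of \<theta>] norm_diff_ineq[of "X \<theta> t" "Y \<theta> t"] by simp
      have "(4 * norm l1 * t powr \<beta> * exp (c' * t powr \<beta>))\<^sup>2 \<le> K \<theta> t"
        using t1[of t] t Kt by simp
      also have "\<dots> \<le> (norm (X \<theta> t))\<^sup>2" by (simp add: K_def)
      finally have "4 * norm l1 * t powr \<beta> * exp (c' * t powr \<beta>) \<le> norm (X \<theta> t)"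
        by (rule power2_le_imp_le) simp
      also note XW
      also have "4 * norm l1 * h t * norm (W \<theta> t) \<le> 4 * norm l1 * t powr \<beta> * norm (W \<theta> t)"
        unfolding h_def \<beta>_def using t1' by (intro mult_right_mono mult_left_mono powr_mono) auto
      finally show "exp (c' * t powr \<beta>) \<le> norm (A (of_real t * cis \<theta>))"
        using l1 t1' by (simp add: W_def)
    qed
  qed
qed

subsection \<open>Proximity function and logarithmic density\<close>

lemma nevanlinna_char_entire:
  assumes "f holomorphic_on UNIV"
  shows "nevanlinna_char r f = proximity r f"
proof -
  have "\<not> is_pole f z" for z
    using not_is_pole_holomorphic[of UNIV z f] assms by simp
  then have "pole_count t f = 0" for t by (simp add: pole_count_def)
  then show ?thesis by (simp add: nevanlinna_char_def integrated_pole_count_def)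
qed

lemma proximity_le:
  assumes f: "f holomorphic_on UNIV" and r: "r \<ge> 0" and M: "ln (max_modulus r f) > 0"
    and H: "H \<in> sets lborel" "H \<subseteq> {0..2*pi}"
    and half: "\<And>\<theta>. \<theta> \<in> H \<Longrightarrow> 2 * log_plus (norm (f (of_real r * cis \<theta>))) \<le> ln (max_modulus r f)"
  shows "proximity r f \<le> (1 - measure lborel H / (4 * pi)) * ln (max_modulus r f)"
proof -
  define L where "L = ln (max_modulus r f)"
  define g where "g \<theta> = log_plus (norm (f (of_real r * cis \<theta>)))" for \<theta>
  have gL: "g \<theta> \<le> L" for \<theta>
  proof -
    have "norm (f (of_real r * cis \<theta>)) \<le> max_modulus r f"
      using r by (intro norm_le_max_modulus f) (simp add: norm_mult)
    then have "ln (norm (f (of_real r * cis \<theta>))) \<le> L" if "f (of_real r * cis \<theta>) \<noteq> 0"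
      using that unfolding L_def by (intro ln_mono) auto
    then show ?thesis using M by (cases "f (of_real r * cis \<theta>) = 0") (auto simp: g_def log_plus_def L_def)
  qed
  have fin: "emeasure lborel H < \<infinity>"
    using emeasure_mono[OF H(2), of lborel] by (auto simp: less_top[symmetric] top_unique)
  have mH: "measure lborel H \<le> 2 * pi"
    using measure_mono_fmeasurable[OF H(2) H(1)] by (simp add: fmeasurable_def)
  define G where "G \<theta> = L * indicator {0..2*pi} \<theta> - L / 2 * indicator H \<theta>" for \<theta> :: real
  have iH: "integrable lborel (indicator H :: real \<Rightarrow> real)" 
    using H(1) fin by (intro integrable_real_indicator) auto
  have iI: "integrable lborel (indicator {0..2*pi} :: real \<Rightarrow> real)"
    by (intro integrable_real_indicator) auto
  have G: "integrable lborel G" "integral\<^sup>L lborel G = L * (2 * pi) - L / 2 * measure lborel H"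
    unfolding G_def using iH iI by simp_all
  have "(LINT \<theta>:{0..2*pi}|lborel. g \<theta>) \<le> L * (2 * pi) - L / 2 * measure lborel H"
  proof (cases "set_integrable lborel {0..2*pi} g")
    case True
    have "(LINT \<theta>:{0..2*pi}|lborel. g \<theta>) \<le> integral\<^sup>L lborel G"
      unfolding set_lebesgue_integral_def
    proof (rule integral_mono[OF _ G(1)])
      show "integrable lborel (\<lambda>\<theta>. indicator {0..2*pi} \<theta> *\<^sub>R g \<theta>)"
        using True by (simp add: set_integrable_def)
      show "indicator {0..2*pi} \<theta> *\<^sub>R g \<theta> \<le> G \<theta>" for \<theta>
        using gL[of \<theta>] half[of \<theta>] H(2) by (auto simp: G_def g_def L_def indicator_def)
    qed
    then show ?thesis by (simp add: G(2))
  next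
    \<comment> \<open>A non-integrable function has integral 0 by convention, and the right-hand
      side is nonnegative.\<close>
    case False
    then have "(LINT \<theta>:{0..2*pi}|lborel. g \<theta>) = 0"
      by (simp add: set_lebesgue_integral_def set_integrable_def not_integrable_integral_eq)
    moreover have "L / 2 * measure lborel H \<le> L / 2 * (2 * pi)"
      using M mH by (intro mult_left_mono) (auto simp: L_def)
    moreover have "L / 2 * (2 * pi) \<le> L * (2 * pi)" using M by (simp add: L_def)
    ultimately show ?thesis by linarith
  qed
  then have "(LINT \<theta>:{0..2*pi}|lborel. g \<theta>) / (2 * pi) \<le> (L * (2 * pi) - L / 2 * measure lborel H) / (2 * pi)"
    by (rule divide_right_mono) simp
  also have "\<dots> = (1 - measure lborel H / (4 * pi)) * L" by (simp add: field_simps)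
  finally show ?thesis by (simp add: proximity_def g_def L_def)
qed

text \<open>If log |B| were at most half of log M on a set of measure \<eta>, the quotient T / log M
  would stay below 1 - \<eta> / (4 pi). The sets \<open>H\<close> are quantified after r because the
  exceptional angles to be avoided vary with r.\<close>

lemma large_values_on_positive_measure:
  fixes F :: "real filter"
  assumes f: "transcendental_entire f" and F: "F \<le> at_top"
    and lim: "((\<lambda>r. nevanlinna_char r f / ln (max_modulus r f)) \<longlongrightarrow> 1) F" and \<eta>: "\<eta> > 0"
  shows "\<forall>\<^sub>F r in F. \<forall>H\<in>sets lborel. H \<subseteq> {0..2*pi} \<longrightarrow> \<eta> \<le> measure lborel H \<longrightarrow>
    (\<exists>\<theta>\<in>H. ln (max_modulus r f) < 2 * log_plus (norm (f (of_real r * cis \<theta>))))"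
proof -
  have hol: "f holomorphic_on UNIV" using f by (simp add: transcendental_entire_def)
  have "\<forall>\<^sub>F r in F. max_modulus r f > 1 * r powr 0"
    by (rule filter_leD[OF F]) (rule transcendental_growth[OF f])
  moreover have "\<forall>\<^sub>F r in F. r > 0" by (rule filter_leD[OF F]) (rule eventually_gt_at_top)
  moreover have "\<forall>\<^sub>F r in F. nevanlinna_char r f / ln (max_modulus r f) > 1 - \<eta> / (4 * pi)"
    using \<eta> by (intro order_tendstoD(1)[OF lim]) simp
  ultimately show ?thesis
  proof eventually_elim
    case (elim r)
    then have M: "ln (max_modulus r f) > 0" by simp
    show ?case
    proof (intro ballI impI, rule ccontr)
      fix H assume H: "H \<in> sets lborel" "H \<subseteq> {0..2*pi}" "\<eta> \<le> measure lborel H"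
        and no: "\<not> (\<exists>\<theta>\<in>H. ln (max_modulus r f) < 2 * log_plus (norm (f (of_real r * cis \<theta>))))"
      have half: "2 * log_plus (norm (f (of_real r * cis \<theta>))) \<le> ln (max_modulus r f)" if "\<theta> \<in> H" for \<theta>
        using no that by (meson not_less)
      have "nevanlinna_char r f \<le> (1 - measure lborel H / (4 * pi)) * ln (max_modulus r f)"
        unfolding nevanlinna_char_entire[OF hol]
        by (rule proximity_le[OF hol _ M H(1,2) half]) (use elim in simp)
      then have "nevanlinna_char r f / ln (max_modulus r f) \<le> 1 - measure lborel H / (4 * pi)"
        using M by (simp add: divide_le_eq)
      also have "\<dots> \<le> 1 - \<eta> / (4 * pi)" using H(3) by (simp add: divide_right_mono)
      finally show False using elim by simp
    qed
  qed
qed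

lemma integral_inverse_exp_interval:
  fixes a b :: real
  assumes "a \<le> b"
  shows "integrable lebesgue (\<lambda>t. indicator {exp a..exp b} t * (1 / t))"
    and "(LINT t|lebesgue. indicator {exp a..exp b} t * (1 / t)) = b - a"
proof -
  have D: "(ln has_real_derivative 1 / t) (at t)" if "exp a \<le> t" for t
    using that less_le_trans[OF exp_gt_zero] by (auto intro!: derivative_eq_intros)
  have c: "isCont (\<lambda>t. 1 / t) t" if "exp a \<le> t" for t :: real
    using that less_le_trans[OF exp_gt_zero] by (intro continuous_intros) force
  have "has_bochner_integral lborel (\<lambda>t. 1 / t * indicator {exp a..exp b} t) (ln (exp b) - ln (exp a))"
    by (rule has_bochner_integral_FTC_Icc_real) (use assms D c in auto)
  then have *: "has_bochner_integral lborel (\<lambda>t. indicator {exp a..exp b} t * (1 / t)) (b - a)"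
    by (simp add: mult.commute)
  have meas: "(\<lambda>t. indicator {exp a..exp b} t * (1 / t)) \<in> borel_measurable lborel" by measurable
  show "integrable lebesgue (\<lambda>t. indicator {exp a..exp b} t * (1 / t))"
    by (subst integrable_completion[OF meas]) (rule integrable.intros[OF *])
  show "(LINT t|lebesgue. indicator {exp a..exp b} t * (1 / t)) = b - a"
    by (subst integral_completion[OF meas]) (rule has_bochner_integral_integral_eq[OF *])
qed

text \<open>In the variable log r the logarithmic measure is length, and the part of
  \<open>E\<close> up to r is covered by the unit cells it meets, each of length 1. The summand
  \<open>j0 + 1\<close> allows an initial segment to be discarded later.\<close>

lemma log_density_count:
  assumes E: "E \<in> sets lebesgue" "upper_log_density E > 0"
  shows "\<exists>d>0. \<forall>j0 N0. \<exists>N\<ge>N0.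
    d * real N \<le> real (j0 + 1 + card {j\<in>{j0<..N}. \<exists>T\<in>{real j..real j + 1}. exp T \<in> E})"
proof -
  obtain d where d: "0 < ereal d" "ereal d < upper_log_density E"
    using ereal_dense2[OF E(2)] by blast
  define I where "I r = (LINT t:E \<inter> {1..r}|lebesgue. 1 / t)" for r :: real
  have fr: "\<exists>\<^sub>F r in at_top. d < 1 / ln r * I r"
  proof (rule ccontr)
    assume "\<not> ?thesis"
    then have "\<forall>\<^sub>F r in at_top. ereal (1 / ln r * I r) \<le> ereal d" by (simp add: frequently_def not_less)
    then have "upper_log_density E \<le> ereal d"
      unfolding upper_log_density_def I_def by (rule Limsup_bounded)
    with d show False by simp
  qed
  define hit where "hit j \<longleftrightarrow> (\<exists>T\<in>{real j..real j + 1}. exp T \<in> E)" for j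
  have "\<exists>N\<ge>N0. d * real N \<le> real (j0 + 1 + card {j\<in>{j0<..N}. hit j})" for j0 N0
  proof -
    have "\<exists>\<^sub>F r in at_top. d < 1 / ln r * I r \<and> r \<ge> exp (real N0 + 1)"
      by (rule frequently_eventually_frequently[OF fr eventually_ge_at_top])
    then obtain r where r: "d < 1 / ln r * I r" "r \<ge> exp (real N0 + 1)" by (blast dest: frequently_ex)
    have r0: "r > 0" using r(2) less_le_trans[OF exp_gt_zero] by blast
    have lr: "ln r \<ge> real N0 + 1" using r(2) r0 by (simp add: ln_ge_iff)
    define N where "N = nat \<lfloor>ln r\<rfloor>"
    have N: "N \<ge> N0" "real N \<le> ln r" using lr by (auto simp: N_def le_nat_floor)
    \<comment> \<open>The cells up to \<open>j0\<close> are included whether hit or not.\<close>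
    define S where "S = {0..j0} \<union> {j\<in>{j0<..N}. hit j}"
    have S: "finite S" "card S \<le> j0 + 1 + card {j\<in>{j0<..N}. hit j}"
      unfolding S_def using card_Un_le[of "{0..j0}" "{j\<in>{j0<..N}. hit j}"] by auto
    define G where "G t = (\<Sum>j\<in>S. indicator {exp (real j)..exp (real j + 1)} t * (1 / t))" for t :: real
    have G: "integrable lebesgue G" "(LINT t|lebesgue. G t) = real (card S)"
      unfolding G_def using S(1) integral_inverse_exp_interval[of "real _" "real _ + 1"]
      by (simp_all add: Bochner_Integration.integral_sum)
    have "I r \<le> real (card S)"
    proof (cases "set_integrable lebesgue (E \<inter> {1..r}) (\<lambda>t. 1 / t)")
      case True
      have "I r \<le> (LINT t|lebesgue. G t)"
        unfolding I_def set_lebesgue_integral_def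
      proof (rule integral_mono[OF _ G(1)])
        show "integrable lebesgue (\<lambda>t. indicator (E \<inter> {1..r}) t *\<^sub>R (1 / t))"
          using True by (simp add: set_integrable_def)
        fix t :: real
        \<comment> \<open>For t at most 0, where 1 / t is not positive, every indicator
          vanishes.\<close>
        have nn: "0 \<le> indicator {exp (real j)..exp (real j + 1)} t * (1 / t)" for j
        proof (cases "t > 0")
          case False
          then have "t \<notin> {exp (real j)..exp (real j + 1)}"
            using less_le_trans[OF exp_gt_zero] by auto
          then show ?thesis by simp
        qed simp
        show "indicator (E \<inter> {1..r}) t *\<^sub>R (1 / t) \<le> G t"
        proof (cases "t \<in> E \<inter> {1..r}")
          case True
          define j where "j = nat \<lfloor>ln t\<rfloor>"
          have lt: "ln t \<ge> 0" "ln t \<le> ln r" "exp (ln t) = t" using True by auto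
          have j: "real j \<le> ln t" "ln t \<le> real j + 1" using lt unfolding j_def by linarith+
          have "j \<le> N" unfolding j_def N_def using lt by (intro nat_mono floor_mono)
          moreover have "hit j" unfolding hit_def using j lt True by (intro bexI[of _ "ln t"]) auto
          ultimately have jS: "j \<in> S" by (auto simp: S_def)
          have "t \<in> {exp (real j)..exp (real j + 1)}"
            using j lt(3) by (metis atLeastAtMost_iff exp_le_cancel_iff)
          then have "1 / t = indicator {exp (real j)..exp (real j + 1)} t * (1 / t)" by simp
          also have "\<dots> \<le> G t" unfolding G_def
            by (rule member_le_sum[OF jS]) (use nn S(1) in auto)
          finally show ?thesis using True by simp
        next
          case False
          then show ?thesis using nn by (simp add: G_def sum_nonneg)
        qed
      qed
      then show ?thesis by (simp add: G(2))
    next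
      \<comment> \<open>Without integrability the integral is 0 by convention.\<close>
      case False
      then show ?thesis
        by (simp add: I_def set_lebesgue_integral_def set_integrable_def not_integrable_integral_eq)
    qed
    moreover have "d * ln r < I r" using r(1) lr by (simp add: field_simps)
    moreover have "d * real N \<le> d * ln r" using N d by (intro mult_left_mono) auto
    ultimately have "d * real N \<le> real (j0 + 1 + card {j\<in>{j0<..N}. hit j})" using S(2) by linarith
    with N(1) show ?thesis by blast
  qed
  with d show ?thesis unfolding hit_def by (intro exI[of _ d]) simp
qed

section \<open>Thin sectors and the growth of increments\<close>

text \<open>In the coordinate s = log z the sector is a rectangle of length 2. The added factor has
  modulus at most exp (- D / 2) on the outer side, which cancels the growth allowed there, and at
  most 1 on the other sides. One unit inside the outer side, undoing it costs only exp (D e^-k). The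
  angle condition is what keeps the cosine at least 1/2.\<close>

lemma thin_sector_bound:
  assumes f: "f holomorphic_on UNIV" and k: "k > 0" "k * (b - a) \<le> 2 * pi / 3" and y: "a \<le> y" "y \<le> b"
    and L: "L > 0" "max_modulus (exp (T - 2)) f \<le> L"
    and rays: "\<And>\<theta> t. \<theta> = a \<or> \<theta> = b \<Longrightarrow> t \<in> {exp (T - 2)..exp T} \<Longrightarrow> norm (f (of_real t * cis \<theta>)) \<le> L"
    and D: "D \<ge> 0" "max_modulus (exp T) f \<le> L * exp (D / 2)"
  shows "norm (f (of_real (exp (T - 1)) * cis y)) \<le> L * exp (D * exp (- k))"
proof -
  define mid where "mid = (a + b) / 2"
  define F where "F s = f (exp s) * exp (- of_real D * exp (of_real k * (s - of_real T - \<i> * of_real mid)))" for s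
  have "(f \<circ> exp) holomorphic_on UNIV"
    by (rule holomorphic_on_compose_gen[OF holomorphic_on_exp f]) auto
  then have F: "F holomorphic_on UNIV"
    unfolding F_def by (intro holomorphic_intros) (simp_all add: o_def)
  have nF: "norm (F s) = norm (f (exp s)) * exp (- D * (exp (k * (Re s - T)) * cos (k * (Im s - mid))))" for s
    by (simp add: F_def norm_mult Re_exp)
  have cosb: "1 / 2 \<le> cos (k * (Im s - mid))" if "a \<le> Im s" "Im s \<le> b" for s
  proof -
    have "\<bar>k * (Im s - mid)\<bar> \<le> k * ((b - a) / 2)"
      unfolding abs_mult using that k by (intro mult_mono) (auto simp: mid_def abs_le_iff field_simps)
    also have "\<dots> \<le> pi / 3" using k by simp
    finally have "cos (pi / 3) \<le> cos \<bar>k * (Im s - mid)\<bar>" using pi_gt_zero by (intro cos_monotone_0_pi_le) auto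
    then show ?thesis by (simp add: cos_60)
  qed
  define S where "S = cbox (Complex (T - 2) a) (Complex T b)"
  have "norm (F (Complex (T - 1) y)) \<le> L"
  proof (rule maximum_modulus_frontier[where S = S and f = F])
    show "F holomorphic_on interior S" "continuous_on (closure S) F"
      using F holomorphic_on_subset holomorphic_on_imp_continuous_on by blast+
    show "bounded S" by (simp add: S_def)
    show "Complex (T - 1) y \<in> S" using y by (simp add: S_def in_cbox_complex_iff)
    fix s assume "s \<in> frontier S"
    then have s: "T - 2 \<le> Re s" "Re s \<le> T" "a \<le> Im s" "Im s \<le> b"
      and "\<not> (T - 2 < Re s \<and> Re s < T \<and> a < Im s \<and> Im s < b)"
      by (auto simp: S_def frontier_cbox in_cbox_complex_iff in_box_complex_iff)
    then consider "Re s = T - 2" | "Re s = T" | "Im s = a \<or> Im s = b" by linarith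
    then show "norm (F s) \<le> L"
    proof cases
      case 2
      have "norm (F s) \<le> (L * exp (D / 2)) * exp (- (D / 2))"
        unfolding nF
      proof (rule mult_mono)
        show "norm (f (exp s)) \<le> L * exp (D / 2)"
          using norm_le_max_modulus[OF f, of "exp s" "exp T"] D(2) 2 by simp
        show "exp (- D * (exp (k * (Re s - T)) * cos (k * (Im s - mid)))) \<le> exp (- (D / 2))"
          using mult_left_mono[OF cosb[OF s(3,4)] D(1)] 2 by simp
      qed (use L in auto)
      also have "\<dots> = L" by (simp add: mult.assoc flip: exp_add)
      finally show ?thesis .
    next
      case 1
      have "norm (f (exp s)) \<le> L"
        using norm_le_max_modulus[OF f, of "exp s" "exp (T - 2)"] L(2) 1 by simp
      moreover have "exp (- D * (exp (k * (Re s - T)) * cos (k * (Im s - mid)))) \<le> 1"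
        using cosb[OF s(3,4)] D(1) by simp
      ultimately show ?thesis unfolding nF using mult_mono[of _ L _ 1] L by fastforce
    next
      case 3
      have "exp s = of_real (exp (Re s)) * cis (Im s)" by (simp add: exp_eq_polar)
      then have "norm (f (exp s)) \<le> L" using rays[OF 3, of "exp (Re s)"] s by simp
      moreover have "exp (- D * (exp (k * (Re s - T)) * cos (k * (Im s - mid)))) \<le> 1"
        using cosb[OF s(3,4)] D(1) by simp
      ultimately show ?thesis unfolding nF using mult_mono[of _ L _ 1] L by fastforce
    qed
  qed
  moreover have "exp (Complex (T - 1) y) = of_real (exp (T - 1)) * cis y" by (simp add: exp_eq_polar)
  ultimately have "norm (f (of_real (exp (T - 1)) * cis y)) * exp (- D * (exp (- k) * cos (k * (y - mid)))) \<le> L"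
    by (simp add: nF)
  moreover have "exp (- D * exp (- k)) \<le> exp (- D * (exp (- k) * cos (k * (y - mid))))"
    using D(1) by (simp add: mult_left_le mult_left_mono)
  ultimately have "norm (f (of_real (exp (T - 1)) * cis y)) * exp (- D * exp (- k)) \<le> L"
    using mult_left_mono[OF _ norm_ge_zero] order_trans by blast
  then show ?thesis by (simp add: exp_minus field_simps)
qed

lemma increments_grow:
  fixes \<sigma> :: "real \<Rightarrow> real"
  assumes mono: "\<And>s t. s \<le> t \<Longrightarrow> \<sigma> s \<le> \<sigma> t" and pos: "\<sigma> (real j0) \<ge> 1 / 2" and \<Gamma>: "\<Gamma> \<ge> 1"
    and gain: "\<And>T. T \<ge> real j0 \<Longrightarrow> exp T \<in> E \<Longrightarrow> \<Gamma> * \<sigma> (T - 1) \<le> \<sigma> T"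
  shows "\<Gamma> ^ card {j\<in>{j0<..N}. \<exists>T\<in>{real j..real j + 1}. exp T \<in> E} / 4 \<le> (\<sigma> (real (max j0 N) + 1))\<^sup>2"
proof -
  define hit where "hit j \<longleftrightarrow> (\<exists>T\<in>{real j..real j + 1}. exp T \<in> E)" for j
  \<comment> \<open>A hit in cell \<open>j\<close> compares \<open>\<sigma> (j + 1)\<close> with \<open>\<sigma> (j - 1)\<close>, so the product of consecutive values gains a factor at every hit.\<close>
  define S where "S j = \<sigma> (real j) * \<sigma> (real j + 1)" for j
  have s2: "\<sigma> t \<ge> 1 / 2" if "t \<ge> real j0" for t using mono[OF that] pos by linarith
  have main: "\<Gamma> ^ card {j\<in>{j0<..j0 + i}. hit j} / 4 \<le> S (j0 + i)" for i
  proof (induction i)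
    case 0
    have "\<sigma> (real j0) \<ge> 1 / 2" "\<sigma> (real j0 + 1) \<ge> 1 / 2"
      using s2[of "real j0"] s2[of "real j0 + 1"] by auto
    then have "1 / 2 * (1 / 2) \<le> S j0" unfolding S_def by (intro mult_mono) linarith+
    then show ?case by simp
  next
    case (Suc i)
    define j where "j = j0 + Suc i"
    have Sj: "S j = \<sigma> (real j) * \<sigma> (real j + 1)" "S (j0 + i) = \<sigma> (real j - 1) * \<sigma> (real j)"
      by (simp_all add: S_def j_def add_ac)
    have sj: "\<sigma> (real j) \<ge> 0" using s2[of "real j"] by (simp add: j_def)
    have "\<Gamma> ^ card {l\<in>{j0<..j}. hit l} / 4 \<le> S j"
    proof (cases "hit j")
      case True
      then obtain T where T: "real j \<le> T" "T \<le> real j + 1" "exp T \<in> E" by (auto simp: hit_def)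
      have "\<Gamma> * \<sigma> (real j - 1) \<le> \<Gamma> * \<sigma> (T - 1)" using T \<Gamma> by (intro mult_left_mono mono) auto
      also have "\<dots> \<le> \<sigma> T" using T by (intro gain) (auto simp: j_def)
      also have "\<dots> \<le> \<sigma> (real j + 1)" using T by (intro mono)
      finally have g: "\<Gamma> * \<sigma> (real j - 1) \<le> \<sigma> (real j + 1)" .
      have "\<Gamma> * S (j0 + i) \<le> S j" unfolding Sj using mult_right_mono[OF g sj] by (simp add: mult_ac)
      moreover have "\<Gamma> * (\<Gamma> ^ card {l\<in>{j0<..j0 + i}. hit l} / 4) \<le> \<Gamma> * S (j0 + i)"
        using Suc \<Gamma> by (intro mult_left_mono) auto
      moreover have "{l\<in>{j0<..j}. hit l} = insert j {l\<in>{j0<..j0 + i}. hit l}"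
        using True by (auto simp: j_def le_Suc_eq)
      then have "card {l\<in>{j0<..j}. hit l} = Suc (card {l\<in>{j0<..j0 + i}. hit l})"
        by (simp add: j_def)
      ultimately show ?thesis by simp
    next
      case False
      have "\<sigma> (real j - 1) * \<sigma> (real j) \<le> \<sigma> (real j + 1) * \<sigma> (real j)"
        using sj by (intro mult_right_mono mono) auto
      then have "S (j0 + i) \<le> S j" unfolding Sj by (simp add: mult_ac)
      moreover have "{l\<in>{j0<..j}. hit l} = {l\<in>{j0<..j0 + i}. hit l}"
        using False by (auto simp: j_def le_Suc_eq)
      ultimately show ?thesis using Suc by simp
    qed
    then show ?case by (simp only: j_def)
  qed
  \<comment> \<open>The maximum also covers N < j0, where no cell is counted.\<close>
  have j0N: "j0 + (N - j0) = max j0 N" by simp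
  have "{j\<in>{j0<..N}. hit j} = {j\<in>{j0<..max j0 N}. hit j}" by auto
  then have "\<Gamma> ^ card {j\<in>{j0<..N}. hit j} / 4 \<le> S (max j0 N)"
    using main[of "N - j0"] by (simp only: j0N)
  also have "\<dots> \<le> (\<sigma> (real (max j0 N) + 1))\<^sup>2"
    unfolding S_def power2_eq_square
  proof (rule mult_right_mono)
    have "1 / 2 \<le> \<sigma> (real (max j0 N) + 1)" by (rule s2) simp
    then show "0 \<le> \<sigma> (real (max j0 N) + 1)" by simp
  qed (simp add: mono)
  finally show ?thesis by (simp add: hit_def)
qed

subsection \<open>The comparison argument\<close>

lemma log_plus_mono:
  assumes "0 \<le> x" "x \<le> y"
  shows "log_plus x \<le> log_plus y"
proof (cases "x = 0")
  case False
  then have "ln x \<le> ln y" using assms by (intro ln_mono) auto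
  then show ?thesis unfolding log_plus_def by linarith
qed (simp add: log_plus_def)

text \<open>The proximity integral sees only angles in [0, 2 pi], and the estimate of exceptional
  angles requires an interval of length at most 1.\<close>

lemma interval_shift_into_period:
  assumes "u < (v :: real)"
  obtains u0 v0 and k :: int where "0 \<le> u0" "u0 < v0" "v0 \<le> 2 * pi" "v0 \<le> u0 + 1"
    "\<And>\<theta>. \<theta> \<in> {u0..v0} \<Longrightarrow> \<theta> + 2 * pi * k \<in> {u..v}"
proof -
  define k where "k = \<lfloor>u / (2 * pi)\<rfloor>"
  define u0 where "u0 = u - 2 * pi * k"
  define v0 where "v0 = min (v - 2 * pi * k) (min (2 * pi) (u0 + 1))"
  have "k \<le> u / (2 * pi)" "u / (2 * pi) < k + 1" unfolding k_def by linarith+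
  then have u0: "0 \<le> u0" "u0 < 2 * pi" by (simp_all add: u0_def field_simps)
  show ?thesis
  proof (rule that)
    show "0 \<le> u0" "u0 < v0" "v0 \<le> 2 * pi" "v0 \<le> u0 + 1"
      using u0 assms unfolding v0_def by (simp_all add: u0_def)
    show "\<theta> + 2 * pi * k \<in> {u..v}" if "\<theta> \<in> {u0..v0}" for \<theta>
      using that unfolding v0_def by (simp add: u0_def algebra_simps)
  qed
qed

lemma cis_shift: "cis (\<theta> + 2 * pi * of_int k) = cis \<theta>"
  using cis_multiple_2pi[of "real_of_int k"] by (simp add: cis_mult[symmetric] del: cis_multiple_2pi)

text \<open>Gronwall is applied to the square of the modulus, which is differentiable even at zeros
  of \<open>f\<close>.\<close>

lemma ray_growth_bound:
  assumes f: "f holomorphic_on UNIV" and st: "0 \<le> s" "s \<le> t"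
    and d: "\<And>x. x \<in> {s..t} \<Longrightarrow> norm (deriv f (of_real x * cis \<theta>)) \<le> \<kappa> * norm (f (of_real x * cis \<theta>))"
  shows "norm (f (of_real t * cis \<theta>)) \<le> norm (f (of_real s * cis \<theta>)) * exp (\<kappa> * (t - s))"
proof -
  define W where "W x = f (of_real x * cis \<theta>)" for x
  define V where "V x = cis \<theta> * deriv f (of_real x * cis \<theta>)" for x
  have dW: "(W has_vector_derivative V x) (at x)" for x
    unfolding W_def V_def by (rule entire_ray_derivative[OF f])
  have "- (norm (W s))\<^sup>2 * exp (2 * \<kappa> * t - 2 * \<kappa> * s) \<le> - (norm (W t))\<^sup>2"
  proof (rule exp_comparison[OF st(2), where K = "\<lambda>x. - (norm (W x))\<^sup>2" and g = "\<lambda>x. 2 * \<kappa>"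
        and K' = "\<lambda>x. - (2 * Re (cnj (W x) * V x))"])
    fix x assume x: "s \<le> x" "x \<le> t"
    show "((\<lambda>x. - (norm (W x))\<^sup>2) has_real_derivative - (2 * Re (cnj (W x) * V x))) (at x)"
      by (intro DERIV_minus norm_square_has_derivative dW)
    show "((\<lambda>x. 2 * \<kappa> * x) has_real_derivative 2 * \<kappa>) (at x)"
      by (auto intro!: derivative_eq_intros)
    have "Re (cnj (W x) * V x) \<le> norm (cnj (W x) * V x)" by (rule complex_Re_le_cmod)
    also have "\<dots> = norm (W x) * norm (deriv f (of_real x * cis \<theta>))" by (simp add: V_def norm_mult)
    also have "\<dots> \<le> norm (W x) * (\<kappa> * norm (W x))"
      using d[of x] x by (intro mult_left_mono) (auto simp: W_def)
    finally show "2 * \<kappa> * - (norm (W x))\<^sup>2 \<le> - (2 * Re (cnj (W x) * V x))"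
      by (simp add: power2_eq_square mult_ac)
  qed
  then have "(norm (W t))\<^sup>2 \<le> (norm (W s))\<^sup>2 * exp (2 * (\<kappa> * (t - s)))" by (simp add: algebra_simps)
  also have "\<dots> = (norm (W s) * exp (\<kappa> * (t - s)))\<^sup>2" by (simp add: power_mult_distrib exp_double)
  finally show ?thesis unfolding W_def by (rule power2_le_imp_le) simp
qed

text \<open>The situation to be refuted. The filter \<open>F\<close> stands for r tending to
  infinity inside \<open>E\<close>; \<open>F \<noteq> bot\<close> then says that \<open>E\<close> is
  unbounded.\<close>

definition finite_growth_solution ::
    "complex poly \<Rightarrow> (complex \<Rightarrow> complex) \<Rightarrow> (complex \<Rightarrow> complex) \<Rightarrow> (complex \<Rightarrow> complex) \<Rightarrow> real filter \<Rightarrow> bool" where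
  "finite_growth_solution P A B f F \<longleftrightarrow>
     P \<noteq> 0 \<and> A holomorphic_on UNIV \<and> (\<forall>z. deriv (deriv A) z = - poly P z * A z) \<and>
     transcendental_entire B \<and> f holomorphic_on UNIV \<and> (\<exists>z. f z \<noteq> 0) \<and>
     (\<forall>z. deriv (deriv f) z + A z * deriv f z + B z * f z = 0) \<and> finite_growth f \<and>
     F \<le> at_top \<and> F \<noteq> bot \<and>
     ((\<lambda>r. nevanlinna_char r B / ln (max_modulus r B)) \<longlongrightarrow> 1) F"

lemma finite_growth_solutionD:
  assumes "finite_growth_solution P A B f F"
  shows "P \<noteq> 0" "A holomorphic_on UNIV" "\<And>z. deriv (deriv A) z = - poly P z * A z"
    "transcendental_entire B" "f holomorphic_on UNIV" "\<exists>z. f z \<noteq> 0"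
    "\<And>z. deriv (deriv f) z + A z * deriv f z + B z * f z = 0" "finite_growth f"
    "F \<le> at_top" "F \<noteq> bot"
    "((\<lambda>r. nevanlinna_char r B / ln (max_modulus r B)) \<longlongrightarrow> 1) F"
  using assms unfolding finite_growth_solution_def by simp_all

text \<open>The window covers two units of log r, enough to compare two consecutive increments of
  log M. The loss of 1/4 in the logarithm lies below the value 1/2 that the increments eventually
  exceed.\<close>

definition calm_ray :: "(complex \<Rightarrow> complex) \<Rightarrow> real \<Rightarrow> real \<Rightarrow> bool" where
  "calm_ray f r \<theta> \<longleftrightarrow> (\<forall>t\<in>{exp (-2) * r..r}.
     norm (f (of_real t * cis \<theta>)) \<le> exp (1 / 4) * max_modulus (exp (-2) * r) f)"

lemma solution_nonconstant:
  assumes sol: "finite_growth_solution P A B f F"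
  shows "\<not> f constant_on UNIV"
proof
  note B = finite_growth_solutionD(4)[OF sol]
    and ode_f = finite_growth_solutionD(7)[OF sol]
    and f = finite_growth_solutionD(5,6)[OF sol]
  assume "f constant_on UNIV"
  then obtain c where c: "\<And>z. f z = c" by (auto simp: constant_on_def)
  then have "f = (\<lambda>_. c)" by auto
  then have "deriv f = (\<lambda>_. 0)" by auto
  then have "B z = 0" for z using ode_f[of z] f(2) c by auto
  then have "\<forall>z. B z = poly 0 z" by simp
  with B show False unfolding transcendental_entire_def by blast
qed

lemma deriv_nontrivial:
  assumes sol: "finite_growth_solution P A B f F"
  shows "\<exists>z. deriv f z \<noteq> 0"
proof (rule ccontr)
  note f = finite_growth_solutionD(5,6)[OF sol]
  assume "\<not> ?thesis"
  then have "(f has_field_derivative 0) (at z)" for z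
    using holomorphic_derivI[OF f(1) open_UNIV, of z] by simp
  then have "f constant_on UNIV"
    by (intro has_field_derivative_0_imp_constant_on) auto
  with solution_nonconstant[OF sol] show False by blast
qed

text \<open>Dividing the equation by f gives B = - (f'/f) (f''/f' + A), and both quotients are
  logarithmic derivatives of functions of finite order. The bound on f''/f' is kept because it is
  used again where \<open>A\<close> is large.\<close>

lemma coefficient_bound_on_rays:
  assumes sol: "finite_growth_solution P A B f F" and uv: "u \<le> v" "v \<le> u + 1" and e: "e > 0"
  shows "\<exists>K::nat. \<forall>\<^sub>F R in at_top. \<exists>Bad. compact Bad \<and> measure lborel Bad \<le> e \<and>
    (\<forall>\<theta>\<in>{u..v} - Bad. \<forall>t\<in>{1..R}.
       norm (deriv (deriv f) (of_real t * cis \<theta>)) \<le> R ^ K * norm (deriv f (of_real t * cis \<theta>)) \<and>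
       norm (B (of_real t * cis \<theta>)) \<le> R ^ K * (R ^ K + norm (A (of_real t * cis \<theta>))))"
proof -
  note ode_f = finite_growth_solutionD(7)[OF sol]
    and growth = finite_growth_solutionD(8)[OF sol]
    and f = finite_growth_solutionD(5,6)[OF sol]
  have df: "deriv f holomorphic_on UNIV" using f(1) by (intro holomorphic_deriv) auto
  obtain K1 :: nat where K1: "\<forall>\<^sub>F R in at_top. \<exists>Bad. compact Bad \<and> measure lborel Bad \<le> e / 2 \<and>
    (\<forall>\<theta>\<in>{u..v} - Bad. \<forall>t\<in>{1..R}. f (of_real t * cis \<theta>) \<noteq> 0 \<and>
       norm (deriv f (of_real t * cis \<theta>)) \<le> R ^ K1 * norm (f (of_real t * cis \<theta>)))"
    using log_deriv_rays[OF f growth uv, of "e / 2"] e by auto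
  obtain K2 :: nat where K2: "\<forall>\<^sub>F R in at_top. \<exists>Bad. compact Bad \<and> measure lborel Bad \<le> e / 2 \<and>
    (\<forall>\<theta>\<in>{u..v} - Bad. \<forall>t\<in>{1..R}. deriv f (of_real t * cis \<theta>) \<noteq> 0 \<and>
       norm (deriv (deriv f) (of_real t * cis \<theta>)) \<le> R ^ K2 * norm (deriv f (of_real t * cis \<theta>)))"
    using log_deriv_rays[OF df deriv_nontrivial[OF sol] finite_growth_deriv[OF f(1) growth] uv, of "e / 2"] e by auto
  define K where "K = max K1 K2"
  have "\<forall>\<^sub>F R in at_top. \<exists>Bad. compact Bad \<and> measure lborel Bad \<le> e \<and>
    (\<forall>\<theta>\<in>{u..v} - Bad. \<forall>t\<in>{1..R}.
       norm (deriv (deriv f) (of_real t * cis \<theta>)) \<le> R ^ K * norm (deriv f (of_real t * cis \<theta>)) \<and>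
       norm (B (of_real t * cis \<theta>)) \<le> R ^ K * (R ^ K + norm (A (of_real t * cis \<theta>))))"
    using K1 K2 eventually_ge_at_top[of 1]
  proof eventually_elim
    case (elim R)
    obtain Bad1 where Bad1: "compact Bad1" "measure lborel Bad1 \<le> e / 2"
      "\<And>\<theta> t. \<theta> \<in> {u..v} - Bad1 \<Longrightarrow> t \<in> {1..R} \<Longrightarrow> f (of_real t * cis \<theta>) \<noteq> 0 \<and>
       norm (deriv f (of_real t * cis \<theta>)) \<le> R ^ K1 * norm (f (of_real t * cis \<theta>))"
      using elim(1) by blast
    obtain Bad2 where Bad2: "compact Bad2" "measure lborel Bad2 \<le> e / 2"
      "\<And>\<theta> t. \<theta> \<in> {u..v} - Bad2 \<Longrightarrow> t \<in> {1..R} \<Longrightarrow>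
       norm (deriv (deriv f) (of_real t * cis \<theta>)) \<le> R ^ K2 * norm (deriv f (of_real t * cis \<theta>))"
      using elim(2) by blast
    have RK: "R ^ K1 \<le> R ^ K" "R ^ K2 \<le> R ^ K" "R ^ K \<ge> 1"
      using elim(3) by (auto simp: K_def intro!: power_increasing)
    show ?case
    proof (rule exI[of _ "Bad1 \<union> Bad2"], intro conjI ballI)
      show "compact (Bad1 \<union> Bad2)" using Bad1(1) Bad2(1) by (rule compact_Un)
      have "measure lborel (Bad1 \<union> Bad2) \<le> measure lborel Bad1 + measure lborel Bad2"
        using Bad1(1) Bad2(1) by (intro measure_Un_le) (auto simp: compact_imp_closed borel_closed)
      then show "measure lborel (Bad1 \<union> Bad2) \<le> e" using Bad1(2) Bad2(2) by linarith
      fix \<theta> t assume \<theta>: "\<theta> \<in> {u..v} - (Bad1 \<union> Bad2)" and t: "t \<in> {1..R}"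
      define z where "z = of_real t * cis \<theta>"
      have 1: "f z \<noteq> 0" "norm (deriv f z) \<le> R ^ K1 * norm (f z)"
        using Bad1(3)[of \<theta> t] \<theta> t by (auto simp: z_def)
      have 2: "norm (deriv (deriv f) z) \<le> R ^ K2 * norm (deriv f z)"
        using Bad2(3)[of \<theta> t] \<theta> t by (auto simp: z_def)
      have df_le: "norm (deriv f z) \<le> R ^ K * norm (f z)"
        using 1(2) RK(1) by (meson mult_right_mono norm_ge_zero order_trans)
      have ddf_le: "norm (deriv (deriv f) z) \<le> R ^ K * norm (deriv f z)"
        using 2 RK(2) by (meson mult_right_mono norm_ge_zero order_trans)
      then show "norm (deriv (deriv f) (of_real t * cis \<theta>)) \<le> R ^ K * norm (deriv f (of_real t * cis \<theta>))"
        by (simp add: z_def)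
      have "B z * f z = - (deriv (deriv f) z + A z * deriv f z)"
        using ode_f[of z] by algebra
      then have "norm (B z) * norm (f z) = norm (deriv (deriv f) z + A z * deriv f z)"
        by (metis norm_minus_cancel norm_mult)
      also have "\<dots> \<le> norm (deriv (deriv f) z) + norm (A z) * norm (deriv f z)"
        by (metis norm_mult norm_triangle_ineq)
      also have "\<dots> \<le> (R ^ K + norm (A z)) * norm (deriv f z)"
        using ddf_le by (simp add: distrib_right)
      also have "\<dots> \<le> (R ^ K + norm (A z)) * (R ^ K * norm (f z))"
        using df_le RK(3) by (intro mult_left_mono) auto
      finally have "norm (B z) * norm (f z) \<le> (R ^ K * (R ^ K + norm (A z))) * norm (f z)"
        by (simp add: mult_ac)
      then have "norm (B z) \<le> R ^ K * (R ^ K + norm (A z))" using 1(1) by simp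
      then show "norm (B (of_real t * cis \<theta>)) \<le> R ^ K * (R ^ K + norm (A (of_real t * cis \<theta>)))"
        by (simp add: z_def)
    qed
  qed
  then show ?thesis by blast
qed

lemma measure_interval_minus:
  assumes "compact Bad" "u \<le> (v :: real)"
  shows "v - u - measure lborel Bad \<le> measure lborel ({u..v} - Bad)"
proof -
  have B: "Bad \<in> sets lborel" using assms(1) by (simp add: compact_imp_closed borel_closed)
  have "measure lborel {u..v} \<le> measure lborel ({u..v} \<union> Bad)"
    using assms(1) by (intro measure_mono_fmeasurable fmeasurable_compact compact_Un) auto
  also have "{u..v} \<union> Bad = ({u..v} - Bad) \<union> Bad" by auto
  also have "measure lborel \<dots> \<le> measure lborel ({u..v} - Bad) + measure lborel Bad"
    using B by (intro measure_Un_le) auto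
  finally show ?thesis using assms(2) by simp
qed

text \<open>The good angles in the sector have measure bounded below, so one of them also carries a
  large value of \<open>B\<close>; there the growth of \<open>B\<close> is limited by
  \<open>A\<close>.\<close>

lemma max_modulus_B_le_A:
  assumes sol: "finite_growth_solution P A B f F" and "u < v"
  shows "\<exists>K::nat. \<forall>\<^sub>F r in F. \<exists>\<theta>\<in>{u..v}.
    ln (max_modulus r B) < 2 * log_plus (r ^ K * (r ^ K + norm (A (of_real r * cis \<theta>))))"
proof -
  note B = finite_growth_solutionD(4)[OF sol]
    and char = finite_growth_solutionD(11)[OF sol]
    and F = finite_growth_solutionD(9,10)[OF sol]
  obtain u0 v0 and k :: int where uv0: "0 \<le> u0" "u0 < v0" "v0 \<le> 2 * pi" "v0 \<le> u0 + 1"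
    "\<And>\<theta>. \<theta> \<in> {u0..v0} \<Longrightarrow> \<theta> + 2 * pi * k \<in> {u..v}"
    using interval_shift_into_period[OF assms(2)] by blast
  \<comment> \<open>Exceptional angles may use half of the sector; the other half still has measure
    at least \<open>e\<close>.\<close>
  define e where "e = (v0 - u0) / 2"
  have e: "e > 0" using uv0 by (simp add: e_def)
  obtain K :: nat where K: "\<forall>\<^sub>F R in at_top. \<exists>Bad. compact Bad \<and> measure lborel Bad \<le> e \<and>
    (\<forall>\<theta>\<in>{u0..v0} - Bad. \<forall>t\<in>{1..R}.
       norm (deriv (deriv f) (of_real t * cis \<theta>)) \<le> R ^ K * norm (deriv f (of_real t * cis \<theta>)) \<and>
       norm (B (of_real t * cis \<theta>)) \<le> R ^ K * (R ^ K + norm (A (of_real t * cis \<theta>))))"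
    using coefficient_bound_on_rays[OF sol less_imp_le[OF uv0(2)] uv0(4) e] by blast
  have "\<forall>\<^sub>F r in F. \<exists>\<theta>\<in>{u..v}.
    ln (max_modulus r B) < 2 * log_plus (r ^ K * (r ^ K + norm (A (of_real r * cis \<theta>))))"
    using filter_leD[OF F(1) K] filter_leD[OF F(1) eventually_ge_at_top[of 1]]
      large_values_on_positive_measure[OF B F(1) char e]
  proof eventually_elim
    case (elim r)
    then obtain Bad where Bad: "compact Bad" "measure lborel Bad \<le> e"
      "\<And>\<theta> t. \<theta> \<in> {u0..v0} - Bad \<Longrightarrow> t \<in> {1..r} \<Longrightarrow>
         norm (B (of_real t * cis \<theta>)) \<le> r ^ K * (r ^ K + norm (A (of_real t * cis \<theta>)))" by blast
    define H where "H = {u0..v0} - Bad"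
    have "Bad \<in> sets lborel" using Bad(1) by (simp add: compact_imp_closed borel_closed)
    then have "H \<in> sets lborel" by (simp add: H_def)
    moreover have "H \<subseteq> {0..2*pi}" using uv0 by (auto simp: H_def)
    moreover have "e \<le> measure lborel H"
      using measure_interval_minus[OF Bad(1), of u0 v0] uv0 Bad(2) by (simp add: H_def e_def)
    ultimately obtain \<theta> where \<theta>: "\<theta> \<in> H"
      "ln (max_modulus r B) < 2 * log_plus (norm (B (of_real r * cis \<theta>)))"
      using elim(3) by blast
    have "norm (B (of_real r * cis \<theta>)) \<le> r ^ K * (r ^ K + norm (A (of_real r * cis \<theta>)))"
      using Bad(3)[of \<theta> r] \<theta>(1) elim(2) by (simp add: H_def)
    then have "log_plus (norm (B (of_real r * cis \<theta>))) \<le> log_plus (r ^ K * (r ^ K + norm (A (of_real r * cis \<theta>))))"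
      by (intro log_plus_mono) auto
    with \<theta>(2) have "ln (max_modulus r B) < 2 * log_plus (r ^ K * (r ^ K + norm (A (of_real r * cis \<theta>))))" by linarith
    moreover have "\<theta> + 2 * pi * k \<in> {u..v}" using uv0(5) \<theta>(1) by (simp add: H_def)
    ultimately show ?case using cis_shift by (intro bexI[of _ "\<theta> + 2 * pi * k"]) simp_all
  qed
  then show ?thesis by blast
qed

text \<open>A bounded \<open>A\<close> would make log M(r,B) of order log r along \<open>F\<close>,
  contrary to the superpolynomial growth of \<open>B\<close> at all large radii.\<close>

lemma no_bounded_sector:
  assumes sol: "finite_growth_solution P A B f F" and "u < v"
    and bd: "\<And>\<theta> t. \<theta> \<in> {u..v} \<Longrightarrow> t \<ge> t1 \<Longrightarrow> norm (A (of_real t * cis \<theta>)) \<le> C"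
  shows False
proof -
  note B = finite_growth_solutionD(4)[OF sol]
    and F = finite_growth_solutionD(9,10)[OF sol]
  obtain K :: nat where K: "\<forall>\<^sub>F r in F. \<exists>\<theta>\<in>{u..v}.
    ln (max_modulus r B) < 2 * log_plus (r ^ K * (r ^ K + norm (A (of_real r * cis \<theta>))))"
    using max_modulus_B_le_A[OF sol assms(2)] by blast
  have C: "C \<ge> 0" using bd[of u t1] assms(2) order_trans[OF norm_ge_zero] by auto
  have "\<forall>\<^sub>F r in F. False"
    using K filter_leD[OF F(1) transcendental_growth[OF B, of 1 "2 * real (2 * K + 1)"]]
      filter_leD[OF F(1) eventually_ge_at_top[of "max t1 (1 + C)"]]
  proof eventually_elim
    case (elim r)
    then have r: "r \<ge> t1" "r \<ge> 1 + C" "r \<ge> 1" using C by auto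
    obtain \<theta> where \<theta>: "\<theta> \<in> {u..v}"
      "ln (max_modulus r B) < 2 * log_plus (r ^ K * (r ^ K + norm (A (of_real r * cis \<theta>))))"
      using elim(1) by blast
    have "r ^ K * (r ^ K + norm (A (of_real r * cis \<theta>))) \<le> r ^ K * (r ^ K + r ^ K * C)"
    proof (intro mult_left_mono add_left_mono)
      have "norm (A (of_real r * cis \<theta>)) \<le> 1 * C" using bd[OF \<theta>(1) r(1)] by simp
      also have "\<dots> \<le> r ^ K * C" using r C by (intro mult_right_mono one_le_power)
      finally show "norm (A (of_real r * cis \<theta>)) \<le> r ^ K * C" .
    qed (use r in simp)
    also have "\<dots> = r ^ K * r ^ K * (1 + C)" by (simp add: algebra_simps)
    also have "\<dots> \<le> r ^ K * r ^ K * r" using r by (intro mult_left_mono) auto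
    also have "\<dots> = r ^ (2 * K + 1)" by (simp add: mult_2 power_add)
    finally have "log_plus (r ^ K * (r ^ K + norm (A (of_real r * cis \<theta>)))) \<le> log_plus (r ^ (2 * K + 1))"
      using r by (intro log_plus_mono) auto
    also have "\<dots> = real (2 * K + 1) * ln r" using r by (simp add: log_plus_def ln_realpow del: power_Suc)
    finally have "ln (max_modulus r B) < 2 * (real (2 * K + 1) * ln r)" using \<theta>(2) by linarith
    moreover have "2 * real (2 * K + 1) * ln r \<le> ln (max_modulus r B)"
    proof -
      have "2 * real (2 * K + 1) * ln r = ln (r powr (2 * real (2 * K + 1)))"
        using r by (simp add: ln_powr)
      also have "\<dots> \<le> ln (max_modulus r B)" using elim(2) r by (intro ln_mono) auto
      finally show ?thesis .
    qed
    ultimately show False by linarith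
  qed
  then show False using F(2) by (simp add: eventually_False)
qed

lemma max_modulus_B_small:
  assumes sol: "finite_growth_solution P A B f F" and \<epsilon>: "\<epsilon> > 0"
  shows "\<forall>\<^sub>F r in F. max_modulus r B \<le> exp (\<epsilon> * r powr (real (degree P) / 2 + 1))"
proof -
  note P0 = finite_growth_solutionD(1)[OF sol]
    and A = finite_growth_solutionD(2)[OF sol]
    and ode_A = finite_growth_solutionD(3)[OF sol]
    and B = finite_growth_solutionD(4)[OF sol]
    and F = finite_growth_solutionD(9,10)[OF sol]
  define \<beta> where "\<beta> = real (degree P) / 2 + 1"
  define a where "a = lead_coeff P"
  \<comment> \<open>The direction in which a z^(n+2) is positive.\<close>
  define \<theta>0 where "\<theta>0 = - Arg a / real (degree P + 2)"
  have "real (degree P + 2) * \<theta>0 = - Arg a" by (simp add: \<theta>0_def)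
  moreover have "a = of_real (norm a) * cis (Arg a)" using rcis_cmod_Arg[of a] by (simp add: rcis_def)
  then have "a * cis (- Arg a) = of_real (norm a) * (cis (Arg a) * cis (- Arg a))"
    by (metis mult.assoc)
  then have "a * cis (- Arg a) = of_real (norm a)" by (simp add: cis_mult)
  ultimately have "a * cis (real (degree P + 2) * \<theta>0) = of_real (norm a)" by simp
  \<comment> \<open>The product of r^K and r^K + |A| doubles the exponent \<epsilon>/4, and the
    factor 2 in front of \<open>log_plus\<close> doubles it again.\<close>
  then obtain u v t1 where uv: "u < v" and small: "\<And>\<theta> t. \<theta> \<in> {u..v} \<Longrightarrow> t \<ge> t1 \<Longrightarrow>
      norm (A (of_real t * cis \<theta>)) \<le> exp (\<epsilon> / 4 * t powr \<beta>)"
    using coefficient_small_near_critical_ray[OF P0 A ode_A, of \<theta>0 "\<epsilon> / 4"] \<epsilon>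
    unfolding a_def \<beta>_def by fastforce
  obtain K :: nat where K: "\<forall>\<^sub>F r in F. \<exists>\<theta>\<in>{u..v}.
    ln (max_modulus r B) < 2 * log_plus (r ^ K * (r ^ K + norm (A (of_real r * cis \<theta>))))"
    using max_modulus_B_le_A[OF sol uv] by blast
  have "\<forall>\<^sub>F r in at_top. 2 * r ^ K \<le> exp (\<epsilon> / 4 * r)" using \<epsilon> by real_asymp
  from filter_leD[OF F(1) this] K filter_leD[OF F(1) eventually_ge_at_top[of "max t1 1"]]
    filter_leD[OF F(1) transcendental_growth[OF B, of 0 0]]
  show ?thesis unfolding \<beta>_def[symmetric]
  proof eventually_elim
    case (elim r)
    then have r: "r \<ge> t1" "r \<ge> 1" by auto
    define y where "y = r powr \<beta>"
    have "r powr 1 \<le> y" unfolding y_def \<beta>_def using r by (intro powr_mono) auto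
    then have ry: "r \<le> y" using r by simp
    obtain \<theta> where \<theta>: "\<theta> \<in> {u..v}"
      "ln (max_modulus r B) < 2 * log_plus (r ^ K * (r ^ K + norm (A (of_real r * cis \<theta>))))"
      using elim(2) by blast
    have e: "2 * r ^ K \<le> exp (\<epsilon> / 4 * y)"
      by (rule order_trans[OF elim(1)]) (use ry \<epsilon> in simp)
    have "r ^ K * (r ^ K + norm (A (of_real r * cis \<theta>))) \<le> (exp (\<epsilon> / 4 * y) / 2) * (exp (\<epsilon> / 4 * y) + exp (\<epsilon> / 4 * y))"
    proof (intro mult_mono add_mono)
      have "0 \<le> r ^ K" using r by simp
      then show "r ^ K \<le> exp (\<epsilon> / 4 * y) / 2" "r ^ K \<le> exp (\<epsilon> / 4 * y)"
        "0 \<le> r ^ K + norm (A (of_real r * cis \<theta>))" using e by (linarith, linarith, simp)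
      show "norm (A (of_real r * cis \<theta>)) \<le> exp (\<epsilon> / 4 * y)"
        using small[OF \<theta>(1) r(1)] by (simp add: y_def)
    qed simp
    also have "\<dots> = exp (\<epsilon> / 2 * y)" by (simp add: exp_add[symmetric] algebra_simps)
    finally have "log_plus (r ^ K * (r ^ K + norm (A (of_real r * cis \<theta>)))) \<le> log_plus (exp (\<epsilon> / 2 * y))"
      using r by (intro log_plus_mono) auto
    also have "\<dots> = \<epsilon> / 2 * y" using ry r \<epsilon> by (simp add: log_plus_def)
    finally have "ln (max_modulus r B) \<le> \<epsilon> * y" using \<theta>(2) by linarith
    moreover have "max_modulus r B > 0" using elim(4) by simp
    ultimately show "max_modulus r B \<le> exp (\<epsilon> * r powr \<beta>)"
      unfolding y_def by (metis exp_le_cancel_iff exp_ln)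
  qed
qed

text \<open>Where \<open>A\<close> is exponentially large, the term f'' is absorbed by half of A f',
  so |f'/f| is at most 2 |B| / |A|. As \<open>B\<close> is of smaller exponential size, this is
  below 1 / (4 r), and integrating over a length at most r costs a factor exp (1/4).\<close>

lemma calm_rays_dense:
  assumes sol: "finite_growth_solution P A B f F" and "u < v"
  shows "\<forall>\<^sub>F r in F. \<exists>\<theta>\<in>{u..v}. calm_ray f r \<theta>"
proof -
  note P0 = finite_growth_solutionD(1)[OF sol]
    and A = finite_growth_solutionD(2)[OF sol]
    and ode_A = finite_growth_solutionD(3)[OF sol]
    and B = finite_growth_solutionD(4)[OF sol]
    and ode_f = finite_growth_solutionD(7)[OF sol]
    and f = finite_growth_solutionD(5,6)[OF sol]
    and F = finite_growth_solutionD(9,10)[OF sol]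
  define \<beta> where "\<beta> = real (degree P) / 2 + 1"
  show ?thesis
  proof (rule sector_dichotomy[OF P0 A ode_A assms(2), folded \<beta>_def])
    fix u' v' C t1
    assume "u' < v'" "\<And>\<theta> t. \<theta> \<in> {u'..v'} \<Longrightarrow> t1 \<le> t \<Longrightarrow> norm (A (of_real t * cis \<theta>)) \<le> C"
    then show ?thesis using no_bounded_sector[OF sol] by blast
  next
    fix u' v' c t1
    assume uv: "u \<le> u'" "u' < v'" "v' \<le> v" "v' \<le> u' + 1" and c: "c > 0"
      and gr: "\<And>\<theta> t. \<theta> \<in> {u'..v'} \<Longrightarrow> t1 \<le> t \<Longrightarrow> exp (c * t powr \<beta>) \<le> norm (A (of_real t * cis \<theta>))"
    define e where "e = (v' - u') / 2"
    have e: "e > 0" using uv by (simp add: e_def)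
    obtain K :: nat where K: "\<forall>\<^sub>F R in at_top. \<exists>Bad. compact Bad \<and> measure lborel Bad \<le> e \<and>
      (\<forall>\<theta>\<in>{u'..v'} - Bad. \<forall>t\<in>{1..R}.
         norm (deriv (deriv f) (of_real t * cis \<theta>)) \<le> R ^ K * norm (deriv f (of_real t * cis \<theta>)) \<and>
         norm (B (of_real t * cis \<theta>)) \<le> R ^ K * (R ^ K + norm (A (of_real t * cis \<theta>))))"
      using coefficient_bound_on_rays[OF sol less_imp_le[OF uv(2)] uv(4) e] by blast
    \<comment> \<open>The power of e^-2 converts the bound at radius r into exp (c/4 s^\<beta>) at
      the inner radius s = e^-2 r, where the lower bound for \<open>A\<close> is weakest.\<close>
    define \<epsilon> where "\<epsilon> = c / 4 * exp (-2) powr \<beta>"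
    have \<epsilon>: "\<epsilon> > 0" using c by (simp add: \<epsilon>_def)
    have "\<forall>\<^sub>F r in at_top. 2 * r ^ K \<le> exp (c * (exp (-2) * r))" using c by real_asymp
    moreover have "\<forall>\<^sub>F r in at_top. 8 * r \<le> exp (3 / 4 * c * (exp (-2) * r))" using c by real_asymp
    moreover have "\<forall>\<^sub>F r in at_top. max t1 1 \<le> exp (-2) * (r :: real)" by real_asymp
    ultimately have "\<forall>\<^sub>F r in at_top. 2 * r ^ K \<le> exp (c * (exp (-2) * r)) \<and>
        8 * r \<le> exp (3 / 4 * c * (exp (-2) * r)) \<and> max t1 1 \<le> exp (-2) * r"
      by (intro eventually_conj)
    from filter_leD[OF F(1) this] filter_leD[OF F(1) K] max_modulus_B_small[OF sol \<epsilon>, folded \<beta>_def]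
    show ?thesis
    proof eventually_elim
      case (elim r)
      define s where "s = exp (-2) * r"
      have s: "s \<ge> t1" "s \<ge> 1" "2 * r ^ K \<le> exp (c * s)" "8 * r \<le> exp (3 / 4 * c * s)"
        using elim(1) by (auto simp: s_def)
      have r0: "r > 0"
      proof (rule ccontr)
        assume "\<not> r > 0"
        then have "exp (-2) * r \<le> 0" by (intro mult_nonneg_nonpos) auto
        with s(2) show False by (simp add: s_def)
      qed
      have sr: "s \<le> r" using r0 by (simp add: s_def)
      obtain Bad where Bad: "compact Bad" "measure lborel Bad \<le> e"
        "\<And>\<theta> t. \<theta> \<in> {u'..v'} - Bad \<Longrightarrow> t \<in> {1..r} \<Longrightarrow>
          norm (deriv (deriv f) (of_real t * cis \<theta>)) \<le> r ^ K * norm (deriv f (of_real t * cis \<theta>))"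
        using elim(2) by blast
      have "{u'..v'} - Bad \<noteq> {}"
      proof
        assume "{u'..v'} - Bad = {}"
        then have "measure lborel ({u'..v'} - Bad) = 0" by (simp only: measure_empty)
        then show False
          using measure_interval_minus[OF Bad(1), of u' v'] uv Bad(2) e by (simp add: e_def field_simps)
      qed
      then obtain \<theta> where \<theta>: "\<theta> \<in> {u'..v'} - Bad" by blast
      define y where "y = s powr \<beta>"
      have "s powr 1 \<le> y" unfolding y_def \<beta>_def using s by (intro powr_mono) auto
      then have sy: "s \<le> y" using s by simp
      have eps: "\<epsilon> * r powr \<beta> = c / 4 * y"
        using r0 by (simp add: \<epsilon>_def y_def s_def powr_mult)
      have d: "norm (deriv f (of_real t * cis \<theta>)) \<le> 1 / (4 * r) * norm (f (of_real t * cis \<theta>))" if t: "t \<in> {s..r}" for t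
      proof -
        define z where "z = of_real t * cis \<theta>"
        have t1: "t \<ge> 1" using t s by simp
        have nz: "norm z = t" using t1 by (simp add: z_def norm_mult)
        have "s powr \<beta> \<le> t powr \<beta>" using t s by (intro powr_mono2) (auto simp: \<beta>_def)
        then have "exp (c * y) \<le> exp (c * t powr \<beta>)" using c by (simp add: y_def)
        also have "\<dots> \<le> norm (A z)" unfolding z_def using \<theta> t s by (intro gr) auto
        finally have Az: "exp (c * y) \<le> norm (A z)" .
        \<comment> \<open>The smallness of \<open>B\<close> is known only at the radius r itself;
          the maximum principle extends it to the whole window.\<close>
        have "norm (B z) \<le> max_modulus r B"
          using B t nz by (intro norm_le_max_modulus_cball) (auto simp: transcendental_entire_def)
        also have "\<dots> \<le> exp (c / 4 * y)" using elim(3) by (simp add: eps)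
        finally have Bz: "norm (B z) \<le> exp (c / 4 * y)" .
        have f2: "norm (deriv (deriv f) z) \<le> r ^ K * norm (deriv f z)"
          unfolding z_def using Bad(3)[OF \<theta>, of t] t t1 by simp
        have "A z * deriv f z = - (deriv (deriv f) z + B z * f z)"
          using ode_f[of z] by algebra
        then have "norm (A z) * norm (deriv f z) = norm (deriv (deriv f) z + B z * f z)"
          by (metis norm_minus_cancel norm_mult)
        also have "\<dots> \<le> norm (deriv (deriv f) z) + norm (B z) * norm (f z)"
          by (metis norm_mult norm_triangle_ineq)
        also have "\<dots> \<le> r ^ K * norm (deriv f z) + exp (c / 4 * y) * norm (f z)"
          using f2 Bz by (intro add_mono mult_right_mono) auto
        finally have 1: "norm (A z) * norm (deriv f z) \<le> r ^ K * norm (deriv f z) + exp (c / 4 * y) * norm (f z)" .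
        have "2 * r ^ K \<le> exp (c * y)"
          by (rule order_trans[OF s(3)]) (use sy c in simp)
        then have "2 * r ^ K * norm (deriv f z) \<le> exp (c * y) * norm (deriv f z)" by (rule mult_right_mono) simp
        moreover have "exp (c * y) * norm (deriv f z) \<le> norm (A z) * norm (deriv f z)"
          using Az by (rule mult_right_mono) simp
        ultimately have "exp (c * y) * norm (deriv f z) \<le> 2 * (exp (c / 4 * y) * norm (f z))"
          using 1 by linarith
        also have "\<dots> = exp (c * y) * (2 * exp (- (3 / 4 * c * y)) * norm (f z))"
          by (simp add: mult.assoc[symmetric] exp_add[symmetric])
        finally have "norm (deriv f z) \<le> 2 * exp (- (3 / 4 * c * y)) * norm (f z)" by simp
        also have "\<dots> \<le> 1 / (4 * r) * norm (f z)"
        proof (rule mult_right_mono)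
          have "8 * r \<le> exp (3 / 4 * c * y)"
            by (rule order_trans[OF s(4)]) (use sy c in simp)
          then show "2 * exp (- (3 / 4 * c * y)) \<le> 1 / (4 * r)"
            using r0 by (simp add: exp_minus field_simps)
        qed simp
        finally show ?thesis by (simp add: z_def)
      qed
      have "calm_ray f r \<theta>"
        unfolding calm_ray_def s_def[symmetric]
      proof
        fix t assume t: "t \<in> {s..r}"
        have "norm (f (of_real t * cis \<theta>)) \<le> norm (f (of_real s * cis \<theta>)) * exp (1 / (4 * r) * (t - s))"
          by (rule ray_growth_bound[OF f(1)]) (use s t d in auto)
        also have "\<dots> \<le> max_modulus s f * exp (1 / 4)"
        proof (rule mult_mono)
          show "norm (f (of_real s * cis \<theta>)) \<le> max_modulus s f"
            using s by (intro norm_le_max_modulus f) (simp add: norm_mult)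
          have "1 / (4 * r) * (t - s) \<le> 1 / (4 * r) * r" using r0 t s by (intro mult_left_mono) auto
          then show "exp (1 / (4 * r) * (t - s)) \<le> exp (1 / 4)" using r0 by simp
          show "0 \<le> max_modulus s f" using max_modulus_pos[OF f, of s] s by simp
        qed simp
        finally show "norm (f (of_real t * cis \<theta>)) \<le> exp (1 / 4) * max_modulus s f" by (simp add: mult.commute)
      qed
      then show ?case using \<theta> uv by (intro bexI[of _ \<theta>]) auto
    qed
  qed
qed

text \<open>Density holds for each fixed sector only from some r on. A finite partition of the
  circle makes this uniform, and calm rays in the two cells next to that of y enclose y.\<close>

lemma calm_rays_surround:
  assumes sol: "finite_growth_solution P A B f F" and \<delta>: "\<delta> > 0"
  shows "\<forall>\<^sub>F r in F. \<forall>y\<in>{0..2 * pi}. \<exists>a b. a \<le> y \<and> y \<le> b \<and> b - a \<le> \<delta> \<and> calm_ray f r a \<and> calm_ray f r b"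
proof -
  define h where "h = \<delta> / 3"
  have h: "h > 0" using \<delta> by (simp add: h_def)
  \<comment> \<open>One extra cell at each end, since the neighbours \<open>j - 1\<close> and
    \<open>j + 1\<close> are used; three cells have total width \<delta>.\<close>
  define J where "J = {-1..\<lfloor>2 * pi / h\<rfloor> + 1}"
  have "\<forall>\<^sub>F r in F. \<forall>j\<in>J. \<exists>\<theta>\<in>{real_of_int j * h..(real_of_int j + 1) * h}. calm_ray f r \<theta>"
    using h by (intro eventually_ball_finite ballI calm_rays_dense[OF sol]) (auto simp: J_def)
  then show ?thesis
  proof eventually_elim
    case (elim r)
    show ?case
    proof
      fix y assume y: "y \<in> {0..2 * pi}"
      define j where "j = \<lfloor>y / h\<rfloor>"
      have j: "real_of_int j \<le> y / h" "y / h < real_of_int j + 1" unfolding j_def by linarith+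
      then have jh: "real_of_int j * h \<le> y" "y \<le> (real_of_int j + 1) * h" using h by (simp_all add: field_simps)
      have "0 \<le> y / h" using y h by simp
      then have "0 \<le> j" unfolding j_def by simp
      moreover have "j \<le> \<lfloor>2 * pi / h\<rfloor>" unfolding j_def using y h by (intro floor_mono divide_right_mono) auto
      ultimately have "j - 1 \<in> J" "j + 1 \<in> J" by (auto simp: J_def)
      then obtain a b where a: "a \<in> {real_of_int (j - 1) * h..(real_of_int (j - 1) + 1) * h}" "calm_ray f r a"
        and b: "b \<in> {real_of_int (j + 1) * h..(real_of_int (j + 1) + 1) * h}" "calm_ray f r b"
        using elim by meson
      have "a \<le> y" "y \<le> b" "b - a \<le> \<delta>" using a(1) b(1) jh by (auto simp: h_def algebra_simps)
      with a b show "\<exists>a b. a \<le> y \<and> y \<le> b \<and> b - a \<le> \<delta> \<and> calm_ray f r a \<and> calm_ray f r b" by blast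
    qed
  qed
qed

text \<open>Every point of the middle circle lies in a thin sector between calm rays, where
  \<open>thin_sector_bound\<close> transmits only the fraction e^-k of the outer growth. Convexity
  expresses this growth through the last increment alone.\<close>

lemma increment_gain:
  assumes sol: "finite_growth_solution P A B f F" and k: "k > 0"
  defines "m \<equiv> (\<lambda>t. ln (max_modulus (exp t) f))"
  shows "\<forall>\<^sub>F r in F. m (ln r - 1) - m (ln r - 2) \<le> 1 / 4 + 4 * exp (- k) * (m (ln r) - m (ln r - 1))"
proof -
  note f = finite_growth_solutionD(5,6)[OF sol]
    and F = finite_growth_solutionD(9,10)[OF sol]
  have "2 * pi / 3 / k > 0" using k by simp
  from calm_rays_surround[OF sol this] filter_leD[OF F(1) eventually_gt_at_top[of 0]]
  show ?thesis
  proof eventually_elim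
    case (elim r)
    define T where "T = ln r"
    have eT: "exp T = r" "exp (T - 2) = exp (-2) * r" using elim(2) by (simp_all add: T_def exp_diff exp_minus field_simps)
    have pos: "max_modulus (exp t) f > 0" for t by (rule max_modulus_pos[OF f]) simp
    have em: "exp (m t) = max_modulus (exp t) f" for t using pos by (simp add: m_def)
    have mono: "m s \<le> m t" if "s \<le> t" for s t
      unfolding m_def using that pos by (intro ln_mono max_modulus_mono f) auto
    have conv: "m (T - 1) - m (T - 2) \<le> m T - m (T - 1)"
      using convex_on_increment_mono[OF convex_ln_max_modulus[OF f], of "T - 1" T 1] by (simp add: m_def)
    define L where "L = exp (1 / 4 + m (T - 2))"
    have L: "L > 0" "max_modulus (exp (T - 2)) f \<le> L" by (simp_all add: L_def flip: em)
    \<comment> \<open>The least nonnegative \<open>D\<close> with M at the outer radius at most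
      \<open>L * exp (D / 2)\<close>.\<close>
    define D where "D = 2 * max 0 (m T - (1 / 4 + m (T - 2)))"
    have D: "D \<ge> 0" "max_modulus (exp T) f \<le> L * exp (D / 2)"
      by (simp_all add: D_def L_def flip: em exp_add)
    have "max_modulus (exp (T - 1)) f \<le> L * exp (D * exp (- k))"
    proof (rule max_modulus_le)
      fix z :: complex assume z: "norm z = exp (T - 1)"
      define y where "y = Arg2pi z"
      have "y \<in> {0..2 * pi}" using Arg2pi[of z] by (auto simp: y_def)
      then obtain a b where ab: "a \<le> y" "y \<le> b" "b - a \<le> 2 * pi / 3 / k" "calm_ray f r a" "calm_ray f r b"
        using elim(1) by blast
      have "z = of_real (norm z) * cis y"
        using Arg2pi_eq[of z] by (simp add: y_def cis_conv_exp mult.commute)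
      then have "norm (f z) = norm (f (of_real (exp (T - 1)) * cis y))" using z by simp
      also have "\<dots> \<le> L * exp (D * exp (- k))"
      proof (rule thin_sector_bound[OF f(1) k _ ab(1,2) L _ D])
        show "k * (b - a) \<le> 2 * pi / 3" using ab(3) k by (simp add: field_simps)
        show "norm (f (of_real t * cis \<theta>)) \<le> L" if "\<theta> = a \<or> \<theta> = b" "t \<in> {exp (T - 2)..exp T}" for \<theta> t
          using ab(4,5) that unfolding calm_ray_def eT(2)[symmetric] unfolding eT(1)[symmetric]
          by (auto simp: L_def exp_add em)
      qed
      finally show "norm (f z) \<le> L * exp (D * exp (- k))" .
    qed simp
    also have "\<dots> = exp (1 / 4 + m (T - 2) + D * exp (- k))" by (simp add: L_def exp_add)
    finally have "m (T - 1) \<le> 1 / 4 + m (T - 2) + D * exp (- k)" by (simp flip: em)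
    \<comment> \<open>The growth over two units is at most twice the last increment, by
      \<open>conv\<close>; the other factor 2 is that in \<open>D\<close>.\<close>
    moreover have "D * exp (- k) \<le> 4 * (m T - m (T - 1)) * exp (- k)"
      using conv mono[of "T - 1" T] mono[of "T - 2" "T - 1"] by (intro mult_right_mono) (auto simp: D_def max_def)
    moreover have "4 * (m T - m (T - 1)) * exp (- k) = 4 * exp (- k) * (m T - m (T - 1))" by simp
    ultimately show ?case unfolding T_def[symmetric] by linarith
  qed
qed

text \<open>If all increments were below 1/2, M(r) would be O(r^(1/2)) along r = e^n, which forces
  an entire function to be constant.\<close>

lemma increments_eventually_half:
  assumes f: "f holomorphic_on UNIV" "\<exists>z. f z \<noteq> 0" and nc: "\<not> f constant_on UNIV"
  defines "m \<equiv> (\<lambda>t. ln (max_modulus (exp t) f))"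
  shows "\<exists>t. m t - m (t - 1) \<ge> 1 / 2"
proof (rule ccontr)
  assume "\<not> ?thesis"
  then have small: "m t - m (t - 1) < 1 / 2" for t by (simp add: not_le)
  have le: "m (real n) \<le> m 0 + real n / 2" for n
  proof (induction n)
    case (Suc n)
    then show ?case using small[of "real (Suc n)"] by (simp add: field_simps)
  qed simp
  have "\<forall>\<^sub>F n in sequentially. max_modulus (exp (real n)) f > exp (m 0) * exp (real n) powr (1 / 2)"
    by (rule eventually_compose_filterlim[OF nonconstant_growth[OF f(1) nc]]) (simp, real_asymp)
  then obtain n where n: "max_modulus (exp (real n)) f > exp (m 0) * exp (real n) powr (1 / 2)"
    using eventually_happens trivial_limit_sequentially by blast
  have "max_modulus (exp (real n)) f = exp (m (real n))"
    using max_modulus_pos[OF f, of "exp (real n)"] by (simp add: m_def)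
  also have "\<dots> \<le> exp (m 0 + real n / 2)" using le by simp
  also have "\<dots> = exp (m 0) * exp (real n) powr (1 / 2)" by (simp add: exp_add powr_def)
  finally show False using n by simp
qed

theorem theorem3:
  fixes P :: "complex poly" and A B f :: "complex \<Rightarrow> complex" and E :: "real set"
  assumes "P \<noteq> 0"
    and "solves_ode2 (\<lambda>_. 0) (poly P) A"
    and "\<exists>z. A z \<noteq> 0"
    and "transcendental_entire B"
    and "E \<in> sets lebesgue" and "E \<subseteq> {1..}"
    and "upper_log_density E > 0"
    and "((\<lambda>r. nevanlinna_char r B / ln (max_modulus r B)) \<longlongrightarrow> 1) (inf at_top (principal E))"
    and "solves_ode2 A B f"
    and "\<exists>z. f z \<noteq> 0"
  shows "growth_order f = \<infinity>"
proof (rule ccontr)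
  assume ord: "growth_order f \<noteq> \<infinity>"
  have A: "A holomorphic_on UNIV" and ode_A: "\<And>z. deriv (deriv A) z = - poly P z * A z"
    using assms(2) by (auto simp: solves_ode2_def eq_neg_iff_add_eq_0)
  have f: "f holomorphic_on UNIV" "\<exists>z. f z \<noteq> 0"
    and ode_f: "\<And>z. deriv (deriv f) z + A z * deriv f z + B z * f z = 0"
    using assms(9,10) by (auto simp: solves_ode2_def)
  have fg: "finite_growth f" by (rule growth_order_finite_growth[OF f ord])
  obtain d where d: "d > 0" and count: "\<And>j0 N0. \<exists>N\<ge>N0.
      d * real N \<le> real (j0 + 1 + card {j\<in>{j0<..N}. \<exists>T\<in>{real j..real j + 1}. exp T \<in> E})"
    using log_density_count[OF assms(5,7)] by blast
  define F where "F = inf at_top (principal E)"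
  have F: "F \<le> at_top" by (simp add: F_def)
  \<comment> \<open>If \<open>E\<close> were bounded, no cell beyond some \<open>j0\<close> would be
    hit, and the count of hits could not grow linearly.\<close>
  have F_bot: "F \<noteq> bot"
  proof
    assume "F = bot"
    then have "\<forall>\<^sub>F r in at_top. r \<notin> E"
      by (simp add: F_def trivial_limit_def eventually_inf_principal)
    then obtain r0 where r0: "\<And>r. r \<ge> r0 \<Longrightarrow> r \<notin> E" unfolding eventually_at_top_linorder by blast
    obtain j0 :: nat where j0: "r0 < real j0" using reals_Archimedean2 by blast
    have "exp T \<notin> E" if "T \<ge> real j" "j > j0" for T j
    proof (rule r0)
      have "real j0 < real j" using that by simp
      then show "r0 \<le> exp T" using exp_ge_add_one_self[of T] that(1) j0 by linarith
    qed
    then have none: "{j\<in>{j0<..N}. \<exists>T\<in>{real j..real j + 1}. exp T \<in> E} = {}" for N by auto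
    obtain N0 :: nat where N0: "real (j0 + 1) / d < real N0" using reals_Archimedean2 by blast
    obtain N where N: "N \<ge> N0" "d * real N \<le> real (j0 + 1)" using count[of N0 j0] unfolding none by auto
    have "d * real N0 \<le> d * real N" using N d by simp
    with N N0 d show False by (simp add: field_simps)
  qed
  have sol: "finite_growth_solution P A B f F"
    unfolding finite_growth_solution_def
    using assms(1,4) A ode_A f ode_f fg F F_bot assms(8)[folded F_def] by simp
  note gain = increment_gain[OF sol]
  define m where "m t = ln (max_modulus (exp t) f)" for t
  define \<sigma> where "\<sigma> t = m t - m (t - 1)" for t
  have pos: "max_modulus (exp t) f > 0" for t by (rule max_modulus_pos[OF f]) simp
  have m_mono: "m s \<le> m t" if "s \<le> t" for s t
    unfolding m_def using that pos by (intro ln_mono max_modulus_mono f) auto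
  have mono: "\<sigma> s \<le> \<sigma> t" if "s \<le> t" for s t
    using convex_on_increment_mono[OF convex_ln_max_modulus[OF f] that, of 1] by (simp add: \<sigma>_def m_def)
  obtain p :: nat where p: "\<forall>\<^sub>F r in at_top. max_modulus r f \<le> exp (r ^ p)"
    using fg unfolding finite_growth_def by blast
  \<comment> \<open>Up to a constant, d N hits gain exp (q d N) = exp ((2 p + 3) N), one unit of
    rate more than the square of exp ((p + 1) N) permits.\<close>
  define q where "q = real (2 * p + 3) / d"
  \<comment> \<open>Then 4 e^-k is half of e^-q. The other factor 2 is lost in absorbing the
    additive 1/4, which is at most half of \<sigma> (T - 1).\<close>
  define k where "k = q + ln 8"
  have q: "q > 0" using d by (simp add: q_def)
  have k: "k > 0" using q by (simp add: k_def add_pos_pos)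
  have ek: "exp (- k) = exp (- q) / 8" by (simp add: k_def exp_diff exp_minus field_simps)
  obtain t0 where t0: "\<sigma> t0 \<ge> 1 / 2"
    using increments_eventually_half[OF f] solution_nonconstant[OF sol]
    unfolding \<sigma>_def m_def by blast
  have "\<forall>\<^sub>F r in at_top. r \<in> E \<longrightarrow> m (ln r - 1) - m (ln r - 2) \<le> 1 / 4 + 4 * exp (- k) * (m (ln r) - m (ln r - 1))"
    using gain[OF k] unfolding F_def eventually_inf_principal m_def .
  then obtain r1 where r1: "\<And>r. r \<ge> r1 \<Longrightarrow> r \<in> E \<Longrightarrow>
      m (ln r - 1) - m (ln r - 2) \<le> 1 / 4 + 4 * exp (- k) * (m (ln r) - m (ln r - 1))"
    unfolding eventually_at_top_linorder by blast
  \<comment> \<open>The margin \<open>t0 + 1\<close> ensures that \<sigma> is already at least 1/2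
    at T - 1.\<close>
  obtain j0 :: nat where j0: "max (t0 + 1) r1 < real j0" using reals_Archimedean2 by blast
  have gain': "exp q * \<sigma> (T - 1) \<le> \<sigma> T" if T: "T \<ge> real j0" "exp T \<in> E" for T
  proof -
    have "\<sigma> (T - 1) \<ge> 1 / 2" using mono[of t0 "T - 1"] t0 j0 T by simp
    moreover have "\<sigma> (T - 1) \<le> 1 / 4 + 4 * exp (- k) * \<sigma> T"
    proof -
      have "r1 < real j0" using j0 by simp
      then have "exp T \<ge> r1" using exp_ge_add_one_self[of T] T(1) by linarith
      from r1[OF this T(2)] show ?thesis by (simp add: \<sigma>_def)
    qed
    ultimately have "\<sigma> (T - 1) \<le> exp (- q) * \<sigma> T" unfolding ek by simp
    then show ?thesis by (simp add: exp_minus field_simps)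
  qed
  have "\<forall>\<^sub>F x in at_top. max_modulus (exp x) f \<le> exp (exp x ^ p)"
    by (rule eventually_compose_filterlim[OF p exp_at_top])
  moreover have "\<forall>\<^sub>F x in at_top. exp x \<ge> 1 + \<bar>m 0\<bar>" by real_asymp
  \<comment> \<open>The exponent p + 1 instead of p absorbs the possibly negative constant
    \<open>m 0\<close>.\<close>
  ultimately have "\<forall>\<^sub>F x in at_top. \<sigma> x \<le> exp (real (p + 1) * x)"
    using eventually_ge_at_top[of 1]
  proof eventually_elim
    case (elim x)
    have "exp (m x) \<le> exp (exp x ^ p)" using elim(1) pos by (simp add: m_def)
    then have "m x \<le> exp (real p * x)" by (simp add: exp_of_nat_mult)
    moreover have "m 0 \<le> m (x - 1)" using elim(3) by (intro m_mono) simp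
    ultimately have "\<sigma> x \<le> exp (real p * x) * 1 + 1 * \<bar>m 0\<bar>" unfolding \<sigma>_def by linarith
    also have "\<dots> \<le> exp (real p * x) * 1 + exp (real p * x) * \<bar>m 0\<bar>"
      using elim(3) by (intro add_left_mono mult_right_mono) auto
    also have "\<dots> = exp (real p * x) * (1 + \<bar>m 0\<bar>)" by (simp add: distrib_left)
    also have "\<dots> \<le> exp (real p * x) * exp x" using elim(2) by (intro mult_left_mono) auto
    also have "\<dots> = exp (real (p + 1) * x)" by (simp add: exp_add[symmetric] distrib_right)
    finally show ?case .
  qed
  then obtain x0 where x0: "\<And>x. x \<ge> x0 \<Longrightarrow> \<sigma> x \<le> exp (real (p + 1) * x)"
    unfolding eventually_at_top_linorder by blast
  \<comment> \<open>The last entry collects the constants that remain when the lower and upper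
    bounds for \<sigma>^2 are compared; an N beyond it is contradictory.\<close>
  define b where "b = max (real j0) (max x0 (q * real (j0 + 1) + real (2 * p + 2) + ln 4))"
  obtain N0 :: nat where N0: "b < real N0" using reals_Archimedean2 by blast
  obtain N where N: "N \<ge> N0"
      "d * real N \<le> real (j0 + 1 + card {j\<in>{j0<..N}. \<exists>T\<in>{real j..real j + 1}. exp T \<in> E})"
    using count by blast
  define c where "c = card {j\<in>{j0<..N}. \<exists>T\<in>{real j..real j + 1}. exp T \<in> E}"
  have bN: "b < real N" using N0 N(1) by linarith
  have "real j0 < real N" using bN unfolding b_def by simp
  then have maxN: "max j0 N = N" by simp
  have "\<sigma> (real j0) \<ge> 1 / 2" using mono[of t0 "real j0"] t0 j0 by simp
  then have "exp q ^ c / 4 \<le> (\<sigma> (real (max j0 N) + 1))\<^sup>2"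
    unfolding c_def by (rule increments_grow[rotated, where \<Gamma> = "exp q"]) (use mono gain' q in auto)
  then have "exp q ^ c / 4 \<le> (\<sigma> (real N + 1))\<^sup>2" by (simp only: maxN)
  also have "\<dots> \<le> (exp (real (p + 1) * (real N + 1)))\<^sup>2"
  proof (rule power_mono)
    show "\<sigma> (real N + 1) \<le> exp (real (p + 1) * (real N + 1))" using bN by (intro x0) (simp add: b_def)
    show "0 \<le> \<sigma> (real N + 1)" unfolding \<sigma>_def using m_mono[of "real N" "real N + 1"] by simp
  qed
  finally have "exp (q * real c) / 4 \<le> exp (real (2 * p + 2) * (real N + 1))"
    by (simp add: exp_of_nat2_mult[symmetric] exp_double[symmetric] algebra_simps)
  then have "exp (q * real c) \<le> exp (real (2 * p + 2) * (real N + 1) + ln 4)"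
    by (simp add: exp_add)
  then have 1: "q * real c \<le> real (2 * p + 2) * (real N + 1) + ln 4" by simp
  have "q * (d * real N) \<le> q * (real (j0 + 1) + real c)" using N(2) q by (intro mult_left_mono) (auto simp: c_def)
  moreover have "q * d = real (2 * p + 3)" using d by (simp add: q_def)
  then have "q * (d * real N) = real (2 * p + 2) * real N + real N"
    by (simp add: distrib_right flip: mult.assoc)
  ultimately have "real N \<le> q * real (j0 + 1) + real (2 * p + 2) + ln 4"
    using 1 by (simp add: algebra_simps)
  with bN show False by (simp add: b_def)
qed

end
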